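(* Let $n\ge 3$. Let $U\subset \mathcal S^{n\times n}$ be an open set such that $O^{-1}UO=U$ for all $O\in O(n)$, and such that $U\cap\{M+tN \mid 0<t<\infty\}$ is convex for all $M\in\mathcal S^{n\times n}$ and all $N\in\mathcal S^{n\times n}_+$. Let $F\in C^1(U)$ satisfy: (a) $F(O^{-1}MO)=F(M)$ for all $M\in U$, $O\in O(n)$; (b) the matrix $\left(\frac{\partial F}{\partial M_{ij}}(M)\right)$ is positive definite for all $M\in U$; (c) for some $\delta>0$, $F(M)\ne 1$ for all $M\in U$ with $\|M\|<\delta$. Assume that $u\in C^2(B_2\setminus\{0\})$ satisfies $$u>0,\quad \Delta u\le 0,\quad A^u\in U,\quad F(A^u)=1\qquad\text{in } B_2\setminus\{0\}.$$ Then, for some constant $\epsilon>0$, $$u_{x,\lambda}(y)\le u(y)\qquad\text{for all } 0<\lambda<|x|\le\epsilon,\ |y-x|\ge\lambda,\ 0<|y|\le 1.$$ Consequently, for some positive constant $C$, $$\left|\frac{u(x)}{u(y)}-1\right|\le Cr\qquad\text{for all } 0<r=|x|=|y|<1 .$$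
   Context: $\mathcal S^{n\times n}$ is the set of real symmetric $n\times n$ matrices, $\mathcal S^{n\times n}_+$ the subset of positive definite ones, $O(n)$ the real orthogonal $n\times n$ matrices, $\|M\|=(\sum_{i,j}M_{ij}^2)^{1/2}$. $B_a(x)\subset\mathbb R^n$ is the ball of radius $a$ centered at $x$, $B_a=B_a(0)$. For a positive $C^2$ function $u$, $$A^u=-\frac{2}{n-2}u^{-\frac{n+2}{n-2}}\nabla^2u+\frac{2n}{(n-2)^2}u^{-\frac{2n}{n-2}}\nabla u\otimes\nabla u-\frac{2}{(n-2)^2}u^{-\frac{2n}{n-2}}|\nabla u|^2 I,$$ where $\nabla u$ is the gradient, $\nabla^2u$ the Hessian of $u$ and $I$ the identity matrix. For $x\in\mathbb R^n$ and $\lambda>0$, $$u_{x,\lambda}(y):=\left(\frac{\lambda}{|y-x|}\right)^{n-2}u\left(x+\frac{\lambda^2(y-x)}{|y-x|^2}\right).$$ *)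

theory Defs
  imports "HOL-Analysis.Analysis"
begin

definition sym_matrices :: "(real^'n^'n) set" where
  "sym_matrices = {M. transpose M = M}"

definition pos_def :: "real^'n^'n \<Rightarrow> bool" where
  "pos_def M \<longleftrightarrow> M \<in> sym_matrices \<and> (\<forall>v. v \<noteq> 0 \<longrightarrow> v \<bullet> (M *v v) > 0)"

subsection \<open>Functions of a symmetric matrix\<close>

text \<open>
  A function on symmetric matrices is represented by a total function \<open>F\<close> on all square
  matrices, of which only the values on symmetric ones matter.  As usual for functions of a
  symmetric matrix, the derivatives with respect to the entries are those of the extension
  \<open>X \<mapsto> F ((X + X\<^sup>T) / 2)\<close> to all square matrices.  Hence the matrix of derivatives is
  symmetric and the differential of \<open>F\<close> at \<open>M\<close> in a symmetric direction \<open>H\<close> is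
  \<open>\<Sum>i j. \<partial>F/\<partial>M\<^sub>i\<^sub>j * H\<^sub>i\<^sub>j\<close>.
\<close>

definition sym_ext :: "(real^'n^'n \<Rightarrow> real) \<Rightarrow> real^'n^'n \<Rightarrow> real" where
  "sym_ext F X = F ((1/2) *\<^sub>R (X + transpose X))"

definition entry_derivs :: "(real^'n^'n \<Rightarrow> real) \<Rightarrow> real^'n^'n \<Rightarrow> real^'n^'n" where
  "entry_derivs F M = (\<chi> i j. frechet_derivative (sym_ext F) (at M) (axis i (axis j 1)))"

text \<open>Meaningful for \<open>U\<close> relatively open in the space of symmetric matrices.\<close>

definition C1_on_sym :: "(real^'n^'n \<Rightarrow> real) \<Rightarrow> (real^'n^'n) set \<Rightarrow> bool" where
  "C1_on_sym F U \<longleftrightarrow>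
     (\<forall>M\<in>U. sym_ext F differentiable (at M)) \<and> continuous_on U (entry_derivs F)"

subsection \<open>Functions on Euclidean space\<close>

definition grad :: "(real^'n \<Rightarrow> real) \<Rightarrow> real^'n \<Rightarrow> real^'n" where
  "grad f x = (\<chi> i. frechet_derivative f (at x) (axis i 1))"

definition hess :: "(real^'n \<Rightarrow> real) \<Rightarrow> real^'n \<Rightarrow> real^'n^'n" where
  "hess f x = jacobian (grad f) (at x)"

definition laplacian :: "(real^'n \<Rightarrow> real) \<Rightarrow> real^'n \<Rightarrow> real" where
  "laplacian f x = trace (hess f x)"

text \<open>Meaningful for open \<open>S\<close>; continuity of \<open>f\<close> and of its gradient follows from
  differentiability.\<close>

definition C2_on :: "(real^'n \<Rightarrow> real) \<Rightarrow> (real^'n) set \<Rightarrow> bool" where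
  "C2_on f S \<longleftrightarrow>
     (\<forall>x\<in>S. f differentiable (at x)) \<and> (\<forall>x\<in>S. grad f differentiable (at x)) \<and>
     continuous_on S (hess f)"

definition tensor :: "real^'n \<Rightarrow> real^'n \<Rightarrow> real^'n^'n" where
  "tensor v w = (\<chi> i j. v $ i * w $ j)"

subsection \<open>The conformal Hessian and the Kelvin transform\<close>

definition conf_hess :: "(real^'n \<Rightarrow> real) \<Rightarrow> real^'n \<Rightarrow> real^'n^'n" where
  "conf_hess u x =
     (let n = real CARD('n) in
        (- (2 / (n - 2)) * u x powr (- ((n + 2) / (n - 2)))) *\<^sub>R hess u x
      + (2 * n / (n - 2)\<^sup>2 * u x powr (- (2 * n / (n - 2)))) *\<^sub>R tensor (grad u x) (grad u x)
      - (2 / (n - 2)\<^sup>2 * u x powr (- (2 * n / (n - 2))) * (norm (grad u x))\<^sup>2) *\<^sub>R mat 1)"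

text \<open>The exponent uses natural-number subtraction, so \<open>CARD('n) \<ge> 2\<close> is needed for the
  intended meaning.\<close>

definition kelvin :: "(real^'n \<Rightarrow> real) \<Rightarrow> real^'n \<Rightarrow> real \<Rightarrow> real^'n \<Rightarrow> real" where
  "kelvin u x l y =
     (l / norm (y - x)) ^ (CARD('n) - 2) * u (x + (l\<^sup>2 / (norm (y - x))\<^sup>2) *\<^sub>R (y - x))"

end

theory Submission
  imports Defs
begin

text \<open>
  Write \<open>u = f powr (-(n-2)/2)\<close>. In terms of \<open>f\<close> the conformal Hessian is the polynomial expression
  \<open>f D\<^sup>2f - |Df|\<^sup>2/2 I\<close>, which increases with \<open>D\<^sup>2f\<close>; the Kelvin transform of \<open>u\<close> becomes
  \<open>f\<^sub>x\<^sub>,\<^sub>l(y) = |y-x|\<^sup>2/l\<^sup>2 f(x + l\<^sup>2(y-x)/|y-x|\<^sup>2)\<close>; and the claim becomes \<open>f \<le> f\<^sub>x\<^sub>,\<^sub>l\<close> outside the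
  ball of radius \<open>l\<close> about \<open>x\<close>. The conformal Hessian of \<open>f\<^sub>x\<^sub>,\<^sub>l\<close> at \<open>y\<close> is that of \<open>f\<close> at the
  inverted point, conjugated by a reflection (\<open>conf_form_invert\<close>), so \<open>f\<^sub>x\<^sub>,\<^sub>l\<close> solves the same equation.

  The inequality is proved by moving spheres (\<open>moving_spheres\<close>). It holds for small \<open>l\<close>. Let \<open>m\<close> be
  the infimum of the radii for which it fails, and suppose that \<open>m < |x|\<close>. Then it still holds for \<open>m\<close>,
  and radii \<open>l \<rightarrow> m\<close> with points \<open>y\<close> of failure accumulate at some \<open>z\<close>, where one of the
  following must happen:

    \<^item> \<open>f = f\<^sub>x\<^sub>,\<^sub>m\<close> at an interior point. By the strong maximum principle the two functions then agree
      along a ray out to the unit sphere, where they are known to differ.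
    \<^item> \<open>z\<close> lies on the sphere and the normal derivatives of \<open>f\<close> and \<open>f\<^sub>x\<^sub>,\<^sub>m\<close> agree there. The Hopf lemma
      (\<open>hopf_touching\<close>) forbids this. It also yields the strong maximum principle.
    \<^item> \<open>z = 0\<close>, where \<open>f\<close> is singular and no linearized equation is available. Here the superharmonicity
      of \<open>u\<close> is used: \<open>strict_order_at_puncture\<close> keeps \<open>f\<^sub>x\<^sub>,\<^sub>m - f\<close> away from zero near the puncture.

  There remains the strict inequality \<open>f < f\<^sub>x\<^sub>,\<^sub>l\<close> on the unit sphere. It holds for all small \<open>x\<close> and
  \<open>l < |x|\<close> as soon as \<open>f(z) / |z|\<^sup>2\<close> is large near \<open>z = 0\<close> (\<open>quadratic_growth\<close>). If this failed,
  then near a suitably chosen point spheres of radius much larger than the local scale of \<open>f\<close>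
  could be moved, which makes \<open>f\<close> nearly constant on that scale. A paraboloid touching
  \<open>f\<close> from above would then produce a point where the conformal Hessian is small, against the
  assumption that \<open>F \<noteq> 1\<close> near the zero matrix.

  The estimate of \<open>u(x)/u(y)\<close> for \<open>|x| = |y|\<close> follows by exchanging \<open>x\<close> and \<open>y\<close> by an inversion with
  centre at a fixed distance from the origin.

  Since \<open>U\<close> need not be convex, values of \<open>F\<close> at two ordered matrices cannot simply be joined by a segment;
  \<open>F_strict_mono\<close> shows how convexity along rays in positive definite directions suffices.
\<close>

section \<open>Positive semidefinite matrices\<close>

definition psd :: "real^'n^'n \<Rightarrow> bool" where
  "psd P \<longleftrightarrow> P \<in> sym_matrices \<and> (\<forall>v. 0 \<le> v \<bullet> (P *v v))"

lemma matrix_inner_tensor: "(D :: real^'n^'n) \<bullet> tensor v w = v \<bullet> (D *v w)"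
  by (simp add: inner_vec_def tensor_def matrix_vector_mult_def sum_distrib_left mult_ac)

lemma matrix_inner_mat_1: "(D :: real^'n^'n) \<bullet> mat 1 = trace D"
  by (simp add: inner_vec_def mat_def trace_def if_distrib cong: if_cong)

lemma norm_tensor: "norm (tensor v w) = norm v * norm (w :: real^'n)"
proof -
  have "tensor v w \<bullet> tensor v w = (v \<bullet> v) * (w \<bullet> w)"
    by (simp add: inner_vec_def tensor_def sum_product mult_ac)
  then show ?thesis by (simp add: norm_eq_sqrt_inner real_sqrt_mult)
qed

lemma tensor_mult_vector: "tensor v w *v x = (w \<bullet> x) *\<^sub>R v"
  by (simp add: vec_eq_iff tensor_def matrix_vector_mult_def inner_vec_def sum_distrib_left mult_ac)

lemma quadratic_form_le: "\<bar>v \<bullet> (D *v v)\<bar> \<le> norm (D :: real^'n^'n) * (norm v)\<^sup>2"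
  using Cauchy_Schwarz_ineq2[of D "tensor v v"]
  by (simp add: matrix_inner_tensor norm_tensor power2_eq_square)

lemma sym_matrices_self_adjoint:
  assumes "P \<in> sym_matrices" shows "v \<bullet> (P *v w) = w \<bullet> (P *v v)"
proof -
  have "transpose P = P" using assms by (simp only: sym_matrices_def mem_Collect_eq)
  then have "P *v v = v v* P" using transpose_matrix_vector[of P v] by simp
  then show ?thesis by (simp only: dot_lmul_matrix[symmetric] inner_commute)
qed

lemma subspace_sym_matrices: "subspace sym_matrices"
  by (auto simp: subspace_def sym_matrices_def transpose_def vec_eq_iff)

lemma sym_matrices_mat_1 [simp]: "mat 1 \<in> sym_matrices"
  by (simp add: sym_matrices_def)

lemma sym_matrices_tensor [simp]: "tensor v v \<in> sym_matrices"
  by (simp add: sym_matrices_def transpose_def tensor_def vec_eq_iff mult.commute)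

lemma sym_matrices_closure [simp]:
  "M \<in> sym_matrices \<Longrightarrow> N \<in> sym_matrices \<Longrightarrow> M + N \<in> sym_matrices"
  "M \<in> sym_matrices \<Longrightarrow> N \<in> sym_matrices \<Longrightarrow> M - N \<in> sym_matrices"
  "M \<in> sym_matrices \<Longrightarrow> c *\<^sub>R M \<in> sym_matrices"
  using subspace_add[OF subspace_sym_matrices] subspace_diff[OF subspace_sym_matrices]
    subspace_scale[OF subspace_sym_matrices] by blast+

lemma psd_Cauchy_Schwarz:
  assumes P: "psd P" shows "(v \<bullet> (P *v w))\<^sup>2 \<le> (v \<bullet> (P *v v)) * (w \<bullet> (P *v w))"
proof -
  define a b c where "a = v \<bullet> (P *v v)" and "b = v \<bullet> (P *v w)" and "c = w \<bullet> (P *v w)"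
  have wv: "w \<bullet> (P *v v) = b"
    using P sym_matrices_self_adjoint by (auto simp: psd_def b_def)
  have q: "0 \<le> a + 2 * t * b + t\<^sup>2 * c" for t
  proof -
    have "0 \<le> (v + t *\<^sub>R w) \<bullet> (P *v (v + t *\<^sub>R w))" using P by (simp add: psd_def)
    also have "\<dots> = a + 2 * t * b + t\<^sup>2 * c"
      using wv by (simp add: a_def b_def c_def matrix_vector_right_distrib inner_simps
         power2_eq_square algebra_simps matrix_vector_mult_scaleR)
    finally show ?thesis .
  qed
  have c0: "0 \<le> c" using P by (simp add: psd_def c_def)
  show ?thesis
  proof (cases "c = 0")
    case True
    have "b = 0"
    proof (rule ccontr)
      assume "b \<noteq> 0"
      then show False using q[of "- (a + 1) / (2 * b)"] True by (simp add: field_simps)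
    qed
    then show ?thesis using True by (simp flip: a_def b_def c_def)
  next
    case False
    then have "0 \<le> a - b\<^sup>2 / c"
      using q[of "- b / c"] by (simp add: power2_eq_square field_simps)
    then show ?thesis using False c0
      by (simp add: field_simps flip: a_def b_def c_def)
  qed
qed

lemma axis_quadratic: "axis i 1 \<bullet> ((P :: real^'n^'n) *v axis j 1) = P $ i $ j"
  by (simp add: inner_axis' matrix_vector_mul_component matrix_vector_mult_basis column_def)

lemma psd_entry_le:
  assumes "psd P" shows "(P $ i $ j)\<^sup>2 \<le> P $ i $ i * P $ j $ j" "0 \<le> P $ i $ i"
proof -
  show "(P $ i $ j)\<^sup>2 \<le> P $ i $ i * P $ j $ j"
    using psd_Cauchy_Schwarz[OF assms, of "axis i 1" "axis j 1"] by (simp only: axis_quadratic)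
  have "0 \<le> axis i 1 \<bullet> (P *v axis i 1)"
    using assms by (simp only: psd_def)
  then show "0 \<le> P $ i $ i" by (simp only: axis_quadratic)
qed

text \<open>
  By the Cauchy-Schwarz inequality an entry is at most the geometric mean of two diagonal entries.
\<close>
lemma psd_norm_le_trace:
  assumes P: "psd P" shows "norm P \<le> trace P"
proof -
  have "P \<bullet> P \<le> (\<Sum>i\<in>UNIV. \<Sum>j\<in>UNIV. P $ i $ i * P $ j $ j)"
    unfolding inner_vec_def inner_real_def
    by (intro sum_mono psd_entry_le(1)[OF P, unfolded power2_eq_square])
  also have "\<dots> = (trace P)\<^sup>2"
    by (simp add: trace_def power2_eq_square sum_product)
  finally have "norm P \<le> sqrt ((trace P)\<^sup>2)"
    unfolding norm_eq_sqrt_inner by (rule real_sqrt_le_mono)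
  moreover have "0 \<le> trace P"
    unfolding trace_def by (intro sum_nonneg psd_entry_le[OF P])
  ultimately show ?thesis by simp
qed

text \<open>
  Instead of diagonalizing \<open>P\<close>, rank-one matrices are split off: if \<open>p\<close> is the \<open>k\<close>-th column of \<open>P\<close>, then
  \<open>P - pp\<^sup>T / P\<^sub>k\<^sub>k\<close> is still positive semidefinite by the Cauchy-Schwarz inequality, it has one more
  vanishing diagonal entry, and \<open>D \<bullet> pp\<^sup>T = p \<bullet> D p\<close>.
\<close>
lemma psd_inner_nonneg:
  assumes D: "\<And>v. 0 \<le> v \<bullet> (D *v v)" and P: "psd P"
  shows "0 \<le> D \<bullet> (P :: real^'n^'n)"
  using P
proof (induction "card {k. P $ k $ k \<noteq> 0}" arbitrary: P rule: less_induct)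
  case (less P)
  show ?case
  proof (cases "\<forall>k. P $ k $ k = 0")
    case True
    then have "trace P = 0" by (simp add: trace_def)
    then show ?thesis using psd_norm_le_trace[OF less.prems] by simp
  next
    case False
    then obtain k where k: "P $ k $ k \<noteq> 0" by blast
    then have kpos: "0 < P $ k $ k" using psd_entry_le(2)[OF less.prems, of k] by simp
    define p where "p = P *v axis k 1"
    define Q where "Q = P - (1 / P $ k $ k) *\<^sub>R tensor p p"
    have pi: "p $ i = P $ i $ k" for i by (simp add: p_def matrix_vector_mult_basis column_def)
    have sym: "P $ i $ j = P $ j $ i" for i j
      using less.prems by (auto simp: psd_def sym_matrices_def transpose_def vec_eq_iff)
    have Q: "psd Q"
      unfolding psd_def
    proof (intro conjI allI)
      show "Q \<in> sym_matrices" using less.prems by (simp add: Q_def psd_def)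
      fix v
      have "(v \<bullet> p)\<^sup>2 \<le> (v \<bullet> (P *v v)) * P $ k $ k"
        using psd_Cauchy_Schwarz[OF less.prems, of v "axis k 1"] by (simp add: p_def axis_quadratic)
      then have "(v \<bullet> p)\<^sup>2 / P $ k $ k \<le> v \<bullet> (P *v v)"
        using kpos by (simp add: field_simps)
      then show "0 \<le> v \<bullet> (Q *v v)"
        by (simp add: Q_def matrix_vector_mult_diff_rdistrib scaleR_matrix_vector_assoc[symmetric]
            tensor_mult_vector inner_simps power2_eq_square inner_commute)
    qed
    have Qd: "Q $ i $ i = P $ i $ i - (P $ i $ k)\<^sup>2 / P $ k $ k" for i
      by (simp add: Q_def tensor_def pi power2_eq_square)
    have "{i. Q $ i $ i \<noteq> 0} \<subset> {i. P $ i $ i \<noteq> 0}"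
    proof
      show "{i. Q $ i $ i \<noteq> 0} \<subseteq> {i. P $ i $ i \<noteq> 0}"
      proof
        fix i assume "i \<in> {i. Q $ i $ i \<noteq> 0}"
        then show "i \<in> {i. P $ i $ i \<noteq> 0}"
          using psd_entry_le(1)[OF less.prems, of i k] by (auto simp: Qd)
      qed
      show "{i. Q $ i $ i \<noteq> 0} \<noteq> {i. P $ i $ i \<noteq> 0}"
        using k Qd[of k] by (auto simp: power2_eq_square)
    qed
    then have "card {i. Q $ i $ i \<noteq> 0} < card {i. P $ i $ i \<noteq> 0}"
      by (intro psubset_card_mono) auto
    then have "0 \<le> D \<bullet> Q" using less.hyps Q by blast
    moreover have "D \<bullet> P = D \<bullet> Q + (1 / P $ k $ k) * (p \<bullet> (D *v p))"
      by (simp add: Q_def inner_simps matrix_inner_tensor)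
    ultimately show ?thesis using kpos D[of p] by simp
  qed
qed

lemma matrix_inner_lower_bound:
  assumes D: "\<And>v. c * (norm v)\<^sup>2 \<le> v \<bullet> (D *v v)" and P: "psd P"
  shows "c * trace P \<le> D \<bullet> (P :: real^'n^'n)"
proof -
  have "0 \<le> (D - c *\<^sub>R mat 1) \<bullet> P"
  proof (rule psd_inner_nonneg[OF _ P])
    fix v show "0 \<le> v \<bullet> ((D - c *\<^sub>R mat 1) *v v)"
      using D[of v] by (simp add: matrix_vector_mult_diff_rdistrib
          scaleR_matrix_vector_assoc[symmetric] inner_simps power2_norm_eq_inner)
  qed
  then show ?thesis
    by (simp add: inner_simps inner_commute[of "mat 1"] matrix_inner_mat_1)
qed

lemma trace_lower_bound:
  assumes D: "\<And>v. c * (norm v)\<^sup>2 \<le> v \<bullet> (D *v v)"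
  shows "c * CARD('n) \<le> trace (D :: real^'n^'n)"
proof -
  have "c \<le> D $ i $ i" for i using D[of "axis i 1"] by (simp add: axis_quadratic)
  then have "(\<Sum>i\<in>(UNIV::'n set). c) \<le> trace D" unfolding trace_def by (intro sum_mono) auto
  then show ?thesis by (simp add: mult.commute)
qed

lemma trace_tensor [simp]: "trace (tensor v w) = v \<bullet> w"
  by (simp add: trace_def tensor_def inner_vec_def)

lemma trace_scaleR [simp]: "trace (c *\<^sub>R (A :: real^'n^'n)) = c * trace A"
  by (simp add: trace_def sum_distrib_left)

lemma trace_mat_1 [simp]: "trace (mat 1 :: real^'n^'n) = real CARD('n)"
  by (simp add: trace_I)

lemma norm_mat_1_le: "norm (mat 1 :: real^'n^'n) \<le> real CARD('n)"
proof -
  have "psd (mat 1 :: real^'n^'n)" by (simp add: psd_def)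
  from psd_norm_le_trace[OF this] show ?thesis by simp
qed

lemma abs_trace_le: "\<bar>trace (D :: real^'n^'n)\<bar> \<le> norm D * real CARD('n)"
proof -
  have "\<bar>trace D\<bar> \<le> norm D * norm (mat 1 :: real^'n^'n)"
    using Cauchy_Schwarz_ineq2[of D "mat 1"] by (simp add: matrix_inner_mat_1)
  also have "\<dots> \<le> norm D * real CARD('n)" by (intro mult_left_mono norm_mat_1_le) simp
  finally show ?thesis .
qed

section \<open>Elliptic functions of symmetric matrices\<close>

lemma matrix_basis_expansion:
  "(H :: real^'n^'n) = (\<Sum>i\<in>UNIV. \<Sum>j\<in>UNIV. H $ i $ j *\<^sub>R axis i (axis j 1))"
proof -
  have "(\<Sum>i\<in>UNIV. \<Sum>j\<in>UNIV. H $ i $ j *\<^sub>R axis i (axis j 1)) $ a $ b = H $ a $ b" for a b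
  proof -
    have "axis i (axis j 1) $ a $ b = (if j = b then if i = a then 1 else 0 else (0::real))" for i j
      by (simp add: axis_def)
    then have "(\<Sum>i\<in>UNIV. \<Sum>j\<in>UNIV. H $ i $ j *\<^sub>R axis i (axis j 1)) $ a $ b
        = (\<Sum>i\<in>UNIV. \<Sum>j\<in>UNIV. if j = b then if i = a then H $ i $ j else 0 else 0)"
      by (simp add: if_distrib[of "\<lambda>x. _ * x"] cong: if_cong)
    then show ?thesis by simp
  qed
  then show ?thesis by (simp add: vec_eq_iff)
qed

locale elliptic_operator =
  fixes U :: "(real^'n^'n) set" and F :: "real^'n^'n \<Rightarrow> real"
  assumes U_open: "openin (top_of_set sym_matrices) U"
    and U_convex: "\<And>M N. M \<in> sym_matrices \<Longrightarrow> pos_def N \<Longrightarrow>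
                     convex (U \<inter> {M + t *\<^sub>R N | t. 0 < t})"
    and F_C1: "C1_on_sym F U"
    and F_elliptic: "\<And>M. M \<in> U \<Longrightarrow> pos_def (entry_derivs F M)"
begin

lemma U_sym: "M \<in> U \<Longrightarrow> M \<in> sym_matrices"
  using openin_imp_subset[OF U_open] by blast

lemma sym_ext_eq: "M \<in> sym_matrices \<Longrightarrow> sym_ext F M = F M"
  by (simp add: sym_ext_def sym_matrices_def flip: scaleR_2)

lemma sym_ext_derivative:
  assumes "M \<in> U"
  shows "(sym_ext F has_derivative (\<lambda>H. entry_derivs F M \<bullet> H)) (at M)"
proof -
  let ?f = "frechet_derivative (sym_ext F) (at M)"
  have d: "(sym_ext F has_derivative ?f) (at M)"
    using F_C1 assms by (auto simp: C1_on_sym_def frechet_derivative_works[symmetric])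
  then have lin: "linear ?f" by (rule has_derivative_linear)
  have "?f H = entry_derivs F M \<bullet> H" for H
  proof -
    have "?f H = ?f (\<Sum>i\<in>UNIV. \<Sum>j\<in>UNIV. H $ i $ j *\<^sub>R axis i (axis j 1))"
      using matrix_basis_expansion[of H] by simp
    also have "\<dots> = (\<Sum>i\<in>UNIV. \<Sum>j\<in>UNIV. H $ i $ j * ?f (axis i (axis j 1)))"
      by (simp add: linear_sum[OF lin] linear_scale[OF lin])
    also have "\<dots> = entry_derivs F M \<bullet> H"
      by (simp add: inner_vec_def entry_derivs_def mult.commute)
    finally show ?thesis .
  qed
  then have "?f = (\<lambda>H. entry_derivs F M \<bullet> H)" by blast
  with d show ?thesis by simp
qed

lemma F_mean_value:
  assumes seg: "\<And>t. 0 \<le> t \<Longrightarrow> t \<le> 1 \<Longrightarrow> A + t *\<^sub>R (B - A) \<in> U"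
  obtains t where "0 < t" "t < 1" "F B - F A = entry_derivs F (A + t *\<^sub>R (B - A)) \<bullet> (B - A)"
proof -
  let ?p = "\<lambda>t. A + t *\<^sub>R (B - A)"
  have "((\<lambda>t. sym_ext F (?p t)) has_real_derivative entry_derivs F (?p t) \<bullet> (B - A)) (at t)"
    if "0 \<le> t" "t \<le> 1" for t
  proof -
    have "((\<lambda>t. sym_ext F (?p t)) has_derivative (\<lambda>s. entry_derivs F (?p t) \<bullet> (s *\<^sub>R (B - A)))) (at t)"
      by (rule has_derivative_compose[where f = ?p, OF _ sym_ext_derivative[OF seg[OF that]]])
         (auto intro!: derivative_eq_intros)
    then show ?thesis
      by (rule has_derivative_imp_has_field_derivative) (simp add: mult.commute)
  qed
  from MVT2[of 0 1 "\<lambda>t. sym_ext F (?p t)", OF _ this]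
  obtain t where t: "0 < t" "t < 1"
    "sym_ext F (?p 1) - sym_ext F (?p 0) = entry_derivs F (?p t) \<bullet> (B - A)"
    by auto
  have "A \<in> sym_matrices" "B \<in> sym_matrices" using seg[of 0] seg[of 1] U_sym by auto
  then show thesis using t by (intro that[of t]) (auto simp: sym_ext_eq)
qed

text \<open>
  Uniform ellipticity on a ball of symmetric matrices, in the form used for linearization: the difference
  of two values of \<open>F\<close> is a linear functional \<open>D\<close> of the difference of the arguments, and although
  \<open>D\<close> depends on both arguments, its bounds do not.
\<close>
definition elliptic_near :: "real^'n^'n \<Rightarrow> real \<Rightarrow> real \<Rightarrow> real \<Rightarrow> bool" where
  "elliptic_near M \<rho> c C \<longleftrightarrow> 0 < \<rho> \<and> 0 < c \<and> 0 < C \<and>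
     (\<forall>A\<in>sym_matrices. norm (A - M) < \<rho> \<longrightarrow> A \<in> U) \<and>
     (\<forall>A\<in>sym_matrices. \<forall>B\<in>sym_matrices. norm (A - M) < \<rho> \<longrightarrow> norm (B - M) < \<rho> \<longrightarrow>
        (\<exists>D. F B - F A = D \<bullet> (B - A) \<and> (\<forall>v. c * (norm v)\<^sup>2 \<le> v \<bullet> (D *v v)) \<and> norm D \<le> C))"

lemma elliptic_near_pos:
  "elliptic_near M \<rho> c C \<Longrightarrow> 0 < \<rho>" "elliptic_near M \<rho> c C \<Longrightarrow> 0 < c" "elliptic_near M \<rho> c C \<Longrightarrow> 0 < C"
  by (simp_all add: elliptic_near_def)

lemma elliptic_near_in_U:
  "elliptic_near M \<rho> c C \<Longrightarrow> A \<in> sym_matrices \<Longrightarrow> norm (A - M) < \<rho> \<Longrightarrow> A \<in> U"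
  by (simp add: elliptic_near_def)

lemma elliptic_near_linearize:
  assumes "elliptic_near M \<rho> c C" "A \<in> sym_matrices" "B \<in> sym_matrices"
    "norm (A - M) < \<rho>" "norm (B - M) < \<rho>"
  obtains D where "F B - F A = D \<bullet> (B - A)" "\<And>v. c * (norm v)\<^sup>2 \<le> v \<bullet> (D *v v)" "norm D \<le> C"
  using assms unfolding elliptic_near_def by blast

text \<open>
  The quadratic form of the derivative at \<open>M\<close> has a positive minimum on the unit sphere, and half
  of it survives a small perturbation. The mean value theorem on segments in the ball then provides \<open>D\<close>.
\<close>
lemma local_ellipticity:
  assumes M: "M \<in> U"
  obtains \<rho> c C where "elliptic_near M \<rho> c C"
proof -
  let ?G = "entry_derivs F"
  have "continuous_on (sphere 0 1 :: (real^'n) set) (\<lambda>v. v \<bullet> (?G M *v v))"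
    by (intro continuous_intros matrix_vector_mult_linear_continuous_on)
  moreover have "axis undefined 1 \<in> (sphere 0 1 :: (real^'n) set)" by simp
  then have "(sphere 0 1 :: (real^'n) set) \<noteq> {}" by blast
  ultimately obtain v0 where v0: "v0 \<in> (sphere 0 1 :: (real^'n) set)"
    and v0min: "\<And>v. v \<in> sphere 0 1 \<Longrightarrow> v0 \<bullet> (?G M *v v0) \<le> v \<bullet> (?G M *v v)"
    using continuous_attains_inf[OF compact_sphere] by blast
  define c where "c = (v0 \<bullet> (?G M *v v0)) / 2"
  have "v0 \<noteq> 0" using v0 by auto
  then have c: "0 < c" using F_elliptic[OF M] by (simp add: c_def pos_def_def)
  have lowM: "2 * c * (norm v)\<^sup>2 \<le> v \<bullet> (?G M *v v)" for v
  proof (cases "v = 0")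
    case False
    then have "2 * c \<le> ((1 / norm v) *\<^sub>R v) \<bullet> (?G M *v ((1 / norm v) *\<^sub>R v))"
      using v0min[of "(1 / norm v) *\<^sub>R v"] by (simp add: c_def)
    then show ?thesis using False by (simp add: matrix_vector_mult_scaleR field_simps power2_eq_square)
  qed simp
  obtain T where T: "open T" "U = sym_matrices \<inter> T" using U_open openin_open by blast
  then obtain r1 where r1: "0 < r1" "ball M r1 \<subseteq> T" using M open_contains_ball by blast
  have "continuous_on U ?G" using F_C1 by (simp add: C1_on_sym_def)
  then obtain r2 where r2: "0 < r2" "\<And>A. A \<in> U \<Longrightarrow> dist A M < r2 \<Longrightarrow> dist (?G A) (?G M) < c"
    using M c unfolding continuous_on_iff by metis
  define \<rho> where "\<rho> = min r1 r2"
  have inU: "A \<in> U" if "A \<in> sym_matrices" "norm (A - M) < \<rho>" for A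
  proof -
    have "A \<in> ball M r1" using that by (simp add: \<rho>_def dist_norm norm_minus_commute)
    then show ?thesis using T(2) r1 that by auto
  qed
  have "elliptic_near M \<rho> c (norm (?G M) + c)"
    unfolding elliptic_near_def
  proof (intro conjI ballI impI)
    show "0 < \<rho>" "0 < c" "0 < norm (?G M) + c"
      using r1 r2 c by (auto simp: \<rho>_def add_nonneg_pos)
    show "A \<in> U" if "A \<in> sym_matrices" "norm (A - M) < \<rho>" for A using inU that .
    fix A B
    assume A0: "A \<in> sym_matrices" and B0: "B \<in> sym_matrices"
      and "norm (A - M) < \<rho>" "norm (B - M) < \<rho>"
    then have A: "A \<in> sym_matrices" "norm (A - M) < \<rho>" and B: "B \<in> sym_matrices" "norm (B - M) < \<rho>"
      by auto
    have near: "norm (A + t *\<^sub>R (B - A) - M) < \<rho>" if "0 \<le> t" "t \<le> 1" for t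
    proof -
      have "A + t *\<^sub>R (B - A) \<in> ball M \<rho>"
        using convexD_alt[OF convex_ball, of A M \<rho> B t] A B that
        by (simp add: dist_norm norm_minus_commute algebra_simps)
      then show ?thesis by (simp add: dist_norm norm_minus_commute)
    qed
    have seg: "A + t *\<^sub>R (B - A) \<in> U" if "0 \<le> t" "t \<le> 1" for t
      by (rule inU[OF _ near[OF that]]) (use A B in simp)
    obtain t where t: "0 < t" "t < 1" "F B - F A = ?G (A + t *\<^sub>R (B - A)) \<bullet> (B - A)"
      using F_mean_value[OF seg] .
    define D where "D = ?G (A + t *\<^sub>R (B - A))"
    have E: "norm (D - ?G M) < c"
      using r2(2)[OF seg] near[of t] t by (simp add: D_def \<rho>_def dist_norm)
    have "c * (norm v)\<^sup>2 \<le> v \<bullet> (D *v v)" for v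
    proof -
      have "\<bar>v \<bullet> ((D - ?G M) *v v)\<bar> \<le> norm (D - ?G M) * (norm v)\<^sup>2" by (rule quadratic_form_le)
      also have "\<dots> \<le> c * (norm v)\<^sup>2" using E by (intro mult_right_mono) auto
      finally show ?thesis using lowM[of v]
        by (simp add: matrix_vector_mult_diff_rdistrib inner_simps)
    qed
    moreover have "norm D \<le> norm (?G M) + c"
      using norm_triangle_ineq2[of D "?G M"] E by linarith
    ultimately show "\<exists>D. F B - F A = D \<bullet> (B - A) \<and> (\<forall>v. c * (norm v)\<^sup>2 \<le> v \<bullet> (D *v v))
        \<and> norm D \<le> norm (?G M) + c"
      using t(3) D_def by blast
  qed
  then show thesis by (rule that)
qed

text \<open>
  Both matrices lie on the ray that starts at \<open>A - (B - A)\<close> in the positive definite direction \<open>B - A\<close>,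
  at the parameters 1 and 2, so the segment between them lies in \<open>U\<close>.
\<close>
lemma F_mono_pos_def:
  assumes A: "A \<in> U" and B: "B \<in> U" and N: "pos_def (B - A)"
  shows "F A \<le> F B"
proof -
  let ?N = "B - A"
  let ?L = "U \<inter> {(A - ?N) + t *\<^sub>R ?N | t. 0 < t}"
  have "A - ?N \<in> sym_matrices" by (intro sym_matrices_closure U_sym A B)
  then have cv: "convex ?L" using N by (rule U_convex)
  have "A \<in> ?L" using A by (auto intro!: exI[of _ 1])
  moreover have "B \<in> ?L" using B by (auto intro!: exI[of _ 2] simp: scaleR_2)
  ultimately have "A + t *\<^sub>R ?N \<in> U" if "0 \<le> t" "t \<le> 1" for t
    using convexD_alt[OF cv, of A B t] that by (simp add: algebra_simps)
  then obtain t where t: "0 < t" "t < 1" "F B - F A = entry_derivs F (A + t *\<^sub>R ?N) \<bullet> ?N"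
    and tU: "A + t *\<^sub>R ?N \<in> U"
    by (metis F_mean_value less_imp_le)
  have pn: "psd ?N" using N unfolding pos_def_def psd_def
    by (metis inner_zero_left less_imp_le order_refl)
  have "0 \<le> entry_derivs F (A + t *\<^sub>R ?N) \<bullet> ?N"
  proof (rule psd_inner_nonneg[OF _ pn])
    fix v show "0 \<le> v \<bullet> (entry_derivs F (A + t *\<^sub>R ?N) *v v)"
      using F_elliptic[OF tU] unfolding pos_def_def by (cases "v = 0") (auto intro: less_imp_le)
  qed
  then show ?thesis using t by simp
qed

text \<open>
  Adding a small multiple of the identity to \<open>B\<close> makes the difference positive definite; the multiple
  then tends to zero.
\<close>
lemma F_mono:
  assumes A: "A \<in> U" and B: "B \<in> U" and P: "psd (B - A)"
  shows "F A \<le> F B"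
proof (rule field_le_epsilon)
  fix e :: real assume e: "0 < e"
  obtain \<rho> c C where l: "elliptic_near B \<rho> c C"
    using local_ellipticity[OF B] .
  note lp = elliptic_near_pos[OF l]
  define m where "m = norm (mat 1 :: real^'n^'n)"
  have m: "0 \<le> m" by (simp add: m_def)
  define \<eta> where "\<eta> = min (\<rho> / (2 * (m + 1))) (e / (C * (m + 1)))"
  have \<eta>: "0 < \<eta>" using lp e m by (simp add: \<eta>_def add_nonneg_pos)
  have "\<eta> \<le> \<rho> / (2 * (m + 1))" by (simp add: \<eta>_def)
  then have "\<eta> * (m + 1) \<le> \<rho> / 2" using m by (simp add: field_simps)
  then have n1: "\<eta> * m < \<rho>" using lp \<eta> by (simp add: algebra_simps)
  have "\<eta> \<le> e / (C * (m + 1))" by (simp add: \<eta>_def)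
  moreover have "0 < C * (m + 1)" using lp m by simp
  ultimately have "C * (\<eta> * (m + 1)) \<le> e" by (simp add: pos_le_divide_eq mult_ac)
  then have n2: "C * (\<eta> * m) \<le> e" using lp \<eta> by (simp add: algebra_simps) (smt (verit) mult_nonneg_nonneg)
  define B' where "B' = B + \<eta> *\<^sub>R mat 1"
  have B'sym: "B' \<in> sym_matrices" using U_sym[OF B] by (simp add: B'_def)
  have B'n: "norm (B' - B) < \<rho>" using n1 \<eta> by (simp add: B'_def m_def)
  have B'U: "B' \<in> U" using elliptic_near_in_U[OF l B'sym B'n] .
  have "pos_def (B' - A)"
    unfolding pos_def_def
  proof (intro conjI allI impI)
    show "B' - A \<in> sym_matrices" using B'sym U_sym[OF A] by simp
    fix v :: "real^'n" assume "v \<noteq> 0"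
    moreover have "v \<bullet> ((B' - A) *v v) = v \<bullet> ((B - A) *v v) + \<eta> * (v \<bullet> v)"
      by (simp add: B'_def matrix_vector_mult_diff_rdistrib matrix_vector_mult_add_rdistrib
          scaleR_matrix_vector_assoc[symmetric] inner_simps)
    moreover have "0 \<le> v \<bullet> ((B - A) *v v)" using P by (simp add: psd_def)
    ultimately show "v \<bullet> ((B' - A) *v v) > 0" using \<eta> by (simp add: add_nonneg_pos)
  qed
  then have 1: "F A \<le> F B'" using F_mono_pos_def A B'U by blast
  obtain D where D: "F B' - F B = D \<bullet> (B' - B)" "norm D \<le> C"
    using elliptic_near_linearize[OF l U_sym[OF B] B'sym _ B'n] lp(1) by auto
  have "D \<bullet> (B' - B) \<le> norm D * norm (B' - B)" by (rule norm_cauchy_schwarz)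
  also have "\<dots> \<le> C * (\<eta> * m)" using D(2) \<eta> by (intro mult_mono) (auto simp: B'_def m_def lp(3) less_imp_le)
  finally show "F A \<le> F B + e" using 1 D n2 by linarith
qed

text \<open>
  A short first step from \<open>A\<close> towards \<open>B\<close> stays in a ball of uniform ellipticity, where \<open>F\<close> grows in
  proportion to the trace of the step; on the rest of the way \<open>F\<close> does not decrease.
\<close>
lemma F_strict_mono:
  assumes A: "A \<in> U" and B: "B \<in> U" and P: "psd (B - A)" and ne: "A \<noteq> B"
  shows "F A < F B"
proof -
  let ?P = "B - A"
  obtain \<rho> c C where l: "elliptic_near A \<rho> c C"
    using local_ellipticity[OF A] .
  note lp = elliptic_near_pos[OF l]
  have np: "0 < norm ?P" using ne by simp
  define s where "s = min (1/2) (\<rho> / (2 * norm ?P))"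
  have s: "0 < s" "s < 1" using lp np by (auto simp: s_def)
  have "s \<le> \<rho> / (2 * norm ?P)" by (simp add: s_def)
  then have sn: "s * norm ?P < \<rho>" using np lp by (simp add: field_simps)
  define A' where "A' = A + s *\<^sub>R ?P"
  have A'sym: "A' \<in> sym_matrices" using U_sym[OF A] U_sym[OF B] by (simp add: A'_def)
  have A'n: "norm (A' - A) < \<rho>" using sn s by (simp add: A'_def)
  have A'U: "A' \<in> U" using elliptic_near_in_U[OF l A'sym A'n] .
  obtain D where D: "F A' - F A = D \<bullet> (A' - A)" "\<And>v. c * (norm v)\<^sup>2 \<le> v \<bullet> (D *v v)"
    using elliptic_near_linearize[OF l U_sym[OF A] A'sym _ A'n] lp(1) by auto
  have "0 < trace ?P" using psd_norm_le_trace[OF P] np by linarith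
  then have "0 < c * trace ?P" using lp(2) by simp
  also have "\<dots> \<le> D \<bullet> ?P" using matrix_inner_lower_bound[OF D(2) P] .
  finally have "0 < D \<bullet> (A' - A)" using s by (simp add: A'_def)
  then have "F A < F A'" using D(1) by simp
  also have "F A' \<le> F B"
  proof (rule F_mono[OF A'U B])
    have e: "B - A' = (1 - s) *\<^sub>R ?P" by (simp add: A'_def algebra_simps)
    show "psd (B - A')" unfolding e
      using P s by (auto simp: psd_def scaleR_matrix_vector_assoc[symmetric])
  qed
  finally show ?thesis .
qed

end

section \<open>Second derivatives and the conformal Hessian\<close>

text \<open>
  \<open>p\<close> and \<open>H\<close> are the gradient and the Hessian of \<open>f\<close> at \<open>y\<close>. They are functions of the point
  because \<open>H\<close> is the derivative of \<open>p\<close>.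
\<close>
definition jet2 :: "(real^'n \<Rightarrow> real) \<Rightarrow> (real^'n \<Rightarrow> real^'n) \<Rightarrow> (real^'n \<Rightarrow> real^'n^'n) \<Rightarrow> real^'n \<Rightarrow> bool" where
  "jet2 f p H y \<longleftrightarrow> (f has_derivative (\<lambda>k. p y \<bullet> k)) (at y) \<and> (p has_derivative (\<lambda>k. H y *v k)) (at y)"

lemma jet2_diff:
  assumes "jet2 f p H y" "jet2 g q K y"
  shows "jet2 (\<lambda>y. f y - g y) (\<lambda>y. p y - q y) (\<lambda>y. H y - K y) y"
  using assms unfolding jet2_def
  by (auto intro!: derivative_eq_intros simp: inner_simps matrix_vector_mult_diff_rdistrib)

lemma jet2_add:
  assumes "jet2 f p H y" "jet2 g q K y"
  shows "jet2 (\<lambda>y. f y + g y) (\<lambda>y. p y + q y) (\<lambda>y. H y + K y) y"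
  using assms unfolding jet2_def
  by (auto intro!: derivative_eq_intros simp: inner_simps matrix_vector_mult_add_rdistrib)

lemma jet2_scaleR:
  assumes "jet2 f p H y"
  shows "jet2 (\<lambda>y. c * f y) (\<lambda>y. c *\<^sub>R p y) (\<lambda>y. c *\<^sub>R H y) y"
  using assms unfolding jet2_def
  by (auto intro!: derivative_eq_intros simp: scaleR_matrix_vector_assoc[symmetric])

lemma jet2_const: "jet2 (\<lambda>y. c) (\<lambda>y. 0) (\<lambda>y. 0) y"
  unfolding jet2_def by (auto intro!: derivative_eq_intros)

lemma jet2_linear: "jet2 (\<lambda>y. p \<bullet> y) (\<lambda>y. p) (\<lambda>y. 0) y"
  unfolding jet2_def by (auto intro!: derivative_eq_intros)

lemma jet2_norm_squared:
  "jet2 (\<lambda>y. (y - c) \<bullet> (y - c)) (\<lambda>y. 2 *\<^sub>R (y - c)) (\<lambda>y. 2 *\<^sub>R mat 1) y"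
  unfolding jet2_def
  by (auto intro!: derivative_eq_intros simp: inner_commute scaleR_matrix_vector_assoc[symmetric])

lemma jet2_isCont: "jet2 f p H y \<Longrightarrow> isCont f y" "jet2 f p H y \<Longrightarrow> isCont p y"
  by (auto simp: jet2_def dest: has_derivative_continuous)

lemma jet2_along_line:
  assumes "jet2 h p H (y + t *\<^sub>R e)"
  shows "((\<lambda>t. h (y + t *\<^sub>R e)) has_real_derivative p (y + t *\<^sub>R e) \<bullet> e) (at t)"
    "((\<lambda>t. p (y + t *\<^sub>R e) \<bullet> e) has_real_derivative e \<bullet> (H (y + t *\<^sub>R e) *v e)) (at t)"
proof -
  let ?l = "\<lambda>t. y + t *\<^sub>R e"
  have l: "(?l has_derivative (\<lambda>s. s *\<^sub>R e)) (at t)" by (auto intro!: derivative_eq_intros)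
  have 1: "((\<lambda>t. h (?l t)) has_derivative (\<lambda>s. p (?l t) \<bullet> (s *\<^sub>R e))) (at t)"
    using assms unfolding jet2_def
    by (intro has_derivative_compose[OF l, of h]) auto
  show "((\<lambda>t. h (?l t)) has_real_derivative p (?l t) \<bullet> e) (at t)"
    by (rule has_derivative_imp_has_field_derivative[OF 1]) (simp add: mult.commute)
  have 2: "((\<lambda>t. p (?l t)) has_derivative (\<lambda>s. H (?l t) *v (s *\<^sub>R e))) (at t)"
    using assms unfolding jet2_def
    by (intro has_derivative_compose[OF l, of p]) auto
  have 3: "((\<lambda>t. p (?l t) \<bullet> e) has_derivative (\<lambda>s. (H (?l t) *v (s *\<^sub>R e)) \<bullet> e)) (at t)"
    by (rule has_derivative_inner_left[OF 2])
  show "((\<lambda>t. p (?l t) \<bullet> e) has_real_derivative e \<bullet> (H (?l t) *v e)) (at t)"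
    by (rule has_derivative_imp_has_field_derivative[OF 3])
       (simp add: matrix_vector_mult_scaleR inner_commute mult.commute)
qed

text \<open>
  Only the values of \<open>h\<close> on one side of \<open>y\<close> enter, so this can be used at a boundary point.
\<close>
lemma second_derivative_nonneg:
  assumes jet: "\<And>t. 0 \<le> t \<Longrightarrow> t < \<tau> \<Longrightarrow> jet2 h p H (y + t *\<^sub>R e)" and \<tau>: "0 < \<tau>"
    and crit: "p y \<bullet> e = 0"
    and min: "\<And>t. 0 < t \<Longrightarrow> t < \<tau> \<Longrightarrow> h y \<le> h (y + t *\<^sub>R e)"
  shows "0 \<le> e \<bullet> (H y *v e)"
proof (rule ccontr)
  assume "\<not> 0 \<le> e \<bullet> (H y *v e)"
  moreover have "((\<lambda>t. p (y + t *\<^sub>R e) \<bullet> e) has_real_derivative e \<bullet> (H y *v e)) (at 0)"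
    using jet2_along_line(2)[OF jet, of 0] \<tau> by simp
  ultimately obtain d where d: "0 < d" "\<And>t. 0 < t \<Longrightarrow> t < d \<Longrightarrow> p (y + t *\<^sub>R e) \<bullet> e < 0"
    using DERIV_neg_dec_right[of "\<lambda>t. p (y + t *\<^sub>R e) \<bullet> e" "e \<bullet> (H y *v e)" 0] crit by auto
  define t where "t = min d \<tau> / 2"
  have t: "0 < t" "t < d" "t < \<tau>" using d \<tau> by (auto simp: t_def)
  have "\<exists>z>0. z < t \<and> h (y + t *\<^sub>R e) - h (y + 0 *\<^sub>R e) = (t - 0) * (p (y + z *\<^sub>R e) \<bullet> e)"
    by (rule MVT2[OF t(1)]) (use t jet2_along_line(1)[OF jet] in auto)
  then obtain z where z: "0 < z" "z < t" "h (y + t *\<^sub>R e) - h y = t * (p (y + z *\<^sub>R e) \<bullet> e)" by auto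
  have "p (y + z *\<^sub>R e) \<bullet> e < 0" using d(2)[of z] z t by simp
  then have "t * (p (y + z *\<^sub>R e) \<bullet> e) < 0" using t by (simp add: mult_pos_neg)
  then show False using z min[of t] t by simp
qed

lemma interior_minimum:
  assumes r: "0 < r" and jet: "\<And>y. y \<in> ball y0 r \<Longrightarrow> jet2 h p H y"
    and min: "\<And>y. y \<in> ball y0 r \<Longrightarrow> h y0 \<le> h y"
  shows "p y0 = 0" "0 \<le> e \<bullet> (H y0 *v e)"
proof -
  have "(h has_derivative (\<lambda>k. p y0 \<bullet> k)) (at y0)" using jet[of y0] r by (simp add: jet2_def)
  then have "(\<lambda>k. p y0 \<bullet> k) = (\<lambda>v. 0)"
    by (intro differential_zero_maxmin[of y0 "ball y0 r" h]) (use r min in auto)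
  then have "p y0 \<bullet> p y0 = 0" by metis
  then show p0: "p y0 = 0" by simp
  define \<tau> where "\<tau> = r / (norm e + 1)"
  have in_ball: "y0 + t *\<^sub>R e \<in> ball y0 r" if "0 \<le> t" "t < \<tau>" for t
  proof -
    have "0 < norm e + 1" by (simp add: add_nonneg_pos)
    then have "t * (norm e + 1) < r" using that(2) by (simp add: \<tau>_def pos_less_divide_eq)
    then show ?thesis using that(1) by (simp add: dist_norm algebra_simps)
  qed
  show "0 \<le> e \<bullet> (H y0 *v e)"
  proof (rule second_derivative_nonneg[where \<tau> = \<tau> and h = h and p = p])
    show "0 < \<tau>" using r by (simp add: \<tau>_def add_nonneg_pos)
  qed (use in_ball jet min p0 in auto)
qed

text \<open>
  The conformal Hessian in terms of \<open>f = u powr (-2/(n-2))\<close>, for a value \<open>a\<close>, gradient \<open>p\<close> and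
  Hessian \<open>H\<close> of \<open>f\<close>.
\<close>
definition conf_form :: "real \<Rightarrow> real^'n \<Rightarrow> real^'n^'n \<Rightarrow> real^'n^'n" where
  "conf_form a p H = a *\<^sub>R H - (p \<bullet> p / 2) *\<^sub>R mat 1"

text \<open>
  The first term carries the ellipticity; the other two are of lower order in the difference of the two functions.
\<close>
lemma conf_form_diff:
  "conf_form b q K - conf_form a p H =
     a *\<^sub>R (K - H) + (b - a) *\<^sub>R K - ((q - p) \<bullet> (q + p) / 2) *\<^sub>R mat 1"
  by (simp add: conf_form_def algebra_simps inner_simps inner_commute[of q p]
      flip: scaleR_add_left scaleR_diff_left add_divide_distrib diff_divide_distrib)

lemma inner_conf_form_diff:
  "D \<bullet> (conf_form b q K - conf_form a p H) =
     a * (D \<bullet> (K - H)) + (b - a) * (D \<bullet> K) - (q - p) \<bullet> (q + p) / 2 * trace D"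
  by (simp add: conf_form_diff inner_simps matrix_inner_mat_1)

lemma conf_form_sym_iff:
  assumes "a \<noteq> 0" shows "conf_form a p H \<in> sym_matrices \<longleftrightarrow> H \<in> sym_matrices"
proof
  assume "conf_form a p H \<in> sym_matrices"
  then have "(1 / a) *\<^sub>R (conf_form a p H + (p \<bullet> p / 2) *\<^sub>R mat 1) \<in> sym_matrices" by simp
  then show "H \<in> sym_matrices" using assms by (simp add: conf_form_def)
qed (simp add: conf_form_def)

context elliptic_operator
begin

definition solution_on :: "(real^'n) set \<Rightarrow> (real^'n \<Rightarrow> real) \<Rightarrow> (real^'n \<Rightarrow> real^'n) \<Rightarrow>
    (real^'n \<Rightarrow> real^'n^'n) \<Rightarrow> bool" where
  "solution_on S f p H \<longleftrightarrow> open S \<and> continuous_on S H \<and>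
     (\<forall>y\<in>S. 0 < f y \<and> jet2 f p H y \<and> conf_form (f y) (p y) (H y) \<in> U \<and>
            F (conf_form (f y) (p y) (H y)) = 1)"

lemma solution_onD:
  assumes "solution_on S f p H"
  shows "open S" "continuous_on S H" "y \<in> S \<Longrightarrow> 0 < f y" "y \<in> S \<Longrightarrow> jet2 f p H y"
    "y \<in> S \<Longrightarrow> conf_form (f y) (p y) (H y) \<in> U" "y \<in> S \<Longrightarrow> F (conf_form (f y) (p y) (H y)) = 1"
    "y \<in> S \<Longrightarrow> H y \<in> sym_matrices" "continuous_on S f" "continuous_on S p"
    "continuous_on S (\<lambda>y. conf_form (f y) (p y) (H y))"
proof -
  note d = assms[unfolded solution_on_def]
  show "open S" "continuous_on S H" "y \<in> S \<Longrightarrow> 0 < f y" "y \<in> S \<Longrightarrow> jet2 f p H y"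
    "y \<in> S \<Longrightarrow> conf_form (f y) (p y) (H y) \<in> U" "y \<in> S \<Longrightarrow> F (conf_form (f y) (p y) (H y)) = 1"
    using d by auto
  show "H y \<in> sym_matrices" if "y \<in> S"
    using d that U_sym conf_form_sym_iff[of "f y" "p y" "H y"] by force
  show c: "continuous_on S f" "continuous_on S p"
    using d jet2_isCont by (auto intro!: continuous_at_imp_continuous_on) blast+
  show "continuous_on S (\<lambda>y. conf_form (f y) (p y) (H y))"
    unfolding conf_form_def by (intro continuous_intros c) (use d in auto)
qed

lemma solution_on_subset:
  "solution_on S f p H \<Longrightarrow> T \<subseteq> S \<Longrightarrow> open T \<Longrightarrow> solution_on T f p H"
  unfolding solution_on_def by (auto intro: continuous_on_subset)

end

section \<open>The Hopf lemma\<close>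

context elliptic_operator
begin

lemma solution_near:
  assumes f: "solution_on S f p H" and y0: "y0 \<in> S" and \<rho>: "0 < \<rho>"
  obtains s where "0 < s" "cball y0 s \<subseteq> S"
    "\<And>y. y \<in> cball y0 s \<Longrightarrow>
       norm (conf_form (f y) (p y) (H y) - conf_form (f y0) (p y0) (H y0)) < \<rho>"
proof -
  obtain s1 where s1: "0 < s1" "cball y0 s1 \<subseteq> S"
    using open_contains_cball[of S] solution_onD(1)[OF f] y0 by blast
  obtain d where d: "0 < d" "\<And>y. y \<in> S \<Longrightarrow> dist y y0 < d \<Longrightarrow>
      dist (conf_form (f y) (p y) (H y)) (conf_form (f y0) (p y0) (H y0)) < \<rho>"
    using solution_onD(10)[OF f] y0 \<rho> unfolding continuous_on_iff by metis
  show thesis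
  proof (rule that[of "min s1 (d / 2)"])
    fix y assume y: "y \<in> cball y0 (min s1 (d / 2))"
    then have "y \<in> S" using s1 by auto
    moreover have "dist y y0 < d" using y d(1) by (auto simp: dist_commute)
    ultimately show "norm (conf_form (f y) (p y) (H y) - conf_form (f y0) (p y0) (H y0)) < \<rho>"
      using d(2) by (simp add: dist_norm)
  qed (use s1 d in auto)
qed

text \<open>
  A direction pointing into the ball gives a one-sided minimum of \<open>g - f\<close>, hence a nonnegative value of the
  quadratic form. The form is even, so directions pointing out of the ball are covered as well,
  and the tangential ones are limits of these. Boundary points can therefore be treated
  exactly like interior ones.
\<close>
lemma touching_hessian_psd:
  assumes f: "solution_on S f p H" and g: "solution_on S g q K" and y0: "y0 \<in> S"
    and lt: "\<And>y. y \<in> ball c R \<Longrightarrow> y \<in> S \<Longrightarrow> f y < g y" and R: "0 < R" "norm (y0 - c) = R"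
    and eq: "f y0 = g y0" "p y0 = q y0"
  shows "psd (K y0 - H y0)"
proof -
  let ?W = "K y0 - H y0"
  have inward: "0 \<le> e \<bullet> (?W *v e)" if e: "0 < e \<bullet> (c - y0)" for e
  proof -
    obtain s where s: "0 < s" "ball y0 s \<subseteq> S"
      using open_contains_ball[of S] solution_onD(1)[OF f] y0 by blast
    define \<tau> where "\<tau> = min (s / (norm e + 1)) (e \<bullet> (c - y0) / ((norm e)\<^sup>2 + 1))"
    have ne: "0 < norm e + 1" "0 < (norm e)\<^sup>2 + 1" by (simp_all add: add_nonneg_pos)
    have inS: "y0 + t *\<^sub>R e \<in> S" if "0 \<le> t" "t < \<tau>" for t
    proof -
      have "t < s / (norm e + 1)" using that by (simp add: \<tau>_def)
      then have "t * (norm e + 1) < s" using ne by (simp add: pos_less_divide_eq)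
      then have "y0 + t *\<^sub>R e \<in> ball y0 s" using that by (simp add: dist_norm algebra_simps)
      then show ?thesis using s by blast
    qed
    have inb: "y0 + t *\<^sub>R e \<in> ball c R" if "0 < t" "t < \<tau>" for t
    proof -
      have "t < e \<bullet> (c - y0) / ((norm e)\<^sup>2 + 1)" using that by (simp add: \<tau>_def)
      then have "t * ((norm e)\<^sup>2 + 1) < e \<bullet> (c - y0)" using ne by (simp add: pos_less_divide_eq)
      then have "t * (e \<bullet> e) < 2 * (e \<bullet> (c - y0))"
        using that e by (simp add: power2_norm_eq_inner algebra_simps)
      then have "t * (t * (e \<bullet> e)) < t * (2 * (e \<bullet> (c - y0)))" using that by simp
      moreover have "(norm (y0 + t *\<^sub>R e - c))\<^sup>2 = R\<^sup>2 - t * (2 * (e \<bullet> (c - y0))) + t * (t * (e \<bullet> e))"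
        unfolding R(2)[symmetric] power2_norm_eq_inner
        by (simp add: inner_simps algebra_simps inner_commute)
      ultimately have "(norm (y0 + t *\<^sub>R e - c))\<^sup>2 < R\<^sup>2" by linarith
      then have "norm (y0 + t *\<^sub>R e - c) < R" using R(1) by (simp add: power2_less_imp_less)
      then show ?thesis by (simp add: dist_norm norm_minus_commute)
    qed
    have "0 \<le> e \<bullet> ((\<lambda>y. K y - H y) y0 *v e)"
    proof (rule second_derivative_nonneg[where h = "\<lambda>y. g y - f y" and p = "\<lambda>y. q y - p y" and \<tau> = \<tau>])
      show "jet2 (\<lambda>y. g y - f y) (\<lambda>y. q y - p y) (\<lambda>y. K y - H y) (y0 + t *\<^sub>R e)"
        if "0 \<le> t" "t < \<tau>" for t
        by (intro jet2_diff solution_onD(4)[OF g] solution_onD(4)[OF f] inS that)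
      show "0 < \<tau>" using s ne e by (simp add: \<tau>_def)
      show "g y0 - f y0 \<le> g (y0 + t *\<^sub>R e) - f (y0 + t *\<^sub>R e)" if "0 < t" "t < \<tau>" for t
        using lt[OF inb inS] that eq by (simp add: less_imp_le)
    qed (use eq in simp)
    then show ?thesis by simp
  qed
  have ne: "0 \<le> e \<bullet> (?W *v e)" if e: "e \<bullet> (c - y0) \<noteq> 0" for e
  proof (cases "0 < e \<bullet> (c - y0)")
    case False
    then have "0 < (- e) \<bullet> (c - y0)" using e by simp
    from inward[OF this] show ?thesis by (simp add: linear_neg[OF matrix_vector_mul_linear])
  qed (rule inward)
  show ?thesis
    unfolding psd_def
  proof (intro conjI allI)
    show "?W \<in> sym_matrices" using solution_onD(7)[OF f y0] solution_onD(7)[OF g y0] by simp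
    fix e
    show "0 \<le> e \<bullet> (?W *v e)"
    proof (cases "e \<bullet> (c - y0) = 0")
      case True
      let ?n = "c - y0"
      have npos: "0 < ?n \<bullet> ?n" using R by auto
      define B where "B = e \<bullet> (?W *v ?n) + ?n \<bullet> (?W *v e)"
      define C where "C = ?n \<bullet> (?W *v ?n)"
      show ?thesis
      proof (rule field_le_epsilon)
        fix \<eta> :: real assume \<eta>: "0 < \<eta>"
        define s where "s = min 1 (\<eta> / (\<bar>B\<bar> + \<bar>C\<bar> + 1))"
        have s: "0 < s" "s \<le> 1" using \<eta> by (auto simp: s_def add_nonneg_pos)
        have "s \<le> \<eta> / (\<bar>B\<bar> + \<bar>C\<bar> + 1)" by (simp add: s_def)
        then have s1: "s * (\<bar>B\<bar> + \<bar>C\<bar> + 1) \<le> \<eta>" by (subst (asm) pos_le_divide_eq) auto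
        have "s * C \<le> s * \<bar>C\<bar>" using s by (intro mult_left_mono) auto
        also have "\<dots> \<le> \<bar>C\<bar>" using s by (intro mult_left_le_one_le) auto
        finally have "s * (s * C) \<le> s * \<bar>C\<bar>" using s by (intro mult_left_mono) auto
        moreover have "s * B \<le> s * \<bar>B\<bar>" using s by (intro mult_left_mono) auto
        ultimately have small: "s * B + s * (s * C) \<le> \<eta>" using s1 s(1) unfolding ring_distribs by linarith
        have "(e + s *\<^sub>R ?n) \<bullet> ?n = s * (?n \<bullet> ?n)" using True by (simp only: inner_add_left) simp
        then have "(e + s *\<^sub>R ?n) \<bullet> ?n \<noteq> 0" using npos s by simp
        from ne[OF this] have "0 \<le> e \<bullet> (?W *v e) + (s * B + s * (s * C))"
          unfolding B_def C_def
          by (simp only: matrix_vector_right_distrib matrix_vector_mult_scaleR inner_add_left inner_add_right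
              inner_scaleR_left inner_scaleR_right) (simp add: algebra_simps)
        then show "0 \<le> e \<bullet> (?W *v e) + \<eta>" using small by linarith
      qed
    qed (rule ne)
  qed
qed

text \<open>
  \<open>Q + \<alpha> Q\<^sup>2\<close> vanishes on the sphere and is positive inside. Where \<open>\<alpha> Q \<le> 1\<close> its gradient is bounded
  independently of \<open>\<alpha>\<close>, while its Hessian contains the radial term of size \<open>\<alpha>\<close>.
\<close>
lemma hopf_barrier:
  fixes c :: "real^'n" and R \<alpha> :: real
  defines "Q \<equiv> \<lambda>y. R\<^sup>2 - (y - c) \<bullet> (y - c)"
  shows "jet2 (\<lambda>y. Q y + \<alpha> * (Q y)\<^sup>2) (\<lambda>y. (- 2 * (1 + 2 * \<alpha> * Q y)) *\<^sub>R (y - c))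
    (\<lambda>y. (8 * \<alpha>) *\<^sub>R tensor (y - c) (y - c) - (2 * (1 + 2 * \<alpha> * Q y)) *\<^sub>R mat 1) y"
  unfolding jet2_def Q_def
proof
  show "((\<lambda>y. R\<^sup>2 - (y - c) \<bullet> (y - c) + \<alpha> * (R\<^sup>2 - (y - c) \<bullet> (y - c))\<^sup>2) has_derivative
     (\<bullet>) ((- 2 * (1 + 2 * \<alpha> * (R\<^sup>2 - (y - c) \<bullet> (y - c)))) *\<^sub>R (y - c))) (at y)"
    by (rule derivative_eq_intros refl)+ (simp add: fun_eq_iff inner_commute algebra_simps)
  show "((\<lambda>y. (- 2 * (1 + 2 * \<alpha> * (R\<^sup>2 - (y - c) \<bullet> (y - c)))) *\<^sub>R (y - c)) has_derivative
     (*v) ((8 * \<alpha>) *\<^sub>R tensor (y - c) (y - c) - (2 * (1 + 2 * \<alpha> * (R\<^sup>2 - (y - c) \<bullet> (y - c)))) *\<^sub>R mat 1)) (at y)"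
    by (rule derivative_eq_intros refl)+
       (simp add: fun_eq_iff inner_commute matrix_vector_mult_diff_rdistrib
         scaleR_matrix_vector_assoc[symmetric] tensor_mult_vector algebra_simps)
qed

text \<open>
  At \<open>y0\<close> the conformal Hessians of \<open>f\<close> and \<open>g\<close> are ordered, by \<open>touching_hessian_psd\<close>, and \<open>F\<close> takes the
  same value on them; hence they coincide, and near \<open>y0\<close> both stay in one ball of uniform
  ellipticity. There the difference of the two equations is a linear elliptic inequality for \<open>g - f\<close>,
  and a small multiple of the barrier lies below \<open>g - f\<close> on an annulus
  that touches the sphere at \<open>y0\<close>. So the inward derivative of \<open>g - f\<close> at \<open>y0\<close> is positive.
\<close>
lemma hopf_touching:
  assumes f: "solution_on S f p H" and g: "solution_on S g q K" and y0: "y0 \<in> S"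
    and le: "\<And>y. y \<in> cball c R \<Longrightarrow> y \<in> S \<Longrightarrow> f y \<le> g y"
    and lt: "\<And>y. y \<in> ball c R \<Longrightarrow> y \<in> S \<Longrightarrow> f y < g y" and R: "0 < R" "norm (y0 - c) = R"
    and eq: "f y0 = g y0" "p y0 = q y0"
  shows False
proof -
  let ?Af = "\<lambda>y. conf_form (f y) (p y) (H y)"
  let ?Ag = "\<lambda>y. conf_form (g y) (q y) (K y)"
  note fD = solution_onD[OF f] and gD = solution_onD[OF g]
  have W: "psd (K y0 - H y0)" by (rule touching_hessian_psd[OF f g y0 lt R eq])
  have "?Ag y0 - ?Af y0 = f y0 *\<^sub>R (K y0 - H y0)" using eq by (simp add: conf_form_diff)
  moreover have "psd (f y0 *\<^sub>R (K y0 - H y0))"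
    using W fD(3)[OF y0] by (auto simp: psd_def scaleR_matrix_vector_assoc[symmetric])
  ultimately have "psd (?Ag y0 - ?Af y0)" by simp
  then have A0: "?Ag y0 = ?Af y0"
    using F_strict_mono[OF fD(5)[OF y0] gD(5)[OF y0]] fD(6)[OF y0] gD(6)[OF y0] by fastforce
  define M where "M = ?Af y0"
  obtain \<rho> e C where ell: "elliptic_near M \<rho> e C"
    using local_ellipticity[OF fD(5)[OF y0]] unfolding M_def .
  note lp = elliptic_near_pos[OF ell]
  obtain s1 where s1: "0 < s1" "cball y0 s1 \<subseteq> S" "\<And>y. y \<in> cball y0 s1 \<Longrightarrow> norm (?Af y - M) < \<rho>"
    using solution_near[OF f y0 lp(1)] unfolding M_def by metis
  obtain s2 where s2: "0 < s2" "cball y0 s2 \<subseteq> S" "\<And>y. y \<in> cball y0 s2 \<Longrightarrow> norm (?Ag y - M) < \<rho>"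
    using solution_near[OF g y0 lp(1)] unfolding A0 M_def by metis
  define s where "s = min s1 s2"
  have s: "0 < s" "cball y0 s \<subseteq> S" using s1 s2 by (auto simp: s_def)
  have nearM: "norm (?Af y - M) < \<rho>" "norm (?Ag y - M) < \<rho>" if "y \<in> cball y0 s" for y
    using s1(3)[of y] s2(3)[of y] that by (auto simp: s_def)
  obtain z where z: "z \<in> cball y0 s" "\<And>y. y \<in> cball y0 s \<Longrightarrow> f z \<le> f y"
    using continuous_attains_inf[OF compact_cball _ continuous_on_subset[OF fD(8) s(2)]] s(1) by auto
  define a0 where "a0 = f z"
  have a0: "0 < a0" "\<And>y. y \<in> cball y0 s \<Longrightarrow> a0 \<le> f y" using z s(2) fD(3) by (auto simp: a0_def)
  obtain B1 where B1: "0 \<le> B1" "\<And>y. y \<in> cball y0 s \<Longrightarrow> norm (K y) \<le> B1"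
    using continuous_on_compact_bound[OF compact_cball continuous_on_subset[OF gD(2) s(2)]] by blast
  have "continuous_on (cball y0 s) (\<lambda>y. q y + p y)"
    by (intro continuous_intros continuous_on_subset[OF fD(9) s(2)] continuous_on_subset[OF gD(9) s(2)])
  then obtain B2 where B2: "0 \<le> B2" "\<And>y. y \<in> cball y0 s \<Longrightarrow> norm (q y + p y) \<le> B2"
    using continuous_on_compact_bound[OF compact_cball] by blast
  \<comment> \<open>A smaller ball touching the sphere at the same point lies in the neighbourhood found above, with its closure.\<close>
  define \<tau> where "\<tau> = min (1/2) (s / (2 * R))"
  have \<tau>: "0 < \<tau>" "\<tau> < 1" using s R by (auto simp: \<tau>_def)
  define r where "r = \<tau> * R"
  define x where "x = y0 + \<tau> *\<^sub>R (c - y0)"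
  have r: "0 < r" using \<tau> R by (simp add: r_def)
  have y0x: "norm (y0 - x) = r" using \<tau> R by (simp add: x_def r_def norm_minus_commute)
  have xc: "norm (x - c) = R - r"
  proof -
    have "x - c = (1 - \<tau>) *\<^sub>R (y0 - c)" by (simp add: x_def algebra_simps)
    then have "norm (x - c) = (1 - \<tau>) * R" using \<tau> R by simp
    then show ?thesis by (simp add: r_def algebra_simps)
  qed
  have "\<tau> \<le> s / (2 * R)" by (simp add: \<tau>_def)
  then have "2 * r \<le> s" using R by (simp add: r_def field_simps)
  then have rs: "y \<in> cball y0 s" if "norm (y - x) \<le> r" for y
    using that y0x norm_triangle_ineq4[of "y - x" "y0 - x"] by (simp add: dist_norm norm_minus_commute)
  have rc: "norm (y - c) \<le> norm (y - x) + (R - r)" for y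
    using norm_triangle_ineq[of "y - x" "x - c"] xc by simp
  define n where "n = real CARD('n)"
  have n: "0 < n" by (simp add: n_def)
  \<comment> \<open>The first entry keeps the annulus \<open>0 \<le> Q \<le> 1/\<alpha>\<close> away from the centre; the second makes the radial term dominate.\<close>
  define \<alpha> where "\<alpha> = max (2 / r\<^sup>2) ((6 * n * C + (r\<^sup>2 * C * B1 + 3 * r * B2 * n * C + 1) / a0) / (4 * e * r\<^sup>2))"
  have \<alpha>1: "2 / r\<^sup>2 \<le> \<alpha>" by (simp add: \<alpha>_def)
  then have \<alpha>0: "0 < \<alpha>" using r by (meson divide_pos_pos less_le_trans zero_less_numeral zero_less_power)
  have \<alpha>r: "1 / \<alpha> \<le> r\<^sup>2 / 2" using \<alpha>1 \<alpha>0 r by (simp add: field_simps)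
  have \<alpha>2: "6 * n * C + (r\<^sup>2 * C * B1 + 3 * r * B2 * n * C + 1) / a0 \<le> 4 * e * r\<^sup>2 * \<alpha>"
  proof -
    have "(6 * n * C + (r\<^sup>2 * C * B1 + 3 * r * B2 * n * C + 1) / a0) / (4 * e * r\<^sup>2) \<le> \<alpha>"
      by (simp add: \<alpha>_def)
    moreover have "0 < 4 * e * r\<^sup>2" using lp r by simp
    ultimately show ?thesis by (subst (asm) pos_divide_le_eq) (auto simp: mult_ac)
  qed
  define Q where "Q y = r\<^sup>2 - (y - x) \<bullet> (y - x)" for y
  define E where "E y = Q y + \<alpha> * (Q y)\<^sup>2" for y
  define dE where "dE y = (- 2 * (1 + 2 * \<alpha> * Q y)) *\<^sub>R (y - x)" for y
  define hE where "hE y = (8 * \<alpha>) *\<^sub>R tensor (y - x) (y - x) - (2 * (1 + 2 * \<alpha> * Q y)) *\<^sub>R mat 1" for y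
  have Ejet: "jet2 E dE hE y" for y
    using hopf_barrier[of r x \<alpha> y] unfolding E_def[abs_def] dE_def[abs_def] hE_def[abs_def] Q_def .
  have contQ: "continuous_on T Q" for T unfolding Q_def by (intro continuous_intros)
  have contE: "continuous_on T E" for T unfolding E_def by (intro continuous_intros contQ)
  define N where "N = {y. 0 \<le> Q y \<and> Q y \<le> 1 / \<alpha>}"
  have Nnorm: "norm (y - x) \<le> r" "r\<^sup>2 / 2 \<le> (y - x) \<bullet> (y - x)" if "y \<in> N" for y
  proof -
    have "(norm (y - x))\<^sup>2 \<le> r\<^sup>2" using that by (simp add: N_def Q_def power2_norm_eq_inner)
    then show "norm (y - x) \<le> r" by (rule power2_le_imp_le) (use r in simp)
    show "r\<^sup>2 / 2 \<le> (y - x) \<bullet> (y - x)" using that \<alpha>r unfolding N_def Q_def by simp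
  qed
  have NS: "y \<in> cball y0 s" "y \<in> S" "y \<in> cball c R" if "y \<in> N" for y
  proof -
    show "y \<in> cball y0 s" by (rule rs[OF Nnorm(1)[OF that]])
    then show "y \<in> S" using s(2) by blast
    show "y \<in> cball c R"
      using rc[of y] Nnorm(1)[OF that] by (simp add: dist_norm norm_minus_commute)
  qed
  have Nclosed: "closed N"
    unfolding N_def by (intro closed_Collect_conj closed_Collect_le continuous_intros contQ)
  have "N \<subseteq> cball x r" using Nnorm(1) by (auto simp: dist_norm norm_minus_commute)
  then have "cball x r \<inter> N = N" by blast
  then have Ncomp: "compact N" using compact_Int_closed[OF compact_cball Nclosed] by metis
  let ?w = "\<lambda>y. g y - f y"
  have wcont: "continuous_on N ?w"
    by (intro continuous_intros continuous_on_subset[OF fD(8)] continuous_on_subset[OF gD(8)]) (use NS in auto)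
  have y0N: "y0 \<in> N" using y0x \<alpha>0 by (simp add: N_def Q_def power2_norm_eq_inner[symmetric])
  \<comment> \<open>The inner boundary of the annulus lies in the open ball, where \<open>f < g\<close>; on the outer one the barrier vanishes.\<close>
  have inner_pos: "0 < ?w y" if "y \<in> N" "Q y = 1 / \<alpha>" for y
  proof -
    have "0 < 1 / \<alpha>" using \<alpha>0 by simp
    then have "(norm (y - x))\<^sup>2 < r\<^sup>2" using that(2) unfolding Q_def power2_norm_eq_inner by linarith
    then have "norm (y - x) < r" by (rule power2_less_imp_less) (use r in simp)
    then have "y \<in> ball c R" using rc[of y] by (simp add: dist_norm norm_minus_commute)
    then show ?thesis using lt NS(2) that by simp
  qed
  obtain m where m: "0 < m" "\<And>y. y \<in> N \<Longrightarrow> Q y = 1 / \<alpha> \<Longrightarrow> m \<le> ?w y"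
  proof (cases "\<exists>y\<in>N. Q y = 1 / \<alpha>")
    case True
    let ?I = "N \<inter> {y. Q y = 1 / \<alpha>}"
    have I1: "compact ?I"
      by (intro compact_Int_closed Ncomp closed_Collect_eq continuous_intros contQ)
    have I2: "?I \<noteq> {}" using True by auto
    have I3: "continuous_on ?I ?w" using wcont by (rule continuous_on_subset) auto
    obtain y where "y \<in> ?I" "\<forall>z\<in>?I. ?w y \<le> ?w z"
      using continuous_attains_inf[OF I1 I2 I3] by blast
    then show thesis using inner_pos by (intro that[of "?w y"]) auto
  qed (intro that[of 1], auto)
  define \<epsilon> where "\<epsilon> = m * \<alpha> / 2"
  have \<epsilon>: "0 < \<epsilon>" using m \<alpha>0 by (simp add: \<epsilon>_def)
  have above: "\<epsilon> * E y \<le> ?w y" if yN: "y \<in> N" for y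
  proof (rule ccontr)
    assume neg: "\<not> \<epsilon> * E y \<le> ?w y"
    let ?h = "\<lambda>y. ?w y - \<epsilon> * E y"
    have hcont: "continuous_on N ?h" by (intro continuous_intros wcont contE)
    obtain y1 where y1: "y1 \<in> N" "\<And>y. y \<in> N \<Longrightarrow> ?h y1 \<le> ?h y"
      using continuous_attains_inf[OF Ncomp _ hcont] y0N by blast
    have neg1: "?w y1 < \<epsilon> * E y1" using y1(2)[OF yN] neg by simp
    have w0: "0 \<le> ?w y1" using le NS(2,3)[OF y1(1)] by simp
    have "Q y1 \<noteq> 0" using neg1 w0 by (auto simp: E_def)
    moreover have "Q y1 \<noteq> 1 / \<alpha>"
    proof
      assume "Q y1 = 1 / \<alpha>"
      then have "E y1 = 1 / \<alpha> + \<alpha> * (1 / \<alpha>)\<^sup>2" by (simp only: E_def)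
      then have "\<epsilon> * E y1 = m" using \<alpha>0 by (simp add: \<epsilon>_def power2_eq_square)
      then show False using m(2)[OF y1(1) \<open>Q y1 = 1 / \<alpha>\<close>] neg1 by simp
    qed
    ultimately have Q1: "0 < Q y1" "Q y1 < 1 / \<alpha>" using y1(1) by (auto simp: N_def)
    have "open {y. 0 < Q y \<and> Q y < 1 / \<alpha>}"
      by (intro open_Collect_conj open_Collect_less continuous_intros contQ)
    then obtain d where d: "0 < d" "ball y1 d \<subseteq> {y. 0 < Q y \<and> Q y < 1 / \<alpha>}"
      using Q1 open_contains_ball by blast
    have dN: "y \<in> N" if "y \<in> ball y1 d" for y using d(2) that unfolding N_def by force
    have jet: "jet2 ?h (\<lambda>y. q y - p y - \<epsilon> *\<^sub>R dE y) (\<lambda>y. K y - H y - \<epsilon> *\<^sub>R hE y) y" if "y \<in> ball y1 d" for y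
      by (intro jet2_diff jet2_scaleR Ejet fD(4) gD(4) NS(2)[OF dN] that)
    note im = interior_minimum[OF d(1) jet y1(2)[OF dN]]
    have grad1: "q y1 - p y1 = \<epsilon> *\<^sub>R dE y1" using im(1) by simp
    have y1S: "y1 \<in> S" using NS(2) y1(1) by blast
    have psd1: "psd (K y1 - H y1 - \<epsilon> *\<^sub>R hE y1)"
      unfolding psd_def using im(2) fD(7)[OF y1S] gD(7)[OF y1S] by (auto simp: hE_def)
    have y1s: "y1 \<in> cball y0 s" using NS y1 by blast
    have symA: "?Af y1 \<in> sym_matrices" "?Ag y1 \<in> sym_matrices"
      using fD(5)[OF y1S] gD(5)[OF y1S] U_sym by auto
    obtain D where D: "F (?Ag y1) - F (?Af y1) = D \<bullet> (?Ag y1 - ?Af y1)"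
      "\<And>v. e * (norm v)\<^sup>2 \<le> v \<bullet> (D *v v)" "norm D \<le> C"
      using elliptic_near_linearize[OF ell symA nearM[OF y1s]] by blast
    have trD: "\<bar>trace D\<bar> \<le> n * C"
      using order_trans[OF abs_trace_le mult_right_mono[OF D(3), of "real CARD('n)"]]
      by (simp add: n_def mult.commute)
    have zero: "f y1 * (D \<bullet> (K y1 - H y1)) + ?w y1 * (D \<bullet> K y1)
        - (q y1 - p y1) \<bullet> (q y1 + p y1) / 2 * trace D = 0"
      using D(1) fD(6)[OF y1S] gD(6)[OF y1S] by (simp only: inner_conf_form_diff)
    have Dpos: "0 \<le> v \<bullet> (D *v v)" for v
      using D(2)[of v] lp(2) by (meson mult_nonneg_nonneg less_imp_le order_trans zero_le_power2)
    have "0 \<le> D \<bullet> (K y1 - H y1 - \<epsilon> *\<^sub>R hE y1)" by (rule psd_inner_nonneg[OF Dpos psd1])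
    then have T1: "\<epsilon> * (D \<bullet> hE y1) \<le> D \<bullet> (K y1 - H y1)" by (simp add: inner_simps)
    have aQ: "\<alpha> * Q y1 \<le> 1" "0 \<le> \<alpha> * Q y1" using Q1 \<alpha>0 by (auto simp: field_simps)
    have T2: "4 * e * r\<^sup>2 * \<alpha> - 6 * n * C \<le> D \<bullet> hE y1"
    proof -
      have "e * (r\<^sup>2 / 2) \<le> e * (norm (y1 - x))\<^sup>2"
        using Nnorm(2)[OF y1(1)] lp(2) unfolding power2_norm_eq_inner by (intro mult_left_mono) auto
      also have "\<dots> \<le> (y1 - x) \<bullet> (D *v (y1 - x))" by (rule D(2))
      finally have "e * (r\<^sup>2 / 2) \<le> (y1 - x) \<bullet> (D *v (y1 - x))" .
      then have "(8 * \<alpha>) * (e * (r\<^sup>2 / 2)) \<le> (8 * \<alpha>) * ((y1 - x) \<bullet> (D *v (y1 - x)))"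
        using \<alpha>0 by (intro mult_left_mono) auto
      moreover have "2 * (1 + 2 * \<alpha> * Q y1) * trace D \<le> 6 * (n * C)"
      proof -
        define k where "k = 2 * (1 + 2 * \<alpha> * Q y1)"
        have k: "0 \<le> k" "k \<le> 6" using aQ by (auto simp: k_def)
        have "k * trace D \<le> k * \<bar>trace D\<bar>" using k by (intro mult_left_mono) auto
        also have "\<dots> \<le> 6 * (n * C)" using k trD by (intro mult_mono) auto
        finally show ?thesis by (simp add: k_def)
      qed
      moreover have "D \<bullet> hE y1 = 8 * \<alpha> * ((y1 - x) \<bullet> (D *v (y1 - x))) - 2 * (1 + 2 * \<alpha> * Q y1) * trace D"
        by (simp only: hE_def inner_diff_right inner_scaleR_right matrix_inner_tensor matrix_inner_mat_1)
      moreover have "8 * \<alpha> * (e * (r\<^sup>2 / 2)) = 4 * e * r\<^sup>2 * \<alpha>" by simp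
      ultimately show ?thesis by linarith
    qed
    have "0 < (r\<^sup>2 * C * B1 + 3 * r * B2 * n * C + 1) / a0"
      using r lp B1 B2 n a0 by (simp add: add_nonneg_pos)
    then have hpos: "0 \<le> D \<bullet> hE y1" using T2 \<alpha>2 by linarith
    have "r\<^sup>2 * C * B1 + 3 * r * B2 * n * C + 1 \<le> a0 * (D \<bullet> hE y1)"
    proof -
      have "(r\<^sup>2 * C * B1 + 3 * r * B2 * n * C + 1) / a0 \<le> D \<bullet> hE y1" using T2 \<alpha>2 by linarith
      then show ?thesis using a0(1) by (simp add: pos_divide_le_eq mult.commute)
    qed
    also have "\<dots> \<le> f y1 * (D \<bullet> hE y1)" using a0(2)[OF y1s] hpos by (intro mult_right_mono) auto
    finally have "\<epsilon> * (r\<^sup>2 * C * B1 + 3 * r * B2 * n * C + 1) \<le> \<epsilon> * (f y1 * (D \<bullet> hE y1))"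
      using \<epsilon> by (intro mult_left_mono) auto
    also have "\<dots> = f y1 * (\<epsilon> * (D \<bullet> hE y1))" by simp
    also have "\<dots> \<le> f y1 * (D \<bullet> (K y1 - H y1))"
      using T1 fD(3)[OF y1S] by (intro mult_left_mono) auto
    finally have S1: "\<epsilon> * (r\<^sup>2 * C * B1) + \<epsilon> * (3 * r * B2 * n * C) + \<epsilon> \<le> f y1 * (D \<bullet> (K y1 - H y1))"
      by (simp add: algebra_simps)
    have S2: "\<bar>?w y1 * (D \<bullet> K y1)\<bar> \<le> \<epsilon> * (r\<^sup>2 * C * B1)"
    proof -
      have "\<alpha> * (Q y1)\<^sup>2 \<le> Q y1" using aQ Q1 by (simp add: power2_eq_square mult_right_le_one_le mult.assoc[symmetric])
      then have "E y1 \<le> r\<^sup>2" using Q1 \<alpha>r by (simp add: E_def)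
      then have "\<epsilon> * E y1 \<le> \<epsilon> * r\<^sup>2" using \<epsilon> by simp
      then have "\<bar>?w y1\<bar> \<le> \<epsilon> * r\<^sup>2" using neg1 w0 by linarith
      moreover have "\<bar>D \<bullet> K y1\<bar> \<le> C * B1"
        using Cauchy_Schwarz_ineq2[of D "K y1"] mult_mono[OF D(3) B1(2)[OF y1s]] lp(3) by simp
      ultimately have "\<bar>?w y1\<bar> * \<bar>D \<bullet> K y1\<bar> \<le> (\<epsilon> * r\<^sup>2) * (C * B1)"
        by (intro mult_mono) (use \<epsilon> in auto)
      then show ?thesis by (simp add: abs_mult mult.assoc)
    qed
    have S3: "\<bar>(q y1 - p y1) \<bullet> (q y1 + p y1) / 2 * trace D\<bar> \<le> \<epsilon> * (3 * r * B2 * n * C)"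
    proof -
      have "\<bar>- 2 * (1 + 2 * \<alpha> * Q y1)\<bar> * norm (y1 - x) \<le> 6 * r"
        using aQ Nnorm(1)[OF y1(1)] by (intro mult_mono) auto
      then have "norm (dE y1) \<le> 6 * r" by (simp add: dE_def)
      then have "norm (q y1 - p y1) \<le> \<epsilon> * (6 * r)" using grad1 \<epsilon> by simp
      then have "norm (q y1 - p y1) * norm (q y1 + p y1) \<le> \<epsilon> * (6 * r) * B2"
        using B2(2)[OF y1s] r \<epsilon> by (intro mult_mono) auto
      then have "\<bar>(q y1 - p y1) \<bullet> (q y1 + p y1)\<bar> \<le> \<epsilon> * (6 * r) * B2"
        using Cauchy_Schwarz_ineq2 order_trans by blast
      then have "\<bar>(q y1 - p y1) \<bullet> (q y1 + p y1) / 2\<bar> \<le> \<epsilon> * (3 * r) * B2" by simp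
      then have "\<bar>(q y1 - p y1) \<bullet> (q y1 + p y1) / 2\<bar> * \<bar>trace D\<bar> \<le> \<epsilon> * (3 * r) * B2 * (n * C)"
        using trD r \<epsilon> B2 by (intro mult_mono) auto
      then show ?thesis by (simp add: abs_mult mult_ac)
    qed
    show False using zero S1 S2 S3 \<epsilon> by linarith
  qed
  \<comment> \<open>The derivative of \<open>g - f - \<epsilon> E\<close> at \<open>y0\<close> towards the centre is \<open>-2\<epsilon>r\<^sup>2\<close>, against \<open>above\<close>.\<close>
  let ?v = "x - y0"
  have vv: "?v \<bullet> ?v = r\<^sup>2" using y0x by (metis norm_minus_commute power2_norm_eq_inner)
  have "jet2 (\<lambda>y. ?w y - \<epsilon> * E y) (\<lambda>y. q y - p y - \<epsilon> *\<^sub>R dE y) (\<lambda>y. K y - H y - \<epsilon> *\<^sub>R hE y) (y0 + 0 *\<^sub>R ?v)"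
    by (simp, intro jet2_diff jet2_scaleR Ejet fD(4) gD(4) y0)
  from jet2_along_line(1)[OF this]
  have "((\<lambda>t. ?w (y0 + t *\<^sub>R ?v) - \<epsilon> * E (y0 + t *\<^sub>R ?v)) has_real_derivative
      (q y0 - p y0 - \<epsilon> *\<^sub>R dE y0) \<bullet> ?v) (at 0)" by simp
  moreover have "Q y0 = 0" using y0x by (simp add: Q_def power2_norm_eq_inner[symmetric])
  then have "(q y0 - p y0 - \<epsilon> *\<^sub>R dE y0) \<bullet> ?v = - 2 * \<epsilon> * r\<^sup>2"
  proof -
    have "dE y0 = 2 *\<^sub>R ?v" using \<open>Q y0 = 0\<close> by (simp add: dE_def scaleR_diff_right)
    then have "q y0 - p y0 - \<epsilon> *\<^sub>R dE y0 = (- 2 * \<epsilon>) *\<^sub>R ?v" using eq by simp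
    then show ?thesis by (simp only: inner_scaleR_left vv)
  qed
  moreover have "- 2 * \<epsilon> * r\<^sup>2 < 0" using \<epsilon> r by simp
  ultimately obtain d where d: "0 < d" "\<And>t. 0 < t \<Longrightarrow> t < d \<Longrightarrow>
      ?w (y0 + t *\<^sub>R ?v) - \<epsilon> * E (y0 + t *\<^sub>R ?v) < ?w y0 - \<epsilon> * E y0"
    using DERIV_neg_dec_right by force
  have E0: "E y0 = 0" using \<open>Q y0 = 0\<close> by (simp add: E_def)
  define t where "t = min (d / 2) (min (1/2) (1 / (2 * \<alpha> * r\<^sup>2)))"
  have t: "0 < t" "t < d" "t \<le> 1 / 2" using d \<alpha>0 r by (auto simp: t_def)
  have "t \<le> 1 / (2 * \<alpha> * r\<^sup>2)" by (simp add: t_def)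
  then have t2: "2 * t * r\<^sup>2 \<le> 1 / \<alpha>" using \<alpha>0 r by (simp add: field_simps)
  have "(y0 + t *\<^sub>R ?v - x) = (- (1 - t)) *\<^sub>R ?v" by (simp add: algebra_simps)
  then have "Q (y0 + t *\<^sub>R ?v) = r\<^sup>2 - (- (1 - t)) * ((- (1 - t)) * r\<^sup>2)"
    unfolding Q_def by (simp only: inner_scaleR_left inner_scaleR_right vv)
  also have "\<dots> = 2 * t * r\<^sup>2 - t\<^sup>2 * r\<^sup>2" by (simp add: power2_eq_square algebra_simps)
  finally have Qt: "Q (y0 + t *\<^sub>R ?v) = 2 * t * r\<^sup>2 - t\<^sup>2 * r\<^sup>2" .
  have "t\<^sup>2 * r\<^sup>2 \<le> t * r\<^sup>2" using t by (intro mult_right_mono) (auto simp: power2_eq_square mult_left_le)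
  moreover have "0 \<le> t * r\<^sup>2" "0 \<le> t\<^sup>2 * r\<^sup>2" using t by auto
  ultimately have "y0 + t *\<^sub>R ?v \<in> N" unfolding N_def mem_Collect_eq Qt using t2 by linarith
  from above[OF this] show False using d(2)[OF t(1,2)] eq E0 by simp
qed

end

section \<open>Superharmonic functions on a punctured ball\<close>

text \<open>
  In dimension \<open>n \<ge> 3\<close> this function is strictly superharmonic, its Laplacian being \<open>-2(n-2)/|y|\<^sup>2\<close>, and it
  tends to infinity at the origin.
\<close>
lemma jet2_neg_ln_norm_squared:
  assumes "y \<noteq> (0 :: real^'n)"
  shows "jet2 (\<lambda>y. - ln (y \<bullet> y)) (\<lambda>y. (- 2 / (y \<bullet> y)) *\<^sub>R y)
    (\<lambda>y. (4 / (y \<bullet> y)\<^sup>2) *\<^sub>R tensor y y - (2 / (y \<bullet> y)) *\<^sub>R mat 1) y"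
  unfolding jet2_def
proof
  have yy: "0 < y \<bullet> y" using assms by simp
  show "((\<lambda>y. - ln (y \<bullet> y)) has_derivative (\<bullet>) ((- 2 / (y \<bullet> y)) *\<^sub>R y)) (at y)"
    by (rule derivative_eq_intros refl yy)+ (simp add: fun_eq_iff inner_commute divide_inverse)
  show "((\<lambda>y. (- 2 / (y \<bullet> y)) *\<^sub>R y) has_derivative
      (*v) ((4 / (y \<bullet> y)\<^sup>2) *\<^sub>R tensor y y - (2 / (y \<bullet> y)) *\<^sub>R mat 1)) (at y)"
  proof (rule has_derivative_eq_rhs[OF has_derivative_scaleR[OF _ has_derivative_ident]])
    show "((\<lambda>y. - 2 / (y \<bullet> y)) has_derivative (\<lambda>k. 4 * (y \<bullet> k) / (y \<bullet> y)\<^sup>2)) (at y)"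
      by (rule derivative_eq_intros refl yy[THEN less_imp_neq, symmetric])+
         (use yy in \<open>auto simp: fun_eq_iff inner_commute power2_eq_square divide_inverse\<close>)
    show "(\<lambda>h. (- 2 / (y \<bullet> y)) *\<^sub>R h + (4 * (y \<bullet> h) / (y \<bullet> y)\<^sup>2) *\<^sub>R y) =
        (*v) ((4 / (y \<bullet> y)\<^sup>2) *\<^sub>R tensor y y - (2 / (y \<bullet> y)) *\<^sub>R mat 1)"
      by (simp add: fun_eq_iff matrix_vector_mult_diff_rdistrib
          scaleR_matrix_vector_assoc[symmetric] tensor_mult_vector)
  qed
qed

lemma jet2_norm:
  assumes "y \<noteq> (0 :: real^'n)"
  shows "jet2 norm (\<lambda>y. (1 / norm y) *\<^sub>R y)
    (\<lambda>y. (1 / norm y) *\<^sub>R mat 1 - (1 / norm y ^ 3) *\<^sub>R tensor y y) y"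
  unfolding jet2_def
proof
  have y: "0 < norm y" using assms by simp
  have d: "(norm has_derivative (\<lambda>k. y \<bullet> k / norm y)) (at y)"
    using has_derivative_norm[OF assms] by (simp add: sgn_div_norm inner_commute divide_inverse mult.commute)
  then show "(norm has_derivative (\<bullet>) ((1 / norm y) *\<^sub>R y)) (at y)"
    by (rule has_derivative_eq_rhs) (simp add: fun_eq_iff)
  show "((\<lambda>y. (1 / norm y) *\<^sub>R y) has_derivative
      (*v) ((1 / norm y) *\<^sub>R mat 1 - (1 / norm y ^ 3) *\<^sub>R tensor y y)) (at y)"
  proof (rule has_derivative_eq_rhs[OF has_derivative_scaleR[OF _ has_derivative_ident]])
    show "((\<lambda>y. 1 / norm y) has_derivative (\<lambda>k. - (y \<bullet> k) / norm y ^ 3)) (at y)"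
      by (rule derivative_eq_intros d refl y[THEN less_imp_neq, symmetric])+
         (use y in \<open>auto simp: fun_eq_iff power3_eq_cube divide_inverse\<close>)
    show "(\<lambda>h. (1 / norm y) *\<^sub>R h + (- (y \<bullet> h) / norm y ^ 3) *\<^sub>R y) =
        (*v) ((1 / norm y) *\<^sub>R mat 1 - (1 / norm y ^ 3) *\<^sub>R tensor y y)"
      by (simp add: fun_eq_iff matrix_vector_mult_diff_rdistrib
          scaleR_matrix_vector_assoc[symmetric] tensor_mult_vector)
  qed
qed

lemma trace_nonneg_if_quadratic_nonneg:
  assumes "\<And>e. 0 \<le> e \<bullet> ((H :: real^'n^'n) *v e)" shows "0 \<le> trace H"
  unfolding trace_def using assms[of "axis _ 1"] by (intro sum_nonneg) (simp add: axis_quadratic)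

lemma annulus_interior_minimum:
  fixes h :: "real^'n \<Rightarrow> real"
  assumes cont: "continuous_on (cball 0 r - ball 0 b) h"
    and jet: "\<And>x. b < norm x \<Longrightarrow> norm x < r \<Longrightarrow> jet2 h p H x"
    and y: "b \<le> norm y" "norm y \<le> r"
    and bdry: "\<And>x. norm x = b \<or> norm x = r \<Longrightarrow> h y < h x"
  obtains x where "b < norm x" "norm x < r" "h x \<le> h y" "p x = 0" "\<And>e. 0 \<le> e \<bullet> (H x *v e)"
proof -
  let ?N = "cball 0 r - ball 0 b :: (real^'n) set"
  have "compact ?N" by (intro compact_diff compact_cball open_ball)
  moreover have yN: "y \<in> ?N" using y by auto
  ultimately obtain x where x: "x \<in> ?N" "\<And>z. z \<in> ?N \<Longrightarrow> h x \<le> h z"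
    using continuous_attains_inf[OF _ _ cont] by blast
  have hx: "h x \<le> h y" by (rule x(2)[OF yN])
  then have "norm x \<noteq> b" "norm x \<noteq> r" using bdry[of x] by auto
  then have xin: "b < norm x" "norm x < r" using x(1) by auto
  define d where "d = min (norm x - b) (r - norm x)"
  have d: "0 < d" using xin by (simp add: d_def)
  have dN: "b < norm w" "norm w < r" if "w \<in> ball x d" for w
  proof -
    have "norm (x - w) < norm x - b" "norm (x - w) < r - norm x"
      using that by (auto simp: d_def dist_norm)
    then show "b < norm w" "norm w < r"
      using norm_triangle_ineq2[of x w] norm_triangle_ineq2[of w x]
      by (auto simp: norm_minus_commute)
  qed
  have "h x \<le> h w" if "w \<in> ball x d" for w
    using dN[OF that] by (intro x(2)) auto
  note im = interior_minimum[OF d jet[OF dN] this]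
  show thesis using that[OF xin hx im] .
qed

text \<open>
  Adding a small multiple of \<open>- ln |y|\<^sup>2\<close> makes the function strictly superharmonic and infinite at the
  puncture, so that its minimum is attained on the outer sphere.
\<close>
lemma punctured_minimum_principle:
  fixes v :: "real^'n \<Rightarrow> real"
  assumes dim: "3 \<le> CARD('n)" and r: "0 < r"
    and cont: "continuous_on (cball 0 r - {0}) v"
    and jet: "\<And>y. y \<in> ball 0 r - {0} \<Longrightarrow> jet2 v p H y"
    and sup: "\<And>y. y \<in> ball 0 r - {0} \<Longrightarrow> trace (H y) \<le> 0"
    and bdd: "\<And>y. y \<in> ball 0 r - {0} \<Longrightarrow> - B \<le> v y"
    and bdry: "\<And>y. norm y = r \<Longrightarrow> m \<le> v y"
    and y: "y \<in> cball 0 r - {0}"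
  shows "m \<le> v y"
proof (rule field_le_epsilon)
  fix e :: real assume e: "0 < e"
  define L where "L y = ln (r\<^sup>2) - ln (y \<bullet> y)" for y :: "real^'n"
  have Lpos: "0 \<le> L y" if "y \<in> cball 0 r - {0}" for y
  proof -
    have "y \<bullet> y \<le> r\<^sup>2" "0 < y \<bullet> y"
      using that r by (auto simp: power2_norm_eq_inner[symmetric] power_mono)
    then have "ln (y \<bullet> y) \<le> ln (r\<^sup>2)" by (subst ln_le_cancel_iff) (use r in auto)
    then show ?thesis by (simp add: L_def)
  qed
  define \<eta> where "\<eta> = e / (L y + 1)"
  have \<eta>: "0 < \<eta>" using e Lpos[OF y] by (simp add: \<eta>_def add_nonneg_pos)
  have \<eta>e: "\<eta> * L y \<le> e"
  proof -
    have "0 < L y + 1" using Lpos[OF y] by simp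
    moreover have "e * L y \<le> e * (L y + 1)" using e by simp
    ultimately show ?thesis by (simp add: \<eta>_def pos_divide_le_eq)
  qed
  define V where "V y = v y + \<eta> * L y" for y
  define k where "k = (\<bar>m\<bar> + \<bar>B\<bar>) / \<eta>"
  have k: "0 \<le> k" using \<eta> by (simp add: k_def)
  define a where "a = min (norm y) (r * exp (- k))"
  have a: "0 < a" "a \<le> norm y" "a \<le> r * exp (- k)" using y r by (auto simp: a_def)
  have ar: "a \<le> r" using a(2) y by auto
  have inner_low: "m \<le> V z" if z: "norm z = a" "a < r" for z
  proof -
    have zz: "z \<bullet> z = a\<^sup>2" using z by (simp add: power2_norm_eq_inner[symmetric])
    have "ln a \<le> ln (r * exp (- k))" using a by simp
    also have "\<dots> = ln r - k" using r by (simp add: ln_mult)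
    finally have "ln a \<le> ln r - k" .
    then have "k \<le> L z" using r a k by (simp add: L_def zz ln_realpow)
    then have "\<eta> * k \<le> \<eta> * L z" using \<eta> by simp
    then have "\<bar>m\<bar> + \<bar>B\<bar> \<le> \<eta> * L z" using \<eta> by (simp add: k_def)
    moreover have "- B \<le> v z" using bdd[of z] z a by auto
    ultimately show ?thesis unfolding V_def by linarith
  qed
  have "m \<le> V y"
  proof (rule ccontr)
    assume neg: "\<not> m \<le> V y"
    have N0: "z \<in> cball 0 r - {0}" if "z \<in> cball 0 r - ball 0 a" for z using that a by auto
    have contL: "continuous_on (cball 0 r - ball 0 a) L"
      unfolding L_def by (intro continuous_intros) (use N0 a in auto)
    have contV: "continuous_on (cball 0 r - ball 0 a) V"
      unfolding V_def by (intro continuous_intros contL continuous_on_subset[OF cont]) (use N0 in blast)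
    have outer: "m \<le> V z" if z: "norm z = r" for z
    proof -
      have "L z = 0" using z by (simp add: L_def power2_norm_eq_inner[symmetric])
      then show ?thesis using bdry[OF z] by (simp add: V_def)
    qed
    have bd: "V y < V z" if "norm z = a \<or> norm z = r" for z
    proof -
      have "m \<le> V z" using that inner_low outer ar by (cases "a = r") auto
      then show ?thesis using neg by linarith
    qed
    let ?hL = "\<lambda>y. 0 + ((4 / (y \<bullet> y)\<^sup>2) *\<^sub>R tensor y y - (2 / (y \<bullet> y)) *\<^sub>R mat 1)"
    have Vjet: "jet2 V (\<lambda>y. p y + \<eta> *\<^sub>R (0 + (- 2 / (y \<bullet> y)) *\<^sub>R y)) (\<lambda>y. H y + \<eta> *\<^sub>R ?hL y) x"
      if "a < norm x" "norm x < r" for x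
      unfolding V_def[abs_def] L_def[abs_def] diff_conv_add_uminus[of "ln _"]
      by (intro jet2_add jet2_scaleR jet2_const jet2_neg_ln_norm_squared jet) (use that a in auto)
    obtain z where zin: "a < norm z" "norm z < r"
      and hess: "\<And>e. 0 \<le> e \<bullet> ((H z + \<eta> *\<^sub>R ?hL z) *v e)"
      using annulus_interior_minimum[OF contV Vjet a(2) _ bd] y by auto
    have "0 \<le> trace (H z + \<eta> *\<^sub>R ?hL z)" by (rule trace_nonneg_if_quadratic_nonneg[OF hess])
    also have "\<dots> = trace (H z) + \<eta> * trace (?hL z)" by (simp only: trace_add trace_scaleR)
    also have "trace (?hL z) = - (2 * (real CARD('n) - 2) / (z \<bullet> z))"
    proof -
      have "z \<noteq> 0" using zin a by auto
      then show ?thesis by (simp add: trace_add trace_sub power2_eq_square field_simps)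
    qed
    finally have "0 \<le> trace (H z) - \<eta> * (2 * (real CARD('n) - 2) / (z \<bullet> z))" by simp
    moreover have "0 < \<eta> * (2 * (real CARD('n) - 2) / (z \<bullet> z))"
      using \<eta> dim zin a by (intro mult_pos_pos divide_pos_pos) auto
    moreover have "trace (H z) \<le> 0" by (rule sup) (use zin a in auto)
    ultimately show False by linarith
  qed
  then show "m \<le> v y + e" using \<eta>e by (simp add: V_def)
qed

section \<open>Comparison at the puncture\<close>

context elliptic_operator
begin

text \<open>
  The case of interest is the sum of \<open>g\<close> and \<open>-\<eta>|y|\<^sup>2 + w \<bullet> y + k\<close> with \<open>|w| \<le> \<eta> r\<close> and \<open>k \<ge> 0\<close>, at points where
  this function is negative; \<open>a\<close> is then the value of the sum and \<open>v\<close> the gradient of the perturbation.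
  On a ball of small radius \<open>r\<close> the value and the gradient of the perturbation are of order \<open>\<eta> r\<close>, while
  its Hessian \<open>-2\<eta>I\<close> is of order \<open>\<eta>\<close> and therefore decides the sign of the change of \<open>F\<close>.
\<close>
lemma strict_supersolution_perturbation:
  assumes g: "solution_on S g q K" and S0: "0 \<in> S"
  obtains s \<eta>0 where "0 < s" "cball 0 s \<subseteq> S"
    "\<And>r. 0 < r \<Longrightarrow> r \<le> s \<Longrightarrow> 0 < \<eta>0 r"
    "\<And>r \<eta> y v a. \<lbrakk>0 < r; r \<le> s; 0 < \<eta>; \<eta> \<le> \<eta>0 r; norm y \<le> r; norm v \<le> 3 * \<eta> * r; a < g y; g y - 2 * \<eta> * r\<^sup>2 \<le> a\<rbrakk> \<Longrightarrow>
      conf_form a (q y + v) (K y - (2 * \<eta>) *\<^sub>R mat 1) \<in> U \<and>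
      F (conf_form a (q y + v) (K y - (2 * \<eta>) *\<^sub>R mat 1)) < 1"
proof -
  let ?A = "\<lambda>y. conf_form (g y) (q y) (K y)"
  note gD = solution_onD[OF g]
  define M where "M = ?A 0"
  obtain \<rho> e C where ell: "elliptic_near M \<rho> e C"
    using local_ellipticity[OF gD(5)[OF S0]] unfolding M_def .
  note lp = elliptic_near_pos[OF ell]
  obtain s1 where s1: "0 < s1" "cball 0 s1 \<subseteq> S" "\<And>y. y \<in> cball 0 s1 \<Longrightarrow> norm (?A y - M) < \<rho> / 2"
    using solution_near[OF g S0, of "\<rho> / 2"] lp(1) unfolding M_def by auto
  note sub = s1(2)
  obtain z where z: "z \<in> cball 0 s1" "\<And>y. y \<in> cball 0 s1 \<Longrightarrow> g z \<le> g y"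
    using continuous_attains_inf[OF compact_cball _ continuous_on_subset[OF gD(8) sub]] s1(1) by auto
  define a0 where "a0 = g z"
  have a0: "0 < a0" "\<And>y. y \<in> cball 0 s1 \<Longrightarrow> a0 \<le> g y" using z sub gD(3) by (auto simp: a0_def)
  obtain G where G: "0 \<le> G" "\<And>y. y \<in> cball 0 s1 \<Longrightarrow> norm (g y) \<le> G"
    using continuous_on_compact_bound[OF compact_cball continuous_on_subset[OF gD(8) sub]] by blast
  obtain B1 where B1: "0 \<le> B1" "\<And>y. y \<in> cball 0 s1 \<Longrightarrow> norm (K y) \<le> B1"
    using continuous_on_compact_bound[OF compact_cball continuous_on_subset[OF gD(2) sub]] by blast
  obtain B2 where B2: "0 \<le> B2" "\<And>y. y \<in> cball 0 s1 \<Longrightarrow> norm (q y) \<le> B2"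
    using continuous_on_compact_bound[OF compact_cball continuous_on_subset[OF gD(9) sub]] by blast
  define n where "n = real CARD('n)"
  have n: "0 < n" by (simp add: n_def)
  define k1 where "k1 = 2 * C * B1 + 3 * (2 * B2 + 3) * (n * C) / 2"
  have k1: "0 \<le> k1" using lp B1 B2 n by (simp add: k1_def)
  define k2 where "k2 = 2 * G * n + 2 * B1 + 3 * (2 * B2 + 3) * n"
  have k2: "0 \<le> k2" using B1 B2 G n by (simp add: k2_def)
  define s where "s = min 1 (min s1 (a0 * e * n / (2 * (k1 + 1))))"
  have s: "0 < s" "s \<le> 1" "s \<le> s1" using s1 a0 lp n k1 by (auto simp: s_def)
  have "s \<le> a0 * e * n / (2 * (k1 + 1))" by (simp add: s_def)
  then have "2 * s * (k1 + 1) \<le> a0 * e * n" using k1 by (simp add: field_simps)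
  moreover have "0 \<le> s * k1" using s k1 by simp
  ultimately have sk: "s * k1 < a0 * e * n" using s(1) unfolding ring_distribs by linarith
  define \<eta>0 where "\<eta>0 r = min 1 (min (a0 / (4 * r\<^sup>2)) (\<rho> / (4 * (k2 + 1))))" for r :: real
  show thesis
  proof (rule that[of s \<eta>0])
    show "0 < s" "cball 0 s \<subseteq> S" using s sub by auto
    show "0 < \<eta>0 r" if "0 < r" "r \<le> s" for r
      using that a0 lp k2 by (simp add: \<eta>0_def)
    fix r \<eta> a :: real and y v :: "real^'n"
    assume r: "0 < r" "r \<le> s" and \<eta>: "0 < \<eta>" "\<eta> \<le> \<eta>0 r" and y: "norm y \<le> r"
      and v: "norm v \<le> 3 * \<eta> * r" and a: "a < g y" "g y - 2 * \<eta> * r\<^sup>2 \<le> a"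
    have \<eta>1: "\<eta> \<le> 1" "\<eta> \<le> a0 / (4 * r\<^sup>2)" "\<eta> \<le> \<rho> / (4 * (k2 + 1))" using \<eta>(2) by (auto simp: \<eta>0_def)
    have ys: "y \<in> cball 0 s1" using y r s by simp
    have yS: "y \<in> S" using ys sub by blast
    have r1: "r \<le> 1" using r s by simp
    have r2: "r\<^sup>2 \<le> r" using r r1 by (simp add: power2_eq_square mult_left_le)
    have "4 * (\<eta> * r\<^sup>2) \<le> a0" using \<eta>1(2) r by (simp add: field_simps)
    then have ahalf: "a0 / 2 \<le> a" using a(2) a0(2)[OF ys] by simp
    have "\<eta> * (4 * (k2 + 1)) \<le> \<rho>" using \<eta>1(3) k2 by (subst (asm) pos_le_divide_eq) auto
    moreover have "0 \<le> \<eta> * k2" using \<eta> k2 by simp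
    ultimately have \<eta>k: "\<eta> * k2 < \<rho> / 2" using \<eta>(1) unfolding ring_distribs by linarith
    let ?B = "conf_form a (q y + v) (K y - (2 * \<eta>) *\<^sub>R mat 1)"
    have nv: "\<bar>v \<bullet> (2 *\<^sub>R q y + v)\<bar> \<le> 3 * \<eta> * r * (2 * B2 + 3)"
    proof -
      have "3 * \<eta> * r \<le> 3" using \<eta>(1) \<eta>1(1) r r1 mult_mono[of \<eta> 1 r 1] by simp
      then have "norm (2 *\<^sub>R q y + v) \<le> 2 * B2 + 3"
        using norm_triangle_ineq[of "2 *\<^sub>R q y" v] v B2(2)[OF ys] by simp
      then have "norm v * norm (2 *\<^sub>R q y + v) \<le> 3 * \<eta> * r * (2 * B2 + 3)"
        using v r \<eta> by (intro mult_mono) auto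
      then show ?thesis using Cauchy_Schwarz_ineq2 order_trans by blast
    qed
    have eqB: "?A y - ?B = (2 * a * \<eta>) *\<^sub>R mat 1 + (g y - a) *\<^sub>R K y + (v \<bullet> (2 *\<^sub>R q y + v) / 2) *\<^sub>R mat 1"
    proof -
      have e: "(q y - (q y + v)) \<bullet> (q y + (q y + v)) = - (v \<bullet> (2 *\<^sub>R q y + v))"
        by (simp add: inner_minus_left scaleR_2 add.assoc)
      show ?thesis unfolding conf_form_diff e by (simp add: mult_ac)
    qed
    have ga: "0 \<le> g y - a" "g y - a \<le> 2 * \<eta> * r\<^sup>2" using a by auto
    have "norm (?A y - ?B) \<le> 2 * a * \<eta> * n + 2 * \<eta> * B1 + 3 * \<eta> * (2 * B2 + 3) * n"
    proof -
      have t1: "norm ((2 * a * \<eta>) *\<^sub>R (mat 1 :: real^'n^'n)) \<le> 2 * a * \<eta> * n"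
        using norm_mat_1_le[where 'n = 'n] \<eta> ahalf a0 by (simp add: n_def mult_left_mono)
      have "(g y - a) * norm (K y) \<le> 2 * \<eta> * r\<^sup>2 * B1"
        using ga B1(2)[OF ys] \<eta> by (intro mult_mono) auto
      also have "\<dots> \<le> 2 * \<eta> * 1 * B1"
        using r1 r \<eta> B1 by (intro mult_right_mono mult_left_mono) (auto simp: power_le_one)
      finally have t2: "norm ((g y - a) *\<^sub>R K y) \<le> 2 * \<eta> * B1" using ga by simp
      have "\<bar>v \<bullet> (2 *\<^sub>R q y + v) / 2\<bar> \<le> 3 * \<eta> * r * (2 * B2 + 3)" using nv by simp
      also have "\<dots> \<le> 3 * \<eta> * 1 * (2 * B2 + 3)"
        using r1 r \<eta> B2 by (intro mult_right_mono mult_left_mono) auto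
      finally have "\<bar>v \<bullet> (2 *\<^sub>R q y + v) / 2\<bar> * norm (mat 1 :: real^'n^'n) \<le> 3 * \<eta> * 1 * (2 * B2 + 3) * n"
        using norm_mat_1_le[where 'n = 'n] \<eta> B2 by (intro mult_mono) (auto simp: n_def)
      then have t3: "norm ((v \<bullet> (2 *\<^sub>R q y + v) / 2) *\<^sub>R (mat 1 :: real^'n^'n)) \<le> 3 * \<eta> * (2 * B2 + 3) * n"
        by simp
      show ?thesis
        unfolding eqB by (intro norm_triangle_le add_mono t1 t2 t3)
    qed
    also have "\<dots> \<le> \<eta> * k2"
    proof -
      have "a \<le> G" using a(1) G(2)[OF ys] by simp
      then have "2 * a * \<eta> * n \<le> 2 * G * \<eta> * n" using \<eta> n by (intro mult_right_mono) auto
      then show ?thesis unfolding k2_def by (simp add: algebra_simps)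
    qed
    finally have AB: "norm (?A y - ?B) < \<rho> / 2" using \<eta>k by simp
    have nA: "norm (?A y - M) < \<rho> / 2" by (rule s1(3)[OF ys])
    have nB: "norm (?B - M) < \<rho>"
      using norm_triangle_ineq[of "?B - ?A y" "?A y - M"] AB nA by (simp add: norm_minus_commute)
    have symB: "?B \<in> sym_matrices"
      using gD(7)[OF yS] by (auto simp: conf_form_def)
    have BU: "?B \<in> U" by (rule elliptic_near_in_U[OF ell symB nB])
    have nA': "norm (?A y - M) < \<rho>" using nA lp(1) by linarith
    obtain D where D: "F (?A y) - F ?B = D \<bullet> (?A y - ?B)"
      "\<And>v. e * (norm v)\<^sup>2 \<le> v \<bullet> (D *v v)" "norm D \<le> C"
      using elliptic_near_linearize[OF ell symB U_sym[OF gD(5)[OF yS]] nB nA'] by blast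
    have trD: "\<bar>trace D\<bar> \<le> n * C"
      using order_trans[OF abs_trace_le mult_right_mono[OF D(3), of "real CARD('n)"]]
      by (simp add: n_def mult.commute)
    have trl: "e * n \<le> trace D" using trace_lower_bound[OF D(2)] by (simp add: n_def)
    have "a0 * \<eta> * (e * n) \<le> 2 * a * \<eta> * trace D"
      using ahalf \<eta> trl a0 lp n by (intro mult_mono) auto
    then have u1: "\<eta> * (a0 * e * n) \<le> 2 * a * \<eta> * trace D" by (simp add: mult_ac)
    have u2: "\<bar>(g y - a) * (D \<bullet> K y)\<bar> \<le> \<eta> * (r * (2 * C * B1))"
    proof -
      have "\<bar>D \<bullet> K y\<bar> \<le> C * B1"
        using Cauchy_Schwarz_ineq2[of D "K y"] mult_mono[OF D(3) B1(2)[OF ys]] lp(3) by simp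
      moreover have "2 * \<eta> * r\<^sup>2 \<le> 2 * \<eta> * r" using r2 \<eta> by simp
      then have "\<bar>g y - a\<bar> \<le> 2 * \<eta> * r" using ga by linarith
      ultimately have "\<bar>g y - a\<bar> * \<bar>D \<bullet> K y\<bar> \<le> 2 * \<eta> * r * (C * B1)"
        using \<eta> r by (intro mult_mono) auto
      then show ?thesis by (simp add: abs_mult mult_ac)
    qed
    have u3: "\<bar>v \<bullet> (2 *\<^sub>R q y + v) / 2 * trace D\<bar> \<le> \<eta> * (r * (3 * (2 * B2 + 3) * (n * C) / 2))"
    proof -
      have "\<bar>v \<bullet> (2 *\<^sub>R q y + v) / 2\<bar> \<le> 3 * \<eta> * r * (2 * B2 + 3) / 2" using nv by simp
      then have "\<bar>v \<bullet> (2 *\<^sub>R q y + v) / 2\<bar> * \<bar>trace D\<bar> \<le> 3 * \<eta> * r * (2 * B2 + 3) / 2 * (n * C)"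
        using trD \<eta> r B2 by (intro mult_mono) auto
      then show ?thesis by (simp add: abs_mult mult_ac)
    qed
    have "D \<bullet> (?A y - ?B) = 2 * a * \<eta> * trace D + (g y - a) * (D \<bullet> K y) + v \<bullet> (2 *\<^sub>R q y + v) / 2 * trace D"
      unfolding eqB by (simp only: inner_add_right inner_scaleR_right matrix_inner_mat_1)
    moreover have "\<eta> * (r * k1) < \<eta> * (a0 * e * n)"
    proof -
      have "r * k1 \<le> s * k1" using r k1 by (intro mult_right_mono) auto
      then show ?thesis using sk \<eta> by simp
    qed
    moreover have "\<eta> * (r * k1) = \<eta> * (r * (2 * C * B1)) + \<eta> * (r * (3 * (2 * B2 + 3) * (n * C) / 2))"
      unfolding k1_def by (simp only: ring_distribs)
    ultimately have "0 < D \<bullet> (?A y - ?B)" using u1 u2 u3 by linarith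
    then have "F ?B < 1" using D(1) gD(6)[OF yS] by simp
    then show "?B \<in> U \<and> F ?B < 1" using BU by simp
  qed
qed

text \<open>
  For every small vector \<open>v\<close> the function \<open>g - \<eta>|y|\<^sup>2 + v \<bullet> y\<close> lies above \<open>f\<close>: otherwise, raised by a
  positive constant, it would touch \<open>f\<close> from above. The raised function exceeds \<open>f\<close> near the puncture
  because \<open>f < g\<close>, so the touching point would not be the puncture, and there \<open>F_mono\<close> contradicts
  \<open>strict_supersolution_perturbation\<close>. The best choice of \<open>v\<close> gives \<open>f \<le> g - P|y|\<close>. Near the origin the
  cone \<open>-P|y|/2\<close> is so superharmonic that \<open>g - f - P|y|/2\<close> is superharmonic too, and it is
  bounded below by its minimum on a small sphere, which is positive.
\<close>
lemma strict_order_at_puncture: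
  assumes dim: "3 \<le> CARD('n)"
    and g: "solution_on S g q K" and S0: "0 \<in> S"
    and f: "solution_on (S - {0}) f p H"
    and sub: "\<And>y. y \<in> S - {0} \<Longrightarrow> 0 \<le> trace (H y)"
    and lt: "\<And>y. y \<in> S - {0} \<Longrightarrow> f y < g y"
  obtains \<kappa> r where "0 < \<kappa>" "0 < r" "\<And>y. 0 < norm y \<Longrightarrow> norm y < r \<Longrightarrow> f y \<le> g y - \<kappa>"
proof -
  note gD = solution_onD[OF g] and fD = solution_onD[OF f]
  obtain r \<eta>0 where r: "0 < r" "cball 0 r \<subseteq> S" and \<eta>0: "\<And>r'. 0 < r' \<Longrightarrow> r' \<le> r \<Longrightarrow> 0 < \<eta>0 r'"
    and pert: "\<And>r' \<eta> y v a. \<lbrakk>0 < r'; r' \<le> r; 0 < \<eta>; \<eta> \<le> \<eta>0 r'; norm y \<le> r'; norm v \<le> 3 * \<eta> * r'; a < g y; g y - 2 * \<eta> * r'\<^sup>2 \<le> a\<rbrakk> \<Longrightarrow>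
      conf_form a (q y + v) (K y - (2 * \<eta>) *\<^sub>R mat 1) \<in> U \<and>
      F (conf_form a (q y + v) (K y - (2 * \<eta>) *\<^sub>R mat 1)) < 1"
    using strict_supersolution_perturbation[OF g S0] by blast
  have contgf: "continuous_on T (\<lambda>y. g y - f y)" if "T \<subseteq> S - {0}" for T
    by (intro continuous_intros continuous_on_subset[OF fD(8) that] continuous_on_subset[OF gD(8)]) (use that in auto)
  have sphS: "sphere 0 r \<subseteq> S - {0}" using r by auto
  have "sphere (0 :: real^'n) r \<noteq> {}" using r by simp
  then obtain z where z: "z \<in> sphere 0 r" "\<And>y. y \<in> sphere 0 r \<Longrightarrow> g z - f z \<le> g y - f y"
    using continuous_attains_inf[OF compact_sphere _ contgf[OF sphS]] by blast
  define m where "m = g z - f z"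
  have m: "0 < m" using lt z sphS by (force simp: m_def)
  define \<eta> where "\<eta> = min (\<eta>0 r) (m / (2 * r\<^sup>2))"
  have \<eta>: "0 < \<eta>" "\<eta> \<le> \<eta>0 r" "\<eta> \<le> m / (2 * r\<^sup>2)" using \<eta>0[OF r(1)] m r by (auto simp: \<eta>_def)
  then have \<eta>m: "2 * \<eta> * r\<^sup>2 \<le> m" using r by (simp add: field_simps)
  have key: "0 \<le> g y - f y - \<eta> * (y \<bullet> y) + v \<bullet> y" if v: "norm v \<le> \<eta> * r" and y: "0 < norm y" "norm y \<le> r" for v y
  proof (rule ccontr)
    let ?h = "\<lambda>y. g y - f y - \<eta> * (y \<bullet> y) + v \<bullet> y"
    assume neg: "\<not> 0 \<le> ?h y"
    have hlow: "- (2 * \<eta> * r * norm x) < ?h x" if x: "0 < norm x" "norm x \<le> r" for x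
    proof -
      have "x \<in> cball 0 r - {0}" using x by auto
      then have "0 < g x - f x" using lt[of x] r by auto
      moreover have "\<eta> * (x \<bullet> x) \<le> \<eta> * (r * norm x)"
        using x \<eta> by (simp add: power2_norm_eq_inner[symmetric] power2_eq_square)
      moreover have "\<bar>v \<bullet> x\<bar> \<le> \<eta> * r * norm x"
        using Cauchy_Schwarz_ineq2[of v x] mult_right_mono[OF v, of "norm x"] by simp
      ultimately show ?thesis by (simp add: algebra_simps)
    qed
    define b where "b = min (norm y) (- ?h y / (2 * \<eta> * r))"
    have b: "0 < b" "b \<le> norm y" using y neg \<eta> r by (auto simp: b_def)
    have "b \<le> - ?h y / (2 * \<eta> * r)" by (simp add: b_def)
    then have hb: "2 * \<eta> * r * b \<le> - ?h y" using \<eta> r by (simp add: field_simps)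
    let ?N = "cball 0 r - ball 0 b :: (real^'n) set"
    have NS: "?N \<subseteq> S - {0}" using r b by auto
    have conth: "continuous_on ?N ?h" by (intro continuous_intros contgf[OF NS])
    have inner: "?h y < ?h x" if "norm x = b" for x
      using hlow[of x] hb that b y(2) by simp
    have outer: "0 \<le> ?h x" if xr: "norm x = r" for x
    proof -
      have "m \<le> g x - f x" using z(2)[of x] xr by (simp add: m_def)
      moreover have "norm v * norm x \<le> \<eta> * r * norm x" by (rule mult_right_mono[OF v]) simp
      then have "\<bar>v \<bullet> x\<bar> \<le> \<eta> * r * norm x" by (rule order_trans[OF Cauchy_Schwarz_ineq2])
      then have "\<bar>v \<bullet> x\<bar> \<le> \<eta> * r\<^sup>2" unfolding xr by (simp add: power2_eq_square mult.assoc)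
      moreover have "\<eta> * (x \<bullet> x) = \<eta> * r\<^sup>2" by (simp add: power2_norm_eq_inner[symmetric] xr)
      ultimately show ?thesis using \<eta>m by linarith
    qed
    have bd: "?h y < ?h x" if "norm x = b \<or> norm x = r" for x
      using that inner[of x] outer[of x] neg by linarith
    have jet: "jet2 ?h (\<lambda>y. q y - p y - \<eta> *\<^sub>R (2 *\<^sub>R (y - 0)) + v) (\<lambda>y. K y - H y - \<eta> *\<^sub>R (2 *\<^sub>R mat 1) + 0) w"
      if "b < norm w" "norm w < r" for w
    proof -
      have "w \<in> ?N" using that by auto
      then have w: "w \<in> S" "w \<in> S - {0}" using NS by blast+
      show ?thesis
        using jet2_add[OF jet2_diff[OF jet2_diff[OF gD(4)[OF w(1)] fD(4)[OF w(2)]]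
              jet2_scaleR[OF jet2_norm_squared[of 0 w], of \<eta>]] jet2_linear[of v w]] by simp
    qed
    obtain x where xin: "b < norm x" "norm x < r" and hx: "?h x \<le> ?h y"
      and im: "q x - p x - \<eta> *\<^sub>R (2 *\<^sub>R (x - 0)) + v = 0"
        "\<And>e. 0 \<le> e \<bullet> ((K x - H x - \<eta> *\<^sub>R (2 *\<^sub>R mat 1) + 0) *v e)"
      using annulus_interior_minimum[OF conth jet b(2) y(2) bd] by blast
    have x: "x \<in> ?N" and xn: "norm x \<le> r" using xin by auto
    have xS: "x \<in> S - {0}" "x \<in> S" using subsetD[OF NS x] by auto
    define w where "w = v - (2 * \<eta>) *\<^sub>R x"
    have px: "p x = q x + w" using im(1) by (simp add: w_def algebra_simps)
    have psd1: "psd (K x - (2 * \<eta>) *\<^sub>R mat 1 - H x)"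
      unfolding psd_def using im(2) fD(7)[OF xS(1)] gD(7)[OF xS(2)] by (auto simp: algebra_simps)
    have wn: "norm w \<le> 3 * \<eta> * r"
    proof -
      have "norm w \<le> norm v + norm ((2 * \<eta>) *\<^sub>R x)" unfolding w_def by (rule norm_triangle_ineq4)
      also have "\<dots> \<le> \<eta> * r + 2 * \<eta> * r"
      proof (rule add_mono[OF v])
        have "2 * \<eta> * norm x \<le> 2 * \<eta> * r" using xn \<eta>(1) by (intro mult_left_mono) auto
        then show "norm ((2 * \<eta>) *\<^sub>R x) \<le> 2 * \<eta> * r" using \<eta>(1) by simp
      qed
      finally show ?thesis by simp
    qed
    have fg: "f x < g x" using lt xS by blast
    have gf: "g x - 2 * \<eta> * r\<^sup>2 \<le> f x"
    proof -
      have "?h x < 0" using hx neg by simp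
      moreover have "\<eta> * (x \<bullet> x) \<le> \<eta> * r\<^sup>2"
        using xn \<eta> by (simp add: power2_norm_eq_inner[symmetric] power_mono)
      moreover have "norm v * norm x \<le> \<eta> * r * r" using v xn \<eta>(1) r(1) by (intro mult_mono) auto
      then have "\<bar>v \<bullet> x\<bar> \<le> \<eta> * r\<^sup>2"
        using order_trans[OF Cauchy_Schwarz_ineq2] by (simp add: power2_eq_square mult.assoc)
      ultimately show ?thesis by linarith
    qed
    let ?B = "conf_form (f x) (q x + w) (K x - (2 * \<eta>) *\<^sub>R mat 1)"
    have B: "?B \<in> U" "F ?B < 1"
      using pert[OF r(1) order_refl \<eta>(1,2) xn wn fg gf] by auto
    have "?B - conf_form (f x) (p x) (H x) = f x *\<^sub>R (K x - (2 * \<eta>) *\<^sub>R mat 1 - H x)"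
      by (simp add: conf_form_diff px)
    moreover have "psd (f x *\<^sub>R (K x - (2 * \<eta>) *\<^sub>R mat 1 - H x))"
      using psd1 fD(3)[OF xS(1)] by (auto simp: psd_def scaleR_matrix_vector_assoc[symmetric])
    ultimately have "F (conf_form (f x) (p x) (H x)) \<le> F ?B"
      using F_mono[OF fD(5)[OF xS(1)] B(1)] by simp
    then show False using B(2) fD(6)[OF xS(1)] by simp
  qed
  define P where "P = \<eta> * r"
  have P: "0 < P" using \<eta> r by (simp add: P_def)
  have cone: "P * norm y \<le> g y - f y" if y: "0 < norm y" "norm y \<le> r" for y
  proof -
    have "0 \<le> g y - f y - \<eta> * (y \<bullet> y) + ((- P / norm y) *\<^sub>R y) \<bullet> y"
      by (rule key[OF _ y]) (use y P in \<open>simp add: P_def\<close>)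
    moreover have "((- P / norm y) *\<^sub>R y) \<bullet> y = - P * norm y"
      using y by (simp add: power2_norm_eq_inner[symmetric] power2_eq_square)
    moreover have "0 \<le> \<eta> * (y \<bullet> y)" using \<eta> by simp
    ultimately show ?thesis by linarith
  qed
  obtain B1 where B1: "0 \<le> B1" "\<And>y. y \<in> cball 0 r \<Longrightarrow> norm (K y) \<le> B1"
    using continuous_on_compact_bound[OF compact_cball continuous_on_subset[OF gD(2) r(2)]] by blast
  define n where "n = real CARD('n)"
  have n: "3 \<le> n" using dim by (simp add: n_def)
  define r2 where "r2 = min r (P / (n * B1 + 1))"
  have nB: "0 < n * B1 + 1" using n B1 by (simp add: add_nonneg_pos)
  have r2: "0 < r2" "r2 \<le> r" using r P nB by (auto simp: r2_def)
  have "r2 \<le> P / (n * B1 + 1)" by (simp add: r2_def)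
  then have r2P: "r2 * (n * B1 + 1) \<le> P" using nB by (simp add: pos_le_divide_eq)
  let ?v = "\<lambda>y. g y - f y - (P / 2) * norm y"
  have *: "P * r2 / 2 \<le> ?v y" if y: "y \<in> cball 0 r2 - {0}" for y
  proof (rule punctured_minimum_principle[OF dim r2(1) _ _ _ _ _ y])
    have sub2: "cball 0 r2 - {0} \<subseteq> S - {0}" using r r2 by auto
    have inS: "y \<in> S - {0}" "y \<in> S" if "y \<in> ball 0 r2 - {0}" for y
    proof -
      have "y \<in> cball 0 r2 - {0}" using that by auto
      then show "y \<in> S - {0}" using sub2 by blast
      then show "y \<in> S" by blast
    qed
    show "continuous_on (cball 0 r2 - {0}) ?v" by (intro continuous_intros contgf sub2)
    let ?hn = "\<lambda>y::real^'n. (1 / norm y) *\<^sub>R mat 1 - (1 / norm y ^ 3) *\<^sub>R tensor y y"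
    show "jet2 ?v (\<lambda>y. q y - p y - (P / 2) *\<^sub>R ((1 / norm y) *\<^sub>R y)) (\<lambda>y. K y - H y - (P / 2) *\<^sub>R ?hn y) y"
      if "y \<in> ball 0 r2 - {0}" for y
      by (intro jet2_diff jet2_scaleR jet2_norm gD(4) fD(4) inS that) (use that in auto)
    show "trace (K y - H y - (P / 2) *\<^sub>R ?hn y) \<le> 0" if y: "y \<in> ball 0 r2 - {0}" for y
    proof -
      have ny: "0 < norm y" "norm y < r2" using y by auto
      have "trace (?hn y) = (n - 1) / norm y"
        using ny by (simp add: trace_sub n_def power2_norm_eq_inner[symmetric] power2_eq_square power3_eq_cube field_simps)
      moreover have "trace (K y) \<le> n * B1"
      proof -
        have "norm (K y) * real CARD('n) \<le> B1 * real CARD('n)"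
          using B1(2)[of y] ny r2 by (intro mult_right_mono) auto
        then have "\<bar>trace (K y)\<bar> \<le> B1 * real CARD('n)" by (rule order_trans[OF abs_trace_le])
        then show ?thesis by (simp add: n_def mult.commute)
      qed
      moreover have "0 \<le> trace (H y)" by (rule sub[OF inS(1)[OF y]])
      moreover have "n * B1 \<le> (P / 2) * ((n - 1) / norm y)"
      proof -
        have "n * B1 * norm y \<le> (n * B1 + 1) * r2" using ny n B1 by (intro mult_mono) auto
        also have "\<dots> \<le> P" using r2P by (simp add: mult.commute)
        also have "\<dots> \<le> (P / 2) * (n - 1)" using P n by simp
        finally show ?thesis using ny by (simp add: pos_le_divide_eq)
      qed
      ultimately show ?thesis by (simp add: trace_sub)
    qed
    show "- 0 \<le> ?v y" if y: "y \<in> ball 0 r2 - {0}" for y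
    proof -
      have "0 \<le> P * norm y" using P by simp
      then show ?thesis using cone[of y] y r2 by auto
    qed
    show "P * r2 / 2 \<le> ?v y" if y: "norm y = r2" for y
      using cone[of y] y r2 by auto
  qed
  show thesis
  proof (rule that[of "P * r2 / 2" r2])
    show "0 < P * r2 / 2" "0 < r2" using P r2 by auto
    fix y :: "real^'n" assume y: "0 < norm y" "norm y < r2"
    have "0 \<le> P / 2 * norm y" using P by simp
    then show "f y \<le> g y - P * r2 / 2" using *[of y] y by auto
  qed
qed

end

section \<open>Inversions in spheres\<close>

definition inversion :: "real^'n \<Rightarrow> real \<Rightarrow> real^'n \<Rightarrow> real^'n" where
  "inversion x l y = x + (l\<^sup>2 / (norm (y - x))\<^sup>2) *\<^sub>R (y - x)"

definition reflection :: "real^'n \<Rightarrow> real^'n^'n" where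
  "reflection v = mat 1 - (2 / (v \<bullet> v)) *\<^sub>R tensor v v"

text \<open>
  With \<open>u = f powr (-(n-2)/2)\<close> this corresponds to the Kelvin transform of \<open>u\<close>. The next two functions are its
  gradient and Hessian.
\<close>
definition invert :: "(real^'n \<Rightarrow> real) \<Rightarrow> real^'n \<Rightarrow> real \<Rightarrow> real^'n \<Rightarrow> real" where
  "invert f x l y = (norm (y - x))\<^sup>2 / l\<^sup>2 * f (inversion x l y)"

definition invert_grad :: "(real^'n \<Rightarrow> real) \<Rightarrow> (real^'n \<Rightarrow> real^'n) \<Rightarrow> real^'n \<Rightarrow> real \<Rightarrow> real^'n \<Rightarrow> real^'n" where
  "invert_grad f p x l y =
     (2 / l\<^sup>2 * f (inversion x l y)) *\<^sub>R (y - x) + reflection (y - x) *v p (inversion x l y)"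

definition invert_hess :: "(real^'n \<Rightarrow> real) \<Rightarrow> (real^'n \<Rightarrow> real^'n) \<Rightarrow> (real^'n \<Rightarrow> real^'n^'n) \<Rightarrow>
    real^'n \<Rightarrow> real \<Rightarrow> real^'n \<Rightarrow> real^'n^'n" where
  "invert_hess f p H x l y =
     (2 / l\<^sup>2 * f (inversion x l y) - 2 / ((y - x) \<bullet> (y - x)) * ((y - x) \<bullet> p (inversion x l y))) *\<^sub>R mat 1
     + (l\<^sup>2 / ((y - x) \<bullet> (y - x))) *\<^sub>R
         (reflection (y - x) ** H (inversion x l y) ** reflection (y - x))"

lemma reflection_mult: "reflection v *v k = k - (2 * (v \<bullet> k) / (v \<bullet> v)) *\<^sub>R v"
  by (simp add: reflection_def matrix_vector_mult_diff_rdistrib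
      scaleR_matrix_vector_assoc[symmetric] tensor_mult_vector)

lemma reflection_involution:
  assumes "v \<noteq> 0" shows "reflection v *v (reflection v *v k) = k"
proof -
  have "v \<bullet> v \<noteq> 0" using assms by simp
  then show ?thesis by (simp add: reflection_mult inner_diff_right)
qed

lemma reflection_squared: "v \<noteq> 0 \<Longrightarrow> reflection v ** reflection v = mat 1"
  by (simp add: matrix_eq matrix_vector_mul_assoc[symmetric] reflection_involution)

lemma transpose_reflection: "transpose (reflection v) = reflection v"
proof -
  have "reflection v \<in> sym_matrices" by (simp add: reflection_def)
  then show ?thesis by (simp add: sym_matrices_def)
qed

lemma orthogonal_reflection: "v \<noteq> 0 \<Longrightarrow> orthogonal_matrix (reflection v)"
  by (simp add: orthogonal_matrix_def transpose_reflection reflection_squared)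

lemma matrix_inv_reflection:
  assumes "v \<noteq> 0" shows "matrix_inv (reflection v) = reflection v"
proof -
  let ?R = "reflection v"
  have RR: "?R ** ?R = mat 1" by (rule reflection_squared[OF assms])
  then have "?R ** matrix_inv ?R = mat 1 \<and> matrix_inv ?R ** ?R = mat 1"
    unfolding matrix_inv_def by (intro someI[of "\<lambda>B. ?R ** B = mat 1 \<and> B ** ?R = mat 1" ?R]) simp
  then have "?R ** (?R ** matrix_inv ?R) = ?R" by simp
  then show ?thesis by (simp add: matrix_mul_assoc RR)
qed

lemma inversion_has_derivative:
  assumes "y \<noteq> x"
  shows "(inversion x l has_derivative
    (\<lambda>k. (l\<^sup>2 / ((y - x) \<bullet> (y - x))) *\<^sub>R (reflection (y - x) *v k))) (at y)"
proof -
  have s: "(y - x) \<bullet> (y - x) \<noteq> 0" using assms by simp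
  have c: "((\<lambda>y. l\<^sup>2 / ((y - x) \<bullet> (y - x))) has_derivative
      (\<lambda>k. - (l\<^sup>2 * (2 * ((y - x) \<bullet> k))) / ((y - x) \<bullet> (y - x))\<^sup>2)) (at y)"
    by (rule derivative_eq_intros refl s)+
       (use s in \<open>auto simp: fun_eq_iff inner_commute power2_eq_square divide_inverse\<close>)
  have v: "((\<lambda>y. y - x) has_derivative (\<lambda>k. k)) (at y)" by (auto intro!: derivative_eq_intros)
  have e: "inversion x l = (\<lambda>y. x + (l\<^sup>2 / ((y - x) \<bullet> (y - x))) *\<^sub>R (y - x))"
    by (simp add: inversion_def fun_eq_iff power2_norm_eq_inner)
  show ?thesis unfolding e
    by (rule has_derivative_eq_rhs[OF has_derivative_add[OF has_derivative_const has_derivative_scaleR[OF c v]]])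
       (use s in \<open>simp add: fun_eq_iff reflection_mult scaleR_diff_right power2_eq_square\<close>)
qed

text \<open>
  Differentiating the gradient yields many terms in \<open>p\<close>; all of them cancel except the
  multiple of the identity in \<open>invert_hess\<close>.
\<close>
lemma invert_jet2:
  fixes y x :: "real^'n"
  assumes yx: "y \<noteq> x" and l: "l \<noteq> 0" and jet: "jet2 f p H (inversion x l y)"
  shows "jet2 (invert f x l) (invert_grad f p x l) (invert_hess f p H x l) y"
proof -
  let ?I = "inversion x l"
  define v where "v = y - x"
  define s where "s = v \<bullet> v"
  define a where "a = f (?I y)"
  define P where "P = p (?I y)"
  define M where "M = H (?I y)"
  define R where "R k = reflection v *v k" for k
  have s: "s \<noteq> 0" using yx by (simp add: s_def v_def)
  have R: "R k = k - (2 * (v \<bullet> k) / s) *\<^sub>R v" for k by (simp add: R_def reflection_mult s_def)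
  have dI: "(?I has_derivative (\<lambda>k. (l\<^sup>2 / s) *\<^sub>R R k)) (at y)"
    using inversion_has_derivative[OF yx, of l] by (simp add: s_def v_def R_def)
  have df: "((\<lambda>y. f (?I y)) has_derivative (\<lambda>k. P \<bullet> ((l\<^sup>2 / s) *\<^sub>R R k))) (at y)"
    by (rule has_derivative_compose[OF dI]) (use jet in \<open>simp add: jet2_def P_def\<close>)
  have dp: "((\<lambda>y. p (?I y)) has_derivative (\<lambda>k. M *v ((l\<^sup>2 / s) *\<^sub>R R k))) (at y)"
    by (rule has_derivative_compose[OF dI]) (use jet in \<open>simp add: jet2_def M_def\<close>)
  have dv: "((\<lambda>y. y - x) has_derivative (\<lambda>k. k)) (at y)" by (auto intro!: derivative_eq_intros)
  have ds: "((\<lambda>y. (y - x) \<bullet> (y - x)) has_derivative (\<lambda>k. 2 * (v \<bullet> k))) (at y)"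
    unfolding v_def by (auto intro!: derivative_eq_intros simp: inner_commute)
  show ?thesis
    unfolding jet2_def
  proof
    have i: "invert f x l = (\<lambda>y. ((y - x) \<bullet> (y - x)) / l\<^sup>2 * f (?I y))"
      by (simp add: fun_eq_iff invert_def power2_norm_eq_inner)
    have "((\<lambda>y. ((y - x) \<bullet> (y - x)) / l\<^sup>2) has_derivative (\<lambda>k. 2 * (v \<bullet> k) / l\<^sup>2)) (at y)"
      using has_derivative_mult_left[OF ds, of "1 / l\<^sup>2"] by simp
    from has_derivative_mult[OF this df]
    show "(invert f x l has_derivative (\<bullet>) (invert_grad f p x l y)) (at y)"
      unfolding i
      by (rule has_derivative_eq_rhs)
         (use s l in \<open>simp add: fun_eq_iff invert_grad_def v_def[symmetric] s_def[symmetric] a_def[symmetric]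
           P_def[symmetric] R_def[symmetric] R inner_simps inner_commute field_simps\<close>)
    have g: "invert_grad f p x l = (\<lambda>y. (2 / l\<^sup>2 * f (?I y)) *\<^sub>R (y - x) + (p (?I y)
        - (2 * ((y - x) \<bullet> p (?I y)) / ((y - x) \<bullet> (y - x))) *\<^sub>R (y - x)))"
      by (simp add: fun_eq_iff invert_grad_def reflection_mult)
    have d1: "((\<lambda>y. 2 / l\<^sup>2 * f (?I y)) has_derivative (\<lambda>k. 2 / l\<^sup>2 * (P \<bullet> ((l\<^sup>2 / s) *\<^sub>R R k)))) (at y)"
      by (rule has_derivative_mult_right[OF df])
    have d2: "((\<lambda>y. 2 * ((y - x) \<bullet> p (?I y)) / ((y - x) \<bullet> (y - x))) has_derivative
        (\<lambda>k. 2 * (v \<bullet> (M *v ((l\<^sup>2 / s) *\<^sub>R R k)) + k \<bullet> P) / s - 2 * (v \<bullet> P) * (2 * (v \<bullet> k)) / s\<^sup>2)) (at y)"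
      by (rule has_derivative_eq_rhs[OF has_derivative_divide'[OF
            has_derivative_mult_right[OF has_derivative_inner[OF dv dp], of 2] ds]])
         (use s in \<open>simp_all add: v_def[symmetric] s_def[symmetric] P_def[symmetric] fun_eq_iff
            power2_eq_square field_simps\<close>)
    show "(invert_grad f p x l has_derivative (*v) (invert_hess f p H x l y)) (at y)"
      unfolding g
    proof (rule has_derivative_eq_rhs[OF has_derivative_add[OF has_derivative_scaleR[OF d1 dv]
            has_derivative_diff[OF dp has_derivative_scaleR[OF d2 dv]]]], rule ext)
      fix k
      define w where "w = M *v R k"
      have hess: "invert_hess f p H x l y *v k =
          (2 / l\<^sup>2 * a - 2 / s * (v \<bullet> P)) *\<^sub>R k + (l\<^sup>2 / s) *\<^sub>R (w - (2 * (v \<bullet> w) / s) *\<^sub>R v)"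
        unfolding invert_hess_def v_def[symmetric] s_def[symmetric] a_def[symmetric] P_def[symmetric] M_def[symmetric]
        by (simp add: matrix_vector_mult_add_rdistrib scaleR_matrix_vector_assoc[symmetric]
            matrix_vector_mul_assoc[symmetric] R_def[symmetric] w_def R[symmetric])
      have Mw: "M *v ((l\<^sup>2 / s) *\<^sub>R R k) = (l\<^sup>2 / s) *\<^sub>R w" by (simp add: w_def matrix_vector_mult_scaleR)
      have PR: "P \<bullet> R k = P \<bullet> k - 2 * (v \<bullet> k) * (v \<bullet> P) / s"
        by (simp add: R inner_simps inner_commute)
      have c: "2 / l\<^sup>2 * (P \<bullet> ((l\<^sup>2 / s) *\<^sub>R R k)) - (2 * (v \<bullet> ((l\<^sup>2 / s) *\<^sub>R w) + k \<bullet> P) / s - 2 * (v \<bullet> P) * (2 * (v \<bullet> k)) / s\<^sup>2)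
          = - (l\<^sup>2 / s * (2 * (v \<bullet> w) / s))"
        using s l by (simp add: PR inner_commute[of k] power2_eq_square field_simps)
      show "(2 / l\<^sup>2 * f (?I y)) *\<^sub>R k + (2 / l\<^sup>2 * (P \<bullet> ((l\<^sup>2 / s) *\<^sub>R R k))) *\<^sub>R (y - x) +
          (M *v ((l\<^sup>2 / s) *\<^sub>R R k) -
            ((2 * ((y - x) \<bullet> p (?I y)) / ((y - x) \<bullet> (y - x))) *\<^sub>R k +
             (2 * (v \<bullet> (M *v ((l\<^sup>2 / s) *\<^sub>R R k)) + k \<bullet> P) / s - 2 * (v \<bullet> P) * (2 * (v \<bullet> k)) / s\<^sup>2) *\<^sub>R (y - x)))
          = invert_hess f p H x l y *v k"
        (is "?a *\<^sub>R k + ?b *\<^sub>R _ + (_ - (?c *\<^sub>R k + ?d *\<^sub>R _)) = _")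
      proof -
        have "?a *\<^sub>R k + ?b *\<^sub>R v + ((l\<^sup>2 / s) *\<^sub>R w - (?c *\<^sub>R k + ?d *\<^sub>R v))
            = (?a - ?c) *\<^sub>R k + (?b - ?d) *\<^sub>R v + (l\<^sup>2 / s) *\<^sub>R w"
          by (simp add: algebra_simps)
        also have "?b - ?d = - (l\<^sup>2 / s * (2 * (v \<bullet> w) / s))" unfolding Mw by (rule c)
        also have "?a - ?c = 2 / l\<^sup>2 * a - 2 / s * (v \<bullet> P)"
          by (simp add: a_def P_def v_def s_def)
        finally show ?thesis unfolding hess Mw v_def[symmetric]
          by (simp add: scaleR_diff_right)
      qed
    qed
  qed
qed

text \<open>
  This is the conformal invariance of the equation. For \<open>g = invert f x l\<close> the multiples of the identity
  in \<open>g D\<^sup>2g\<close> and in \<open>|Dg|\<^sup>2/2 I\<close> cancel up to \<open>-|p|\<^sup>2/2 I\<close>, which commutes with the reflection.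
\<close>
lemma conf_form_invert:
  assumes yx: "y \<noteq> x" and l: "l \<noteq> 0"
  shows "conf_form (invert f x l y) (invert_grad f p x l y) (invert_hess f p H x l y)
    = reflection (y - x) ** conf_form (f (inversion x l y)) (p (inversion x l y)) (H (inversion x l y))
        ** reflection (y - x)"
proof -
  define v where "v = y - x"
  define s where "s = v \<bullet> v"
  define a where "a = f (inversion x l y)"
  define P where "P = p (inversion x l y)"
  define M where "M = H (inversion x l y)"
  define R where "R k = reflection v *v k" for k
  have v0: "v \<noteq> 0" using yx by (simp add: v_def)
  then have s: "s \<noteq> 0" by (simp add: s_def)
  have R: "R k = k - (2 * (v \<bullet> k) / s) *\<^sub>R v" for k by (simp add: R_def reflection_mult s_def)
  have RR: "R (R k) = k" for k using reflection_involution[OF v0] by (simp add: R_def)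
  have qq: "invert_grad f p x l y \<bullet> invert_grad f p x l y = 4 * a\<^sup>2 * s / (l\<^sup>2)\<^sup>2 + P \<bullet> P - 4 * a * (v \<bullet> P) / l\<^sup>2"
  proof -
    have gen: "(\<alpha> *\<^sub>R v + w) \<bullet> (\<alpha> *\<^sub>R v + w) = \<alpha>\<^sup>2 * (v \<bullet> v) + 2 * \<alpha> * (v \<bullet> w) + w \<bullet> w" for \<alpha> w
      by (simp add: inner_simps inner_commute[of w v] power2_eq_square algebra_simps)
    have e: "invert_grad f p x l y = (2 / l\<^sup>2 * a) *\<^sub>R v + R P"
      by (simp add: invert_grad_def a_def v_def R_def P_def)
    have "R P \<bullet> R P = P \<bullet> P" using s
      by (simp add: R inner_simps s_def[symmetric] inner_commute field_simps)
    moreover have "v \<bullet> R P = - (v \<bullet> P)" using s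
      by (simp add: R inner_simps s_def[symmetric])
    moreover have "invert_grad f p x l y \<bullet> invert_grad f p x l y
        = (2 / l\<^sup>2 * a)\<^sup>2 * s + 2 * (2 / l\<^sup>2 * a) * (v \<bullet> R P) + R P \<bullet> R P"
      unfolding e s_def by (rule gen)
    ultimately show ?thesis by (simp add: power_mult_distrib power_divide)
  qed
  have g: "invert f x l y = s / l\<^sup>2 * a"
    by (simp add: invert_def s_def v_def a_def power2_norm_eq_inner)
  show ?thesis
  proof (subst matrix_eq, rule allI)
    fix k
    have rhs: "(reflection (y - x) ** conf_form (f (inversion x l y)) (p (inversion x l y)) (H (inversion x l y))
        ** reflection (y - x)) *v k = a *\<^sub>R R (M *v R k) - (P \<bullet> P / 2) *\<^sub>R k"
      unfolding v_def[symmetric] a_def[symmetric] P_def[symmetric] M_def[symmetric] conf_form_def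
      by (simp add: matrix_vector_mul_assoc[symmetric] matrix_vector_mult_diff_rdistrib
          scaleR_matrix_vector_assoc[symmetric] matrix_vector_mult_diff_distrib matrix_vector_mult_scaleR
          reflection_involution[OF v0] R_def)
    have hess: "invert_hess f p H x l y *v k =
          (2 / l\<^sup>2 * a - 2 / s * (v \<bullet> P)) *\<^sub>R k + (l\<^sup>2 / s) *\<^sub>R R (M *v R k)"
      unfolding invert_hess_def v_def[symmetric] s_def[symmetric] a_def[symmetric] P_def[symmetric] M_def[symmetric]
      by (simp add: matrix_vector_mult_add_rdistrib scaleR_matrix_vector_assoc[symmetric]
          matrix_vector_mul_assoc[symmetric] R_def)
    define \<alpha> where "\<alpha> = 2 / l\<^sup>2 * a - 2 / s * (v \<bullet> P)"
    have c1: "s / l\<^sup>2 * a * (l\<^sup>2 / s) = a" using s l by simp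
    have c2: "s / l\<^sup>2 * a * \<alpha> - (4 * a\<^sup>2 * s / (l\<^sup>2)\<^sup>2 + P \<bullet> P - 4 * a * (v \<bullet> P) / l\<^sup>2) / 2
        = - (P \<bullet> P / 2)"
      using s l by (simp add: \<alpha>_def power2_eq_square field_simps)
    have "conf_form (invert f x l y) (invert_grad f p x l y) (invert_hess f p H x l y) *v k
        = (s / l\<^sup>2 * a * \<alpha> - (4 * a\<^sup>2 * s / (l\<^sup>2)\<^sup>2 + P \<bullet> P - 4 * a * (v \<bullet> P) / l\<^sup>2) / 2) *\<^sub>R k
          + (s / l\<^sup>2 * a * (l\<^sup>2 / s)) *\<^sub>R R (M *v R k)"
      unfolding conf_form_def g qq
      by (simp only: matrix_vector_mult_diff_rdistrib scaleR_matrix_vector_assoc[symmetric] hess[folded \<alpha>_def]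
          matrix_vector_mul_lid scaleR_add_right scaleR_scaleR scaleR_diff_left) simp
    then show "conf_form (invert f x l y) (invert_grad f p x l y) (invert_hess f p H x l y) *v k =
        (reflection (y - x) ** conf_form (f (inversion x l y)) (p (inversion x l y)) (H (inversion x l y))
        ** reflection (y - x)) *v k"
      unfolding c1 c2 rhs by simp
  qed
qed

lemma continuous_on_inversion: "continuous_on (- {x}) (inversion x l)"
  unfolding inversion_def by (intro continuous_intros) auto

lemma continuous_on_matrix_mult:
  fixes A B :: "'a::topological_space \<Rightarrow> real^'n^'n"
  assumes "continuous_on T A" "continuous_on T B" shows "continuous_on T (\<lambda>y. A y ** B y)"
  unfolding matrix_matrix_mult_def
  by (intro continuous_intros continuous_on_vec_lambda continuous_on_component assms)

lemma continuous_on_reflection: "continuous_on (- {x}) (\<lambda>y. reflection (y - x))"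
  unfolding reflection_def tensor_def
  by (intro continuous_intros continuous_on_vec_lambda continuous_on_component) auto

text \<open>
  Invariance under orthogonal matrices is what makes inversions map solutions to solutions.
\<close>
locale conformal_operator = elliptic_operator U F
  for U :: "(real^'n^'n) set" and F :: "real^'n^'n \<Rightarrow> real" +
  assumes U_inv: "\<And>Q. orthogonal_matrix Q \<Longrightarrow> (\<lambda>M. matrix_inv Q ** M ** Q) ` U = U"
    and F_inv: "\<And>M Q. M \<in> U \<Longrightarrow> orthogonal_matrix Q \<Longrightarrow> F (matrix_inv Q ** M ** Q) = F M"
begin

lemma invert_solution:
  assumes f: "solution_on S f p H" and l: "l \<noteq> 0"
  shows "solution_on {y. y \<noteq> x \<and> inversion x l y \<in> S}
    (invert f x l) (invert_grad f p x l) (invert_hess f p H x l)"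
proof -
  let ?T = "{y. y \<noteq> x \<and> inversion x l y \<in> S}"
  note fD = solution_onD[OF f]
  have Te: "?T = - {x} \<inter> inversion x l -` S" by auto
  have op: "open ?T" unfolding Te
    by (rule continuous_open_preimage[OF continuous_on_inversion]) (use fD(1) in auto)
  have cI: "continuous_on ?T (inversion x l)"
    by (rule continuous_on_subset[OF continuous_on_inversion]) auto
  have cR: "continuous_on ?T (\<lambda>y. reflection (y - x))"
    by (rule continuous_on_subset[OF continuous_on_reflection]) auto
  have im: "inversion x l ` ?T \<subseteq> S" by auto
  have c: "continuous_on ?T (\<lambda>y. f (inversion x l y))" "continuous_on ?T (\<lambda>y. p (inversion x l y))"
    "continuous_on ?T (\<lambda>y. H (inversion x l y))"
    using fD(2,8,9) by (auto intro: continuous_on_compose2[OF _ cI im])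
  have "continuous_on ?T (invert_hess f p H x l)"
    unfolding invert_hess_def
    by (intro continuous_intros continuous_on_matrix_mult c cR) auto
  moreover have "0 < invert f x l y \<and> jet2 (invert f x l) (invert_grad f p x l) (invert_hess f p H x l) y \<and>
      conf_form (invert f x l y) (invert_grad f p x l y) (invert_hess f p H x l y) \<in> U \<and>
      F (conf_form (invert f x l y) (invert_grad f p x l y) (invert_hess f p H x l y)) = 1" if "y \<in> ?T" for y
  proof -
    have y: "y \<noteq> x" "inversion x l y \<in> S" using that by auto
    let ?z = "inversion x l y"
    let ?A = "conf_form (f ?z) (p ?z) (H ?z)"
    let ?Q = "reflection (y - x)"
    have v0: "y - x \<noteq> 0" using y by simp
    note inv = matrix_inv_reflection[OF v0] and orth = orthogonal_reflection[OF v0]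
    have "?Q ** ?A ** ?Q \<in> U"
      using U_inv[OF orth] fD(5)[OF y(2)] unfolding inv by blast
    moreover have "F (?Q ** ?A ** ?Q) = 1"
      using F_inv[OF fD(5)[OF y(2)] orth] fD(6)[OF y(2)] unfolding inv by simp
    moreover have "0 < invert f x l y"
      using fD(3)[OF y(2)] y l by (simp add: invert_def)
    ultimately show ?thesis
      using invert_jet2[OF y(1) l fD(4)[OF y(2)]] unfolding conf_form_invert[OF y(1) l] by blast
  qed
  ultimately show ?thesis unfolding solution_on_def using op by blast
qed

end

section \<open>Moving spheres\<close>

lemma norm_inversion:
  assumes "y \<noteq> x" shows "norm (inversion x l y - x) = l\<^sup>2 / norm (y - x)"
  using assms by (simp add: inversion_def power2_eq_square)

lemma norm_inversion_le:
  assumes "0 < l" "l \<le> norm (y - x)" shows "norm (inversion x l y - x) \<le> l"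
proof -
  have "y \<noteq> x" using assms by auto
  moreover have "l * l \<le> l * norm (y - x)" using assms by (intro mult_left_mono) auto
  ultimately show ?thesis using assms by (simp add: norm_inversion power2_eq_square pos_divide_le_eq)
qed

lemma inversion_in_domain:
  fixes x y :: "real^'n"
  assumes "norm x \<le> 1/4" "0 < l" "l < norm x" "l \<le> norm (y - x)"
  shows "inversion x l y \<in> ball 0 2 - {0}"
proof -
  have "norm (inversion x l y - x) \<le> l" using norm_inversion_le assms by blast
  then have "norm (inversion x l y) < 2" "0 < norm (inversion x l y)"
    using assms norm_triangle_ineq[of "inversion x l y - x" x]
      norm_triangle_ineq2[of x "x - inversion x l y"] by (auto simp: norm_minus_commute)
  then show ?thesis by auto
qed

lemma tendsto_invert:
  assumes S: "open S" "continuous_on S f" and z: "inversion x l y \<in> S" and "y \<noteq> x" "l \<noteq> 0"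
    and L: "(L \<longlongrightarrow> l) G" and Y: "(Y \<longlongrightarrow> y) G"
  shows "((\<lambda>n. invert f x (L n) (Y n)) \<longlongrightarrow> invert f x l y) G"
proof -
  have "((\<lambda>n. inversion x (L n) (Y n)) \<longlongrightarrow> inversion x l y) G"
    unfolding inversion_def using assms by (intro tendsto_intros) auto
  moreover have "isCont f (inversion x l y)" using S z by (simp add: continuous_on_eq_continuous_at)
  ultimately have "((\<lambda>n. f (inversion x (L n) (Y n))) \<longlongrightarrow> f (inversion x l y)) G"
    by (rule isCont_tendsto_compose[rotated])
  then show ?thesis unfolding invert_def using assms by (intro tendsto_intros) auto
qed

text \<open>
  Along a ray from the centre, with \<open>r' = l\<^sup>2/r\<close> the radius of the inverted point, the inequality
  \<open>f \<le> invert f x l\<close> compares the quotient \<open>f(x + t e)/t\<close> at \<open>t = r\<close> with its value at \<open>t = r'\<close>.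
\<close>
lemma invert_radial:
  assumes "norm e = 1" "0 < r" "0 < l"
  shows "inversion x l (x + r *\<^sub>R e) = x + (l\<^sup>2 / r) *\<^sub>R e"
    "invert f x l (x + r *\<^sub>R e) = r * (f (x + (l\<^sup>2 / r) *\<^sub>R e) / (l\<^sup>2 / r))"
proof -
  show i: "inversion x l (x + r *\<^sub>R e) = x + (l\<^sup>2 / r) *\<^sub>R e"
    using assms by (simp add: inversion_def power2_eq_square)
  show "invert f x l (x + r *\<^sub>R e) = r * (f (x + (l\<^sup>2 / r) *\<^sub>R e) / (l\<^sup>2 / r))"
    using assms unfolding invert_def i by (simp add: power2_eq_square)
qed

lemma radial_quotient_derivative:
  assumes "jet2 f p H (x + t *\<^sub>R e)" "0 < t"
  shows "((\<lambda>t. f (x + t *\<^sub>R e) / t) has_real_derivative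
    (p (x + t *\<^sub>R e) \<bullet> (t *\<^sub>R e) - f (x + t *\<^sub>R e)) / t\<^sup>2) (at t)"
  using DERIV_divide[OF jet2_along_line(1)[OF assms(1)] DERIV_ident] assms(2)
  by (simp add: power2_eq_square mult.commute)

context elliptic_operator
begin

text \<open>
  The strong maximum principle. If \<open>f < g\<close> at a point \<open>c\<close> close to \<open>y\<close>, then the largest ball about \<open>c\<close> without
  touching points has a touching point on its boundary, against the Hopf lemma.
\<close>
lemma touching_set_open:
  assumes f: "solution_on S f p H" and g: "solution_on S g q K"
    and le: "\<And>y. y \<in> S \<Longrightarrow> f y \<le> g y" and y: "y \<in> S" "f y = g y"
  obtains s where "0 < s" "ball y s \<subseteq> S" "\<And>z. z \<in> ball y s \<Longrightarrow> f z = g z"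
proof -
  note fD = solution_onD[OF f] and gD = solution_onD[OF g]
  obtain s2 where s2: "0 < s2" "cball y s2 \<subseteq> S" using fD(1) y open_contains_cball by blast
  define s where "s = s2 / 2"
  have s: "0 < s" "cball y (2 * s) \<subseteq> S" using s2 by (auto simp: s_def)
  have sub: "ball y s \<subseteq> S" using s by (auto simp: subset_iff)
  have "f c = g c" if c: "c \<in> ball y s" for c
  proof (rule ccontr)
    assume ne: "f c \<noteq> g c"
    define Z where "Z = {z \<in> cball y (2 * s). f z = g z}"
    have "closed Z"
      unfolding Z_def
      by (intro continuous_closed_preimage_constant[where f = "\<lambda>z. f z - g z" and a = 0, simplified]
          continuous_intros closed_cball continuous_on_subset[OF fD(8) s(2)] continuous_on_subset[OF gD(8) s(2)])
    moreover have yZ: "y \<in> Z" using y s by (simp add: Z_def)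
    ultimately obtain y0 where y0: "y0 \<in> Z" "\<And>z. z \<in> Z \<Longrightarrow> dist c y0 \<le> dist c z"
      using distance_attains_inf[of Z c] by blast
    define R where "R = dist c y0"
    have "R \<le> dist c y" using y0(2)[OF yZ] by (simp add: R_def)
    then have Rs: "R < s" using c by (simp add: dist_commute)
    have R0: "0 < R" using ne y0(1) by (auto simp: R_def Z_def)
    have inB: "z \<in> ball y (2 * s)" if "dist c z \<le> R" for z
      using that Rs c dist_triangle[of y z c] by simp
    have y0B: "y0 \<in> ball y (2 * s)" by (rule inB) (simp add: R_def)
    have BS: "ball y (2 * s) \<subseteq> S" using s(2) ball_subset_cball by blast
    have y0S: "y0 \<in> S" using y0B BS by blast
    have eq: "f y0 = g y0" using y0 by (simp add: Z_def)
    have lt: "f z < g z" if "z \<in> ball c R" for z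
    proof -
      have "z \<notin> Z" using y0(2)[of z] that by (auto simp: R_def)
      moreover have "z \<in> ball y (2 * s)" using that by (intro inB) simp
      ultimately have "f z \<noteq> g z" by (simp add: Z_def)
      then show ?thesis using le[of z] \<open>z \<in> ball y (2 * s)\<close> BS by force
    qed
    obtain d where d: "0 < d" "ball y0 d \<subseteq> S" using fD(1) y0S open_contains_ball by blast
    have "q y0 - p y0 = 0"
    proof (rule interior_minimum(1)[where h = "\<lambda>y. g y - f y" and p = "\<lambda>y. q y - p y" and H = "\<lambda>y. K y - H y", OF d(1)])
      show "jet2 (\<lambda>y. g y - f y) (\<lambda>y. q y - p y) (\<lambda>y. K y - H y) z" if "z \<in> ball y0 d" for z
        using that d by (intro jet2_diff fD(4) gD(4)) auto
      show "g y0 - f y0 \<le> g z - f z" if "z \<in> ball y0 d" for z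
        using le[of z] that d eq by auto
    qed
    then have pq: "p y0 = q y0" by simp
    have "norm (y0 - c) = R" by (simp add: R_def dist_norm norm_minus_commute)
    from hopf_touching[OF f g y0S le lt R0 this eq pq] show False by blast
  qed
  then show thesis using that s sub by blast
qed

end

context conformal_operator
begin

context
  fixes f p H M
  assumes dim: "3 \<le> CARD('n)"
    and f: "solution_on (ball 0 2 - {0}) f p H"
    and sub: "\<And>y. y \<in> ball 0 2 - {0} \<Longrightarrow> 0 \<le> trace (H y)"
    and bound: "\<And>y. 0 < norm y \<Longrightarrow> norm y \<le> 1 \<Longrightarrow> f y \<le> M"
begin

abbreviation (input) "S0 \<equiv> ball 0 2 - {0} :: (real^'n) set"

text \<open>
  Close to \<open>x\<close> the quotient \<open>f(x + t e)/t\<close> decreases in \<open>t\<close>, as \<open>f\<close> is positive with bounded gradient. Farther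
  away \<open>invert f x l\<close> exceeds the bound of \<open>f\<close> because of the factor \<open>1/l\<^sup>2\<close>.
\<close>
lemma small_spheres:
  assumes x: "0 < norm x" "norm x \<le> 1/4"
  obtains l0 where "0 < l0"
    "\<And>l y. \<lbrakk>0 < l; l \<le> l0; l \<le> norm (y - x); 0 < norm y; norm y \<le> 1\<rbrakk> \<Longrightarrow> f y \<le> invert f x l y"
proof -
  note fD = solution_onD[OF f]
  have cS: "cball x (norm x / 2) \<subseteq> S0"
  proof
    fix y assume "y \<in> cball x (norm x / 2)"
    then have "norm (x - y) \<le> norm x / 2" by (simp add: dist_norm)
    then show "y \<in> S0" using x norm_triangle_ineq2[of y x] norm_triangle_ineq2[of x y]
      by (auto simp: norm_minus_commute)
  qed
  have ne: "cball x (norm x / 2) \<noteq> {}" using x by simp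
  obtain z where z: "z \<in> cball x (norm x / 2)" "\<And>y. y \<in> cball x (norm x / 2) \<Longrightarrow> f z \<le> f y"
    using continuous_attains_inf[OF compact_cball ne continuous_on_subset[OF fD(8) cS]] by blast
  define a where "a = f z"
  have a: "0 < a" "\<And>y. y \<in> cball x (norm x / 2) \<Longrightarrow> a \<le> f y"
    unfolding a_def by (rule fD(3)[OF subsetD[OF cS z(1)]]) (rule z(2))
  obtain B where B: "0 \<le> B" "\<And>y. y \<in> cball x (norm x / 2) \<Longrightarrow> norm (p y) \<le> B"
    using continuous_on_compact_bound[OF compact_cball continuous_on_subset[OF fD(9) cS]] by blast
  define r0 where "r0 = min (norm x / 2) (a / (B + 1))"
  have r0: "0 < r0" "r0 \<le> norm x / 2"
    using x(1) a(1) B(1) min.cobounded1 unfolding r0_def by (simp, blast)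
  have "r0 \<le> a / (B + 1)" by (simp add: r0_def)
  then have "r0 * (B + 1) \<le> a" using B by (simp add: pos_le_divide_eq)
  then have r0B: "r0 * B \<le> a" using r0 by (simp add: algebra_simps)
  define c where "c = min 1 (a / (\<bar>M\<bar> + 1))"
  have c: "0 < c" "c \<le> 1" using a by (auto simp: c_def)
  have "c \<le> a / (\<bar>M\<bar> + 1)" by (simp add: c_def)
  then have cM: "c * (\<bar>M\<bar> + 1) \<le> a" by (simp add: pos_le_divide_eq)
  show thesis
  proof (rule that[of "r0 * c"])
    show "0 < r0 * c" using r0 c by simp
    fix l y assume l: "0 < l" "l \<le> r0 * c" "l \<le> norm (y - x)" and y: "0 < norm y" "norm y \<le> 1"
    have "r0 * c \<le> r0 * 1" using c r0 by (intro mult_left_mono) auto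
    then have lr: "l \<le> r0" using l(2) by linarith
    show "f y \<le> invert f x l y"
    proof (cases "norm (y - x) \<le> r0")
      case True
      define r where "r = norm (y - x)"
      define e where "e = (1 / r) *\<^sub>R (y - x)"
      have r: "0 < r" "r \<le> r0" "l \<le> r" using True l by (auto simp: r_def)
      have e: "norm e = 1" using r by (simp add: e_def r_def)
      have ye: "y = x + r *\<^sub>R e" using r by (simp add: e_def)
      define r' where "r' = l\<^sup>2 / r"
      have "l * l \<le> r * r" using r l by (intro mult_mono) auto
      then have r': "0 < r'" "r' \<le> r" using r l by (auto simp: r'_def power2_eq_square pos_divide_le_eq)
      have inb: "x + t *\<^sub>R e \<in> cball x (norm x / 2)" if "r' \<le> t" "t \<le> r" for t
        using that r r0 r' e by (simp add: dist_norm)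
      have "f (x + r *\<^sub>R e) / r \<le> f (x + r' *\<^sub>R e) / r'"
      proof (rule DERIV_nonpos_imp_nonincreasing[OF r'(2)])
        fix t assume t: "r' \<le> t" "t \<le> r"
        let ?w = "x + t *\<^sub>R e"
        have w: "?w \<in> cball x (norm x / 2)" by (rule inb[OF t])
        have t0: "0 < t" using t r' by simp
        have "p ?w \<bullet> (t *\<^sub>R e) \<le> norm (p ?w) * norm (t *\<^sub>R e)" by (rule norm_cauchy_schwarz)
        also have "\<dots> \<le> B * r0" using B(2)[OF w] t t0 r e B by (intro mult_mono) auto
        also have "\<dots> \<le> f ?w" using r0B a(2)[OF w] by (simp add: mult.commute)
        finally have "(p ?w \<bullet> (t *\<^sub>R e) - f ?w) / t\<^sup>2 \<le> 0" by (simp add: divide_nonpos_nonneg)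
        moreover have "jet2 f p H ?w" using fD(4) w cS by blast
        ultimately show "\<exists>D. ((\<lambda>t. f (x + t *\<^sub>R e) / t) has_real_derivative D) (at t) \<and> D \<le> 0"
          using radial_quotient_derivative t0 by blast
      qed
      then have "r * (f (x + r *\<^sub>R e) / r) \<le> r * (f (x + r' *\<^sub>R e) / r')" using r by (intro mult_left_mono) auto
      then show ?thesis unfolding ye invert_radial(2)[OF e r(1) l(1)] r'_def using r by simp
    next
      case False
      let ?z = "inversion x l y"
      have "norm (?z - x) \<le> norm x / 2" using norm_inversion_le[OF l(1,3)] lr r0 by simp
      then have az: "a \<le> f ?z" by (intro a(2)) (simp add: dist_norm norm_minus_commute)
      have "l * l \<le> (r0 * c) * (r0 * c)" using l by (intro mult_mono) auto
      also have "\<dots> \<le> (r0 * c) * (r0 * 1)" using r0 c by (intro mult_left_mono) auto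
      finally have "l\<^sup>2 \<le> r0\<^sup>2 * c" by (simp add: power2_eq_square mult_ac)
      then have "l\<^sup>2 * (\<bar>M\<bar> + 1) \<le> r0\<^sup>2 * c * (\<bar>M\<bar> + 1)" by (intro mult_right_mono) auto
      also have "\<dots> = r0\<^sup>2 * (c * (\<bar>M\<bar> + 1))" by simp
      also have "\<dots> \<le> (norm (y - x))\<^sup>2 * f ?z"
        using False r0 c(1) cM az a(1) by (intro mult_mono power_mono) auto
      finally have "\<bar>M\<bar> + 1 \<le> invert f x l y"
        using l by (simp add: invert_def pos_le_divide_eq mult.commute)
      then show ?thesis using bound[OF y] by linarith
    qed
  qed
qed

context
  fixes x :: "real^'n" and l :: real
  assumes x: "norm x \<le> 1/4" and l: "0 < l" "l < norm x"
    and below: "\<And>y. \<lbrakk>l \<le> norm (y - x); 0 < norm y; norm y \<le> 1\<rbrakk> \<Longrightarrow> f y \<le> invert f x l y"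
    and outer: "\<And>y. norm y = 1 \<Longrightarrow> f y < invert f x l y"
begin

abbreviation (input) "g0 \<equiv> invert f x l"
abbreviation (input) "q0 \<equiv> invert_grad f p x l"
abbreviation (input) "K0 \<equiv> invert_hess f p H x l"
abbreviation (input) "T0 \<equiv> {y. y \<noteq> x \<and> inversion x l y \<in> S0}"

lemma inverted_solution: "solution_on T0 g0 q0 K0"
  using invert_solution[OF f] l by simp

lemma exterior_in_T0: "l \<le> norm (y - x) \<Longrightarrow> y \<in> T0"
  using inversion_in_domain[OF x l(1,2)] l by auto

abbreviation (input) "E0 \<equiv> {y. l < norm (y - x)} \<inter> ball 0 1 :: (real^'n) set"

lemma open_E0: "open E0"
  by (intro open_Int open_ball open_Collect_less continuous_intros)

lemma E0_solutions:
  "solution_on E0 g0 q0 K0" "solution_on (E0 - {0}) f p H" "solution_on (E0 - {0}) g0 q0 K0"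
proof -
  have o: "open (E0 - {0})" by (intro open_delete open_E0)
  show "solution_on E0 g0 q0 K0"
    by (rule solution_on_subset[OF inverted_solution _ open_E0]) (use exterior_in_T0 in force)
  then show "solution_on (E0 - {0}) g0 q0 K0" by (rule solution_on_subset[OF _ _ o]) auto
  show "solution_on (E0 - {0}) f p H"
    by (rule solution_on_subset[OF f _ o]) auto
qed

text \<open>
  Touching propagates along a ray from \<open>x\<close> until the ray meets the unit sphere, where \<open>outer\<close> forbids it. The
  starting point is first moved within the touching set so that the ray misses the puncture.
\<close>
lemma strict_below_inside:
  assumes y0: "y0 \<in> E0 - {0}" shows "f y0 < g0 y0"
proof (rule ccontr)
  assume "\<not> f y0 < g0 y0"
  have leE: "f y \<le> g0 y" if "y \<in> E0 - {0}" for y using below that by auto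
  note fD = solution_onD[OF E0_solutions(2)] and gD = solution_onD[OF E0_solutions(3)]
  have eq0: "f y0 = g0 y0" using leE[OF y0] \<open>\<not> f y0 < g0 y0\<close> by simp
  obtain s where s: "0 < s" "ball y0 s \<subseteq> E0 - {0}" "\<And>z. z \<in> ball y0 s \<Longrightarrow> f z = g0 z"
    using touching_set_open[OF E0_solutions(2,3) leE y0 eq0] by blast
  have "2 \<le> DIM(real^'n)" using dim by simp
  then obtain e' where e': "e' \<noteq> 0" "orthogonal x e'"
    using orthogonal_to_vector_exists[of x] by blast
  define e where "e = (if 0 \<le> e' \<bullet> y0 then e' else - e')"
  have e: "e \<noteq> 0" "e \<bullet> x = 0" "0 \<le> e \<bullet> y0"
    using e' by (auto simp: e_def orthogonal_def inner_commute)
  define y1 where "y1 = y0 + (s / (2 * norm e)) *\<^sub>R e"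
  have y1s: "y1 \<in> ball y0 s" using s e by (simp add: y1_def dist_norm)
  have y1E: "y1 \<in> E0 - {0}" using y1s s by blast
  have ey1: "0 < e \<bullet> y1" using s e by (simp add: y1_def inner_add_right add_nonneg_pos)
  define w where "w t = x + t *\<^sub>R (y1 - x)" for t
  have w0: "w t \<noteq> 0" if "1 \<le> t" for t
  proof
    assume "w t = 0"
    then have "e \<bullet> w t = 0" by simp
    then have "t * (e \<bullet> y1) = 0" by (simp add: w_def inner_simps e)
    then show False using ey1 that by simp
  qed
  have wx: "l < norm (w t - x)" if "1 \<le> t" for t
  proof -
    have "norm (y1 - x) \<le> t * norm (y1 - x)" using that by (simp add: mult_le_cancel_right1)
    then show ?thesis using y1E that by (simp add: w_def)
  qed
  define T where "T = (1 + norm x) / norm (y1 - x)"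
  define I where "I = {t. 1 \<le> t \<and> norm (w t) \<le> 1}"
  have y1x: "0 < norm (y1 - x)" using y1E l by auto
  have IT: "t \<le> T" if "t \<in> I" for t
  proof -
    have "t * norm (y1 - x) \<le> norm (w t) + norm x"
      using norm_triangle_ineq4[of "w t" x] that by (simp add: w_def I_def)
    also have "\<dots> \<le> 1 + norm x" using that by (simp add: I_def)
    finally show ?thesis using y1x by (simp add: T_def pos_le_divide_eq)
  qed
  have cw: "continuous_on X w" for X unfolding w_def by (intro continuous_intros)
  have cI: "closed I"
    unfolding I_def by (intro closed_Collect_conj closed_Collect_le continuous_intros cw)
  have wS: "w ` I \<subseteq> S0" using w0 by (auto simp: I_def)
  have wT: "w ` I \<subseteq> T0" using wx exterior_in_T0 by (force simp: I_def)
  have cfw: "continuous_on I (\<lambda>t. f (w t))"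
    by (rule continuous_on_compose2[OF solution_onD(8)[OF f] cw wS])
  have cgw: "continuous_on I (\<lambda>t. g0 (w t))"
    by (rule continuous_on_compose2[OF solution_onD(8)[OF inverted_solution] cw wT])
  define J where "J = {t \<in> I. f (w t) = g0 (w t)}"
  have "closed J"
    unfolding J_def
    by (rule continuous_closed_preimage_constant[where f = "\<lambda>t. f (w t) - g0 (w t)" and a = 0, simplified])
       (intro continuous_intros cfw cgw cI)+
  moreover have "J \<subseteq> {1..T}" using IT by (auto simp: J_def I_def)
  ultimately have cJ: "compact J"
    by (metis bounded_closed_interval bounded_subset compact_eq_bounded_closed)
  have "1 \<in> J" using y1E s(3)[OF y1s] by (simp add: J_def I_def w_def)
  then obtain t where t: "t \<in> J" "\<And>t'. t' \<in> J \<Longrightarrow> t' \<le> t"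
    using compact_attains_sup[OF cJ] by blast
  have tI: "1 \<le> t" "norm (w t) \<le> 1" "f (w t) = g0 (w t)" using t(1) by (auto simp: J_def I_def)
  have "norm (w t) \<noteq> 1" using outer[of "w t"] tI by auto
  then have wE: "w t \<in> E0 - {0}" using tI wx w0 by auto
  obtain r where r: "0 < r" "ball (w t) r \<subseteq> E0 - {0}" "\<And>z. z \<in> ball (w t) r \<Longrightarrow> f z = g0 z"
    using touching_set_open[OF E0_solutions(2,3) leE wE tI(3)] by blast
  define t' where "t' = t + r / (2 * norm (y1 - x))"
  have t't: "t < t'" using r y1x by (simp add: t'_def)
  have "w t' - w t = (r / (2 * norm (y1 - x))) *\<^sub>R (y1 - x)"
    by (simp add: w_def t'_def algebra_simps)
  then have "norm (w t' - w t) < r" using r y1x by simp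
  then have w': "w t' \<in> ball (w t) r" by (simp add: dist_norm norm_minus_commute)
  then have "norm (w t') \<le> 1" using r(2) by auto
  then have "t' \<in> J" using r(3)[OF w'] t't tI(1) by (simp add: J_def I_def)
  then show False using t(2) t't by fastforce
qed

lemma gap_at_puncture:
  obtains \<kappa> r where "0 < \<kappa>" "0 < r" "\<And>y. 0 < norm y \<Longrightarrow> norm y < r \<Longrightarrow> f y \<le> g0 y - \<kappa>"
proof -
  have zeroE: "0 \<in> E0" using l by simp
  have "0 \<le> trace (H y)" if "y \<in> E0 - {0}" for y by (rule sub) (use that in auto)
  from strict_order_at_puncture[OF dim E0_solutions(1) zeroE E0_solutions(2) this strict_below_inside]
  show thesis using that by blast
qed

text \<open>
  On the sphere \<open>f\<close> and \<open>invert f x l\<close> agree and their gradients differ by a multiple of \<open>f - p \<bullet> (y - x)\<close> in the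
  normal direction. By minimality from outside this quantity is nonnegative, and by the Hopf
  lemma, applied to a ball touching the sphere from outside, it is not zero.
\<close>
lemma radially_decreasing_on_sphere:
  assumes y: "norm (y - x) = l" shows "p y \<bullet> (y - x) < f y"
proof (rule ccontr)
  assume "\<not> p y \<bullet> (y - x) < f y"
  then have ge: "f y \<le> p y \<bullet> (y - x)" by simp
  define v where "v = y - x"
  have vv: "v \<bullet> v = l\<^sup>2" using y by (simp add: v_def power2_norm_eq_inner[symmetric])
  have v0: "v \<noteq> 0" using y l by (auto simp: v_def)
  have Iy: "inversion x l y = y" using y l by (simp add: inversion_def)
  have gy: "g0 y = f y" using y l by (simp add: invert_def Iy)
  have qy: "q0 y = p y + (2 / l\<^sup>2 * (f y - p y \<bullet> v)) *\<^sub>R v"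
    by (simp add: invert_grad_def Iy v_def[symmetric] reflection_mult vv inner_commute
        right_diff_distrib scaleR_diff_left)
  define W where "W = T0 \<inter> S0 \<inter> ball 0 1"
  have oW: "open W"
    unfolding W_def using solution_onD(1)[OF inverted_solution] by (intro open_Int) auto
  have fW: "solution_on W f p H" by (rule solution_on_subset[OF f _ oW]) (auto simp: W_def)
  have gW: "solution_on W g0 q0 K0"
    by (rule solution_on_subset[OF inverted_solution _ oW]) (auto simp: W_def)
  have ny: "0 < norm y" "norm y < 1"
    using norm_triangle_ineq2[of x "x - y"] norm_triangle_ineq[of "y - x" x] y x l
    by (auto simp: norm_minus_commute)
  have yW: "y \<in> W" using ny exterior_in_T0[of y] y by (auto simp: W_def)
  have lt: "f z < g0 z" if "z \<in> W" "l < norm (z - x)" for z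
    using strict_below_inside[of z] that by (auto simp: W_def)
  have le: "f z \<le> g0 z" if "z \<in> W" "l \<le> norm (z - x)" for z
    using below[of z] that by (auto simp: W_def)
  have out: "norm (y + t *\<^sub>R v - x) = (1 + t) * l" if "0 \<le> t" for t
  proof -
    have "y + t *\<^sub>R v - x = (1 + t) *\<^sub>R v" by (simp add: v_def algebra_simps)
    then show ?thesis using that y by (simp add: v_def)
  qed
  have "f y - p y \<bullet> v \<ge> 0"
  proof (rule ccontr)
    assume neg: "\<not> f y - p y \<bullet> v \<ge> 0"
    have j: "jet2 (\<lambda>y. g0 y - f y) (\<lambda>y. q0 y - p y) (\<lambda>y. K0 y - H y) (y + 0 *\<^sub>R v)"
      using jet2_diff[OF solution_onD(4)[OF gW yW] solution_onD(4)[OF fW yW]] by simp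
    have "(q0 y - p y) \<bullet> v = 2 * (f y - p y \<bullet> v)" using l by (simp add: qy vv)
    then have "((\<lambda>t. g0 (y + t *\<^sub>R v) - f (y + t *\<^sub>R v)) has_real_derivative 2 * (f y - p y \<bullet> v)) (at 0)"
      using jet2_along_line(1)[OF j] by simp
    then obtain d where d: "0 < d" "\<And>t. 0 < t \<Longrightarrow> t < d \<Longrightarrow> g0 (y + t *\<^sub>R v) - f (y + t *\<^sub>R v) < g0 y - f y"
      using DERIV_neg_dec_right[of "\<lambda>t. g0 (y + t *\<^sub>R v) - f (y + t *\<^sub>R v)" _ 0] neg by force
    obtain r where r: "0 < r" "ball y r \<subseteq> W" using oW yW open_contains_ball by blast
    define u where "u = r / norm v"
    have u: "0 < u" using r v0 by (simp add: u_def)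
    define t where "t = min d u / 2"
    have t: "0 < t" "t < d" "t < u" using d(1) u by (auto simp: t_def)
    then have "t < r / norm v" by (simp add: u_def)
    then have "t * norm v < r" using v0 by (simp add: pos_less_divide_eq)
    then have "y + t *\<^sub>R v \<in> W" using r t by (auto simp: subset_iff dist_norm)
    moreover have "l \<le> norm (y + t *\<^sub>R v - x)" using out[of t] t l by simp
    ultimately show False using le d(2)[OF t(1,2)] gy by fastforce
  qed
  then have "f y - p y \<bullet> v = 0" using ge by (simp add: v_def)
  then have pq: "p y = q0 y" by (simp add: qy)
  have cx: "norm (y + v - x) = 2 * l" using out[of 1] by simp
  have far: "l + (l - norm (z - (y + v))) \<le> norm (z - x)" for z
    using norm_triangle_ineq4[of "z - x" "z - (y + v)"] cx by (simp add: algebra_simps)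
  show False
  proof (rule hopf_touching[OF fW gW yW, of "y + v" l])
    show "f z \<le> g0 z" if "z \<in> cball (y + v) l" "z \<in> W" for z
      using le[OF that(2)] far[of z] that(1) by (simp add: dist_norm norm_minus_commute)
    show "f z < g0 z" if "z \<in> ball (y + v) l" "z \<in> W" for z
      using lt[OF that(2)] far[of z] that(1) by (simp add: dist_norm norm_minus_commute)
  qed (use l y gy pq in \<open>auto simp: v_def norm_minus_commute\<close>)
qed

end

text \<open>
  The radii of failure have a positive infimum \<open>m\<close> by \<open>small_spheres\<close>. A limit point of points of
  failure for radii tending to \<open>m\<close> is the puncture, a point beyond the sphere, or a point
  on it; the three preceding lemmas exclude these cases.
\<close>
theorem moving_spheres:
  assumes x: "norm x \<le> 1/4" and \<Lambda>: "\<Lambda> < norm x"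
    and outer: "\<And>l y. \<lbrakk>0 < l; l \<le> \<Lambda>; norm y = 1\<rbrakk> \<Longrightarrow> f y < invert f x l y"
    and l: "0 < l" "l \<le> \<Lambda>" and y: "l \<le> norm (y - x)" "0 < norm y" "norm y \<le> 1"
  shows "f y \<le> invert f x l y"
proof (rule ccontr)
  assume bad: "\<not> f y \<le> invert f x l y"
  note fD = solution_onD[OF f]
  have S: "open S0" by (rule fD(1))
  define Bad where "Bad = {l. 0 < l \<and> l \<le> \<Lambda> \<and>
    (\<exists>y. l \<le> norm (y - x) \<and> 0 < norm y \<and> norm y \<le> 1 \<and> invert f x l y < f y)}"
  have lBad: "l \<in> Bad" using l y bad by (auto simp: Bad_def not_le)
  have x0: "0 < norm x" using l \<Lambda> by linarith
  obtain l0 where l0: "0 < l0"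
    "\<And>l y. \<lbrakk>0 < l; l \<le> l0; l \<le> norm (y - x); 0 < norm y; norm y \<le> 1\<rbrakk> \<Longrightarrow> f y \<le> invert f x l y"
    using small_spheres[OF x0 x] by blast
  have l0Bad: "l0 \<le> l'" if "l' \<in> Bad" for l'
    using that l0(2)[of l'] by (force simp: Bad_def not_le[symmetric])
  then have bdd: "bdd_below Bad" by (rule bdd_belowI)
  define m where "m = Inf Bad"
  have ml: "m \<le> l'" if "l' \<in> Bad" for l' unfolding m_def by (rule cInf_lower[OF that bdd])
  have "l0 \<le> m" unfolding m_def using lBad l0Bad by (intro cInf_greatest) auto
  then have m0: "0 < m" using l0 by simp
  have m\<Lambda>: "m \<le> \<Lambda>" using ml[OF lBad] l by simp
  have mx: "m < norm x" using m\<Lambda> \<Lambda> by simp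
  note inS = inversion_in_domain[OF x m0 mx]
  have good: "f y \<le> invert f x m y" if y: "m \<le> norm (y - x)" "0 < norm y" "norm y \<le> 1" for y
  proof (rule ccontr)
    assume "\<not> f y \<le> invert f x m y"
    then have lt: "invert f x m y < f y" by simp
    have yx: "y \<noteq> x" using y m0 by auto
    have "((\<lambda>l. invert f x l y) \<longlongrightarrow> invert f x m y) (at_left m)"
      by (rule tendsto_invert[OF S fD(8) inS[OF y(1)] yx]) (use m0 in auto)
    then have "eventually (\<lambda>l. invert f x l y < f y) (at_left m)" using lt by (rule order_tendstoD)
    moreover have "eventually (\<lambda>l. l \<in> {0<..<m}) (at_left m)" by (rule eventually_at_left_real[OF m0])
    ultimately have "eventually (\<lambda>l. invert f x l y < f y \<and> l \<in> {0<..<m}) (at_left m)"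
      by (rule eventually_conj)
    then obtain l' where l': "invert f x l' y < f y" "l' \<in> {0<..<m}"
      using eventually_happens'[OF trivial_limit_at_left_real] by blast
    then have "l' \<in> Bad" using y m\<Lambda> by (auto simp: Bad_def intro!: exI[of _ y])
    then show False using ml[of l'] l' by auto
  qed
  have out: "f y < invert f x m y" if "norm y = 1" for y by (rule outer[OF m0 m\<Lambda> that])
  have "\<exists>l. l \<in> Bad \<and> l < m + 1 / real (Suc n)" for n
    using cInf_lessD[of Bad "m + 1 / real (Suc n)"] lBad unfolding m_def by auto
  then obtain L where L: "\<And>n. L n \<in> Bad" "\<And>n. L n < m + 1 / real (Suc n)" by metis
  have Lm: "L \<longlonglongrightarrow> m"
  proof (rule tendsto_sandwich[of "\<lambda>_. m" _ _ "\<lambda>n. m + 1 / real (Suc n)"])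
    show "(\<lambda>n. m + 1 / real (Suc n)) \<longlonglongrightarrow> m"
      using tendsto_add[OF tendsto_const[of m] LIMSEQ_inverse_real_of_nat] by (simp add: inverse_eq_divide)
  qed (use ml[OF L(1)] less_imp_le[OF L(2)] in auto)
  have "\<exists>y. L n \<le> norm (y - x) \<and> 0 < norm y \<and> norm y \<le> 1 \<and> invert f x (L n) y < f y" for n
    using L(1)[of n] by (simp add: Bad_def)
  then obtain Y where Y: "\<And>n. L n \<le> norm (Y n - x)" "\<And>n. 0 < norm (Y n)" "\<And>n. norm (Y n) \<le> 1"
    "\<And>n. invert f x (L n) (Y n) < f (Y n)" by metis
  have "\<forall>n. Y n \<in> cball 0 1" using Y by simp
  then obtain z \<phi> where z: "z \<in> cball 0 1" "strict_mono \<phi>" "(Y \<circ> \<phi>) \<longlonglongrightarrow> z"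
    using compact_cball[of "0::real^'n" 1] unfolding compact_def by blast
  define l' where "l' n = L (\<phi> n)" for n
  define y' where "y' n = Y (\<phi> n)" for n
  have l'm: "l' \<longlonglongrightarrow> m" using LIMSEQ_subseq_LIMSEQ[OF Lm z(2)] by (simp add: l'_def[abs_def] comp_def)
  have y'z: "y' \<longlonglongrightarrow> z" using z(3) by (simp add: y'_def[abs_def] comp_def)
  have l'0: "0 < l' n" for n using L(1) by (auto simp: l'_def Bad_def)
  have y': "l' n \<le> norm (y' n - x)" "0 < norm (y' n)" "norm (y' n) \<le> 1" "invert f x (l' n) (y' n) < f (y' n)" for n
    using Y by (auto simp: l'_def y'_def)
  have mz: "m \<le> norm (z - x)"
    by (rule LIMSEQ_le[OF l'm tendsto_norm[OF tendsto_diff[OF y'z tendsto_const]]]) (use y' in auto)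
  have zx: "z \<noteq> x" using mz m0 by auto
  have lim: "(\<lambda>n. invert f x (l' n) (y' n)) \<longlonglongrightarrow> invert f x m z"
    by (rule tendsto_invert[OF S fD(8) inS[OF mz] zx _ l'm y'z]) (use m0 in simp)
  consider "z = 0" | "z \<noteq> 0" "m < norm (z - x)" | "norm (z - x) = m" using mz by fastforce
  then show False
  proof cases
    case 1
    obtain \<kappa> r where \<kappa>: "0 < \<kappa>" "0 < r" "\<And>y. 0 < norm y \<Longrightarrow> norm y < r \<Longrightarrow> f y \<le> invert f x m y - \<kappa>"
      using gap_at_puncture[OF x m0 mx good out] by blast
    have lim2: "(\<lambda>n. invert f x m (y' n) - \<kappa>) \<longlonglongrightarrow> invert f x m z - \<kappa>"
      by (intro tendsto_diff tendsto_const tendsto_invert[OF S fD(8) inS[OF mz] zx _ tendsto_const y'z])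
         (use m0 in simp)
    have "eventually (\<lambda>n. dist (y' n) z < r) sequentially" using y'z \<kappa>(2) by (rule tendstoD)
    then have "eventually (\<lambda>n. invert f x (l' n) (y' n) \<le> invert f x m (y' n) - \<kappa>) sequentially"
    proof eventually_elim
      case (elim n)
      then have "norm (y' n) < r" using 1 by simp
      then show ?case using \<kappa>(3)[OF y'(2)[of n]] y'(4)[of n] by simp
    qed
    then have "invert f x m z \<le> invert f x m z - \<kappa>"
      using tendsto_le[OF sequentially_bot lim2 lim] by blast
    then show False using \<kappa>(1) by simp
  next
    case 2
    have "z \<in> S0" using 2 z(1) by auto
    then have "isCont f z" using fD(8) S continuous_on_eq_continuous_at by blast
    then have "(\<lambda>n. f (y' n)) \<longlonglongrightarrow> f z" using y'z by (rule isCont_tendsto_compose)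
    then have "invert f x m z \<le> f z"
      by (rule LIMSEQ_le[OF lim]) (use y'(4) less_imp_le in blast)
    moreover have "f z < invert f x m z"
    proof (cases "norm z = 1")
      case False
      then show ?thesis using strict_below_inside[OF x m0 mx good out, of z] 2 z(1) by auto
    qed (rule out)
    ultimately show False by simp
  next
    case 3
    define q where "q w = p w \<bullet> (w - x) - f w" for w
    define r where "r n = norm (y' n - x)" for n
    have rm: "r \<longlonglongrightarrow> m"
      unfolding r_def[abs_def] 3[symmetric] by (intro tendsto_intros y'z)
    have zS: "z \<in> S0"
      using 3 mx z(1) norm_triangle_ineq2[of x "x - z"] by (auto simp: norm_minus_commute)
    \<comment> \<open>A failure means that \<open>f(x + t e)/t\<close> is larger at \<open>r n\<close> than at the inverted radius, so its derivative, a
      positive multiple of \<open>q\<close>, is positive in between.\<close>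
    have "\<exists>w. r n < norm x \<longrightarrow> 0 \<le> q w \<and> norm (w - y' n) \<le> r n - (l' n)\<^sup>2 / r n" for n
    proof (cases "r n < norm x")
      case True
      have rl: "l' n \<le> r n" "0 < r n" using y'(1)[of n] l'0[of n] by (auto simp: r_def)
      define e where "e = (1 / r n) *\<^sub>R (y' n - x)"
      have e: "norm e = 1" using rl by (simp add: e_def r_def)
      have ye: "y' n = x + r n *\<^sub>R e" using rl by (simp add: e_def)
      define r' where "r' = (l' n)\<^sup>2 / r n"
      have "l' n * l' n \<le> r n * r n" using rl l'0[of n] by (intro mult_mono) auto
      then have r': "0 < r'" "r' \<le> r n"
        using rl l'0[of n] by (auto simp: r'_def power2_eq_square pos_divide_le_eq)
      have "r n * (f (x + r' *\<^sub>R e) / r') < f (x + r n *\<^sub>R e)"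
        using y'(4)[of n] unfolding ye invert_radial(2)[OF e rl(2) l'0] r'_def[symmetric] .
      then have lt: "f (x + r' *\<^sub>R e) / r' < f (x + r n *\<^sub>R e) / r n"
        using rl by (simp add: pos_less_divide_eq mult.commute)
      then have "r' \<noteq> r n" by auto
      then have rr: "r' < r n" using r' by simp
      have seg: "jet2 f p H (x + t *\<^sub>R e)" if "r' \<le> t" "t \<le> r n" for t
      proof (rule fD(4))
        define d where "d = t *\<^sub>R e"
        have "norm d < norm x" using that True r' e by (simp add: d_def)
        then have "0 < norm (x + d)" "norm (x + d) < 2"
          using x norm_triangle_ineq[of x d] norm_triangle_ineq2[of x "- d"] by auto
        then show "x + t *\<^sub>R e \<in> S0" by (auto simp: d_def)
      qed
      have "\<exists>t>r'. t < r n \<and> f (x + r n *\<^sub>R e) / r n - f (x + r' *\<^sub>R e) / r' =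
          (r n - r') * ((p (x + t *\<^sub>R e) \<bullet> (t *\<^sub>R e) - f (x + t *\<^sub>R e)) / t\<^sup>2)"
        by (rule MVT2[OF rr], rule radial_quotient_derivative[OF seg]) (use r' in auto)
      then obtain t where t: "r' < t" "t < r n"
        "f (x + r n *\<^sub>R e) / r n - f (x + r' *\<^sub>R e) / r' = (r n - r') * (q (x + t *\<^sub>R e) / t\<^sup>2)"
        by (auto simp: q_def)
      have "0 < (r n - r') * (q (x + t *\<^sub>R e) / t\<^sup>2)" using t(3) lt by linarith
      then have "0 < q (x + t *\<^sub>R e) / t\<^sup>2" by (rule zero_less_mult_pos) (use rr in simp)
      then have "0 < q (x + t *\<^sub>R e)" using t r' by (simp add: zero_less_divide_iff)
      moreover have "x + t *\<^sub>R e - y' n = (t - r n) *\<^sub>R e" unfolding ye by (simp add: algebra_simps)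
      then have "norm (x + t *\<^sub>R e - y' n) = r n - t" using t e by simp
      ultimately show ?thesis using t r'_def by (intro exI[of _ "x + t *\<^sub>R e"]) auto
    qed auto
    then obtain W where W: "\<And>n. r n < norm x \<Longrightarrow> 0 \<le> q (W n) \<and> norm (W n - y' n) \<le> r n - (l' n)\<^sup>2 / r n"
      by metis
    have ev: "eventually (\<lambda>n. r n < norm x) sequentially" using rm mx by (rule order_tendstoD)
    have "(\<lambda>n. r n - (l' n)\<^sup>2 / r n) \<longlonglongrightarrow> m - m\<^sup>2 / m"
      by (intro tendsto_intros rm l'm) (use m0 in simp)
    then have "(\<lambda>n. r n - (l' n)\<^sup>2 / r n) \<longlonglongrightarrow> 0" using m0 by (simp add: power2_eq_square)
    then have "(\<lambda>n. W n - y' n) \<longlonglongrightarrow> 0"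
      by (rule Lim_null_comparison[rotated]) (use ev W in \<open>auto elim: eventually_mono\<close>)
    from tendsto_add[OF this y'z] have Wz: "W \<longlonglongrightarrow> z" by simp
    have "isCont p z" "isCont f z" using fD(8,9) S zS continuous_on_eq_continuous_at by blast+
    then have "(\<lambda>n. q (W n)) \<longlonglongrightarrow> q z"
      unfolding q_def by (intro tendsto_intros isCont_tendsto_compose[OF _ Wz] Wz)
    moreover have "eventually (\<lambda>n. 0 \<le> q (W n)) sequentially" using ev W by (auto elim: eventually_mono)
    ultimately have "0 \<le> q z" by (rule tendsto_lowerbound) simp
    moreover have "q z < 0"
      using radially_decreasing_on_sphere[OF x m0 mx good out 3] by (simp add: q_def)
    ultimately show False by simp
  qed
qed

end
end

section \<open>Growth at the puncture\<close>

context elliptic_operator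
begin

text \<open>
  An upper bound for the Hessian bounds the conformal Hessian from above, and since its trace is nonnegative it is
  then small as a whole.
\<close>
lemma no_flat_touching:
  fixes f :: "real^'n \<Rightarrow> real" and b :: real
  assumes f: "solution_on S f p H" and y: "y \<in> S"
    and gap: "\<And>A. A \<in> U \<Longrightarrow> norm A < \<delta> \<Longrightarrow> F A \<noteq> 1"
    and tr: "0 \<le> trace (conf_form (f y) (p y) (H y))"
    and Hb: "psd (b *\<^sub>R mat 1 - H y)" and b: "0 \<le> b" "2 * CARD('n) * (f y * b) < \<delta>"
  shows False
proof -
  note fD = solution_onD[OF f]
  let ?A = "conf_form (f y) (p y) (H y)"
  let ?P = "(f y * b) *\<^sub>R mat 1 - ?A"
  have fb: "0 \<le> f y * b" using fD(3)[OF y] b by simp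
  have "?P = f y *\<^sub>R (b *\<^sub>R mat 1 - H y) + (p y \<bullet> p y / 2) *\<^sub>R mat 1"
    by (simp add: conf_form_def algebra_simps)
  moreover have "psd (f y *\<^sub>R (b *\<^sub>R mat 1 - H y) + (p y \<bullet> p y / 2) *\<^sub>R mat 1)"
    using Hb fD(3)[OF y]
    by (auto simp: psd_def scaleR_matrix_vector_assoc[symmetric] matrix_vector_mult_add_rdistrib inner_add_right
        simp del: matrix_vector_mult_diff_rdistrib)
  ultimately have "psd ?P" by simp
  then have "norm ?P \<le> trace ?P" by (rule psd_norm_le_trace)
  also have "\<dots> \<le> CARD('n) * (f y * b)" using tr by (simp add: trace_sub mult.commute)
  finally have P: "norm ?P \<le> CARD('n) * (f y * b)" .
  have I: "norm ((f y * b) *\<^sub>R (mat 1 :: real^'n^'n)) \<le> CARD('n) * (f y * b)"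
  proof -
    have "norm (mat 1 :: real^'n^'n) * (f y * b) \<le> CARD('n) * (f y * b)"
      by (intro mult_right_mono fb) (rule norm_mat_1_le)
    then show ?thesis using fb by (simp only: norm_scaleR abs_of_nonneg mult.commute)
  qed
  have "norm ?A \<le> norm ((f y * b) *\<^sub>R (mat 1 :: real^'n^'n)) + norm ?P"
    using norm_triangle_ineq4[of "(f y * b) *\<^sub>R (mat 1 :: real^'n^'n)" ?P] by simp
  then have "norm ?A < \<delta>" using P I b by simp
  then show False using gap[OF fD(5)[OF y]] fD(6)[OF y] by blast
qed

end

context conformal_operator
begin

text \<open>
  Suppose \<open>f(z) < K|z|\<^sup>2\<close> for some \<open>z\<close> very close to the origin. Maximizing the quotient of the distance to the boundary of a
  ball about \<open>z\<close> by \<open>f\<close> selects a point \<open>x0\<close> with value \<open>fs = f(x0)\<close> such that \<open>f \<ge> fs/2\<close> on a ball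
  of radius much larger than \<open>fs\<close>. Around centres at distance \<open>\<Lambda> fs\<close> from \<open>x0\<close> spheres can then be
  moved up to radius \<open>2 \<Lambda> fs\<close>: besides the bound for \<open>f\<close>, the required inequality on the unit sphere
  only involves values of \<open>f\<close> near \<open>x0\<close>, and \<open>fs\<close> is small. Comparing \<open>x0\<close> with the points on the ray from the centre
  through \<open>x0\<close> gives \<open>f \<le> (1 + 1/\<Lambda>) fs\<close> at distance up to \<open>fs\<close> from \<open>x0\<close>. So a paraboloid of
  opening \<open>a/fs\<close> touches \<open>f\<close> from above inside that ball, and \<open>no_flat_touching\<close> applies.
\<close>
lemma quadratic_growth:
  assumes dim: "3 \<le> CARD('n)"
    and f: "solution_on (ball 0 2 - {0}) f p H"
    and sub: "\<And>y. y \<in> ball 0 2 - {0} \<Longrightarrow> 0 \<le> trace (H y)"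
    and tr: "\<And>y. y \<in> ball 0 2 - {0} \<Longrightarrow> 0 \<le> trace (conf_form (f y) (p y) (H y))"
    and bound: "\<And>y. 0 < norm y \<Longrightarrow> norm y \<le> 1 \<Longrightarrow> f y \<le> M"
    and gap: "0 < \<delta>" "\<And>A. A \<in> U \<Longrightarrow> norm A < \<delta> \<Longrightarrow> F A \<noteq> 1" and K: "0 < K"
  obtains \<rho> where "0 < \<rho>" "\<And>z. 0 < norm z \<Longrightarrow> norm z < \<rho> \<Longrightarrow> K * (norm z)\<^sup>2 \<le> f z"
proof -
  note fD = solution_onD[OF f]
  define n where "n = real CARD('n)"
  have n: "0 < n" by (simp add: n_def)
  define a where "a = min 1 (\<delta> / (16 * n))"
  have a: "0 < a" "a \<le> 1" using gap n by (auto simp: a_def)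
  have "a \<le> \<delta> / (16 * n)" by (simp add: a_def)
  then have a\<delta>: "8 * n * a < \<delta>" using n gap by (simp add: field_simps)
  define \<Lambda> where "\<Lambda> = 2 / a"
  have \<Lambda>: "2 \<le> \<Lambda>" using a by (simp add: \<Lambda>_def field_simps)
  define M1 where "M1 = \<bar>M\<bar> + 1"
  have M1: "1 \<le> M1" "M < M1" by (auto simp: M1_def)
  define \<rho> where "\<rho> = min (1/6) (min (1 / (12 * \<Lambda> * K)) (1 / (32 * \<Lambda>\<^sup>2 * K * M1)))"
  show thesis
  proof (rule that[of \<rho>])
    show "0 < \<rho>" using \<Lambda> K M1 by (simp add: \<rho>_def)
    fix z :: "real^'n" assume z: "0 < norm z" "norm z < \<rho>"
    have "norm z < 1 / (12 * \<Lambda> * K)" "norm z < 1 / (32 * \<Lambda>\<^sup>2 * K * M1)" and z6: "norm z \<le> 1/6"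
      using z by (auto simp: \<rho>_def)
    then have z1: "12 * \<Lambda> * K * norm z < 1" and z2: "32 * \<Lambda>\<^sup>2 * K * M1 * norm z < 1"
      using \<Lambda> K M1 by (simp_all add: pos_less_divide_eq mult.commute)
    show "K * (norm z)\<^sup>2 \<le> f z"
    proof (rule ccontr)
      assume "\<not> K * (norm z)\<^sup>2 \<le> f z"
      then have fz: "f z < K * (norm z)\<^sup>2" by simp
      define \<sigma> where "\<sigma> = norm z / 2"
      have \<sigma>: "0 < \<sigma>" "norm z = 2 * \<sigma>" "\<sigma> \<le> 1/12" using z z6 by (auto simp: \<sigma>_def)
      have inS: "y \<in> ball 0 2 - {0}" "\<sigma> \<le> norm y" "norm y \<le> 3 * \<sigma>" if "norm (y - z) \<le> \<sigma>" for y
      proof -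
        show "\<sigma> \<le> norm y" "norm y \<le> 3 * \<sigma>"
          using that \<sigma> norm_triangle_ineq[of "y - z" z] norm_triangle_ineq2[of z "z - y"]
          by (auto simp: norm_minus_commute)
        then show "y \<in> ball 0 2 - {0}" using \<sigma> by auto
      qed
      have cS: "cball z \<sigma> \<subseteq> ball 0 2 - {0}"
      proof
        fix y assume "y \<in> cball z \<sigma>"
        then show "y \<in> ball 0 2 - {0}" by (intro inS(1)) (simp add: dist_norm norm_minus_commute)
      qed
      have cont: "continuous_on (cball z \<sigma>) (\<lambda>y. (\<sigma> - norm (y - z)) / f y)"
        by (intro continuous_intros continuous_on_subset[OF fD(8) cS]) (use fD(3) cS in force)
      obtain x0 where x0: "x0 \<in> cball z \<sigma>"
        "\<And>y. y \<in> cball z \<sigma> \<Longrightarrow> (\<sigma> - norm (y - z)) / f y \<le> (\<sigma> - norm (x0 - z)) / f x0"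
        using continuous_attains_sup[OF compact_cball _ cont] \<sigma> by auto
      define fs where "fs = f x0"
      define ss where "ss = \<sigma> - norm (x0 - z)"
      have fs0: "0 < fs" unfolding fs_def by (rule fD(3)[OF subsetD[OF cS x0(1)]])
      have fz0: "0 < f z" by (rule fD(3)[OF subsetD[OF cS]]) (use \<sigma> in simp)
      have ratio: "\<sigma> / f z \<le> ss / fs" using x0(2)[of z] \<sigma> by (simp add: ss_def fs_def)
      then have "0 < ss / fs" using \<sigma> fz0 by (meson divide_pos_pos less_le_trans)
      then have ss0: "0 < ss" using fs0 by (simp add: zero_less_divide_iff)
      have ss\<sigma>: "ss \<le> \<sigma>" by (simp add: ss_def)
      have "fs * \<sigma> \<le> ss * f z" using ratio fs0 fz0 by (simp add: field_simps)
      also have "\<dots> \<le> ss * (K * (norm z)\<^sup>2)" using ss0 fz by (intro mult_left_mono) auto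
      also have "\<dots> = (2 * K * norm z * ss) * \<sigma>" using \<sigma>(2) by (simp add: power2_eq_square)
      finally have fss: "fs \<le> 2 * K * norm z * ss" by (rule mult_right_le_imp_le) (rule \<sigma>(1))
      have c1: "6 * \<Lambda> * fs \<le> ss"
      proof -
        have "6 * \<Lambda> * fs \<le> 6 * \<Lambda> * (2 * K * norm z * ss)" using fss \<Lambda> by (intro mult_left_mono) auto
        also have "\<dots> = (12 * \<Lambda> * K * norm z) * ss" by simp
        also have "\<dots> \<le> 1 * ss" using z1 ss0 by (intro mult_right_mono) auto
        finally show ?thesis by simp
      qed
      have c2: "16 * \<Lambda>\<^sup>2 * fs * M1 \<le> 1"
      proof -
        have "2 * K * norm z * ss \<le> 2 * K * norm z * 1" using K z ss\<sigma> \<sigma> by (intro mult_left_mono) auto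
        then have "fs \<le> 2 * K * norm z" using fss by simp
        then have "16 * \<Lambda>\<^sup>2 * M1 * fs \<le> 16 * \<Lambda>\<^sup>2 * M1 * (2 * K * norm z)" using M1 by (intro mult_left_mono) auto
        also have "\<dots> = 32 * \<Lambda>\<^sup>2 * K * M1 * norm z" by simp
        finally show ?thesis using z2 by (simp add: mult_ac)
      qed
      have fl: "2 * fs \<le> \<Lambda> * fs" using \<Lambda> fs0 by simp
      have half: "fs / 2 \<le> f y" if "norm (y - x0) \<le> ss / 2" for y
      proof -
        have yz: "norm (y - z) \<le> \<sigma> - ss / 2"
          using that norm_triangle_ineq[of "y - x0" "x0 - z"] unfolding ss_def diff_add_eq diff_diff_eq2
          by (simp add: field_simps)
        then have y\<sigma>: "norm (y - z) \<le> \<sigma>" using ss0 by simp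
        then have yc: "y \<in> cball z \<sigma>" by (simp add: dist_norm norm_minus_commute)
        have fy: "0 < f y" by (rule fD(3)[OF subsetD[OF cS yc]])
        have "(ss / 2) / f y \<le> (\<sigma> - norm (y - z)) / f y" using yz fy by (intro divide_right_mono) auto
        also have "\<dots> \<le> ss / fs" using x0(2)[OF yc] by (simp add: ss_def fs_def)
        finally show ?thesis using fy fs0 ss0 by (simp add: field_simps)
      qed
      have upper: "f y \<le> fs * (1 + a / 2)" if y: "norm (y - x0) \<le> fs" for y
      proof (cases "y = x0")
        case True
        then show ?thesis using fs0 a by (simp add: fs_def)
      next
        case False
        define d where "d = norm (y - x0)"
        define e where "e = (1 / d) *\<^sub>R (y - x0)"
        have d: "0 < d" "d \<le> fs" using False y by (auto simp: d_def)
        have e: "norm e = 1" using d by (simp add: e_def d_def)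
        define r' where "r' = \<Lambda> * fs"
        define r where "r = r' + d"
        \<comment> \<open>The sphere about \<open>x\<close> that exchanges \<open>x0\<close> and \<open>y\<close> has radius \<open>sqrt (r' * r)\<close>.\<close>
        define x where "x = x0 - r' *\<^sub>R e"
        have r': "0 < r'" "2 * fs \<le> r'" "6 * r' \<le> ss" using \<Lambda> fs0 fl c1 by (auto simp: r'_def)
        have r: "r' < r" "0 < r" using d r' by (auto simp: r_def)
        have "d *\<^sub>R e = y - x0" using d by (simp add: e_def)
        moreover have "x + r *\<^sub>R e = x0 + d *\<^sub>R e" by (simp add: x_def r_def scaleR_add_left)
        ultimately have yx: "y = x + r *\<^sub>R e" by simp
        define l where "l = sqrt (r' * r)"
        have l2: "l\<^sup>2 = r' * r" using r r' by (simp add: l_def)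
        have l0: "0 < l" using r r' by (simp add: l_def)
        have lr: "l \<le> r"
          by (rule power2_le_imp_le) (use l2 r r' in \<open>simp_all add: power2_eq_square mult_right_mono\<close>)
        have l2r: "l \<le> 2 * r'"
        proof (rule power2_le_imp_le)
          have "r' * r \<le> r' * (4 * r')" using r' d by (intro mult_left_mono) (auto simp: r_def)
          then show "l\<^sup>2 \<le> (2 * r')\<^sup>2" using l2 by (simp add: power2_eq_square)
        qed (use r' in simp)
        have x0z: "norm (x0 - z) = \<sigma> - ss" by (simp add: ss_def)
        have xx0: "norm (x - x0) = r'" using e r' by (simp add: x_def)
        have "norm (x - z) \<le> r' + (\<sigma> - ss)"
          using norm_triangle_ineq[of "x - x0" "x0 - z"] xx0 x0z by simp
        then have "norm (x - z) \<le> \<sigma>" using r' by simp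
        note xn = inS[OF this]
        have x4: "norm x \<le> 1/4" using xn \<sigma> by simp
        have "2 * r' < norm x" using xn(2) ss\<sigma> r' by simp
        moreover have "norm (y - z) \<le> d + (\<sigma> - ss)"
          using norm_triangle_ineq[of "y - x0" "x0 - z"] x0z by (simp add: d_def)
        then have "norm (y - z) \<le> \<sigma>" using d r' by simp
        note yn = inS[OF this]
        moreover have "f w < invert f x l' w" if l': "0 < l'" "l' \<le> 2 * r'" and w: "norm w = 1" for l' w
        proof -
          have wx: "3/4 \<le> norm (w - x)" using norm_triangle_ineq2[of w x] w x4 by simp
          have "2 * r' \<le> 1/4" using r' ss\<sigma> \<sigma> by simp
          then have "l' \<le> norm (w - x)" using wx l' by simp
          then have "norm (inversion x l' w - x) \<le> l'" using norm_inversion_le l' by blast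
          then have "norm (inversion x l' w - x0) \<le> ss / 2"
            using norm_triangle_ineq[of "inversion x l' w - x" "x - x0"] xx0 l' r' by simp
          then have hz: "fs / 2 \<le> f (inversion x l' w)" by (rule half)
          have "l'\<^sup>2 \<le> (2 * r')\<^sup>2" using l' by (intro power_mono) auto
          then have "l'\<^sup>2 * M1 \<le> (2 * r')\<^sup>2 * M1" using M1 by (intro mult_right_mono) auto
          also have "\<dots> = (16 * \<Lambda>\<^sup>2 * fs * M1) * (fs / 4)" by (simp add: r'_def power2_eq_square)
          also have "\<dots> \<le> 1 * (fs / 4)" using c2 fs0 by (intro mult_right_mono) auto
          finally have "l'\<^sup>2 * M1 \<le> fs / 4" by simp
          moreover have "(3/4)\<^sup>2 * (fs / 2) \<le> (norm (w - x))\<^sup>2 * f (inversion x l' w)"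
            using wx hz fs0 by (intro mult_mono power_mono) auto
          moreover have "(3/4)\<^sup>2 * (fs / 2) = 9/8 * (fs / 4)" by (simp add: power2_eq_square)
          ultimately have "9/8 * (l'\<^sup>2 * M1) \<le> (norm (w - x))\<^sup>2 * f (inversion x l' w)" by linarith
          then have "9/8 * M1 \<le> (norm (w - x))\<^sup>2 * f (inversion x l' w) / l'\<^sup>2"
            using l' by (simp add: pos_le_divide_eq mult_ac)
          then have "9/8 * M1 \<le> invert f x l' w" by (simp add: invert_def)
          moreover have "f w \<le> M" by (rule bound) (simp_all add: w)
          ultimately show ?thesis using M1 by linarith
        qed
        ultimately have "f y \<le> invert f x l y"
          using moving_spheres[OF dim f sub bound x4, of "2 * r'" l y] l0 l2r lr yx e \<sigma> r by auto
        also have "\<dots> = r * (f x0 / r')"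
          unfolding yx invert_radial(2)[OF e r(2) l0] using l2 r by (simp add: x_def)
        also have "\<dots> = fs * (1 + d / r')" using r' by (simp add: r_def fs_def field_simps)
        also have "\<dots> \<le> fs * (1 + a / 2)"
        proof -
          have "d / r' \<le> fs / r'" using d r' by (intro divide_right_mono) auto
          also have "\<dots> = a / 2" using fs0 a by (simp add: r'_def \<Lambda>_def)
          finally show ?thesis using fs0 by simp
        qed
        finally show ?thesis .
      qed
      let ?h = "\<lambda>y. a / fs * ((y - x0) \<bullet> (y - x0)) - f y"
      have fsss: "fs \<le> ss" using c1 fl fs0 by linarith
      have bS: "y \<in> ball 0 2 - {0}" if "norm (y - x0) \<le> fs" for y
        by (rule inS(1)) (use that norm_triangle_ineq[of "y - x0" "x0 - z"] fsss in \<open>simp add: ss_def\<close>)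
      have cS2: "cball x0 fs \<subseteq> ball 0 2 - {0}"
      proof
        fix y assume "y \<in> cball x0 fs"
        then show "y \<in> ball 0 2 - {0}" by (intro bS) (simp add: dist_norm norm_minus_commute)
      qed
      have "continuous_on (cball x0 fs) ?h"
        by (intro continuous_intros continuous_on_subset[OF fD(8) cS2])
      then obtain y1 where y1: "y1 \<in> cball x0 fs" "\<And>y. y \<in> cball x0 fs \<Longrightarrow> ?h y1 \<le> ?h y"
        using continuous_attains_inf[OF compact_cball, of x0 fs ?h] fs0 by auto
      have y1n: "norm (y1 - x0) \<le> fs" using y1(1) by (simp add: dist_norm norm_minus_commute)
      have "norm (y1 - x0) \<noteq> fs"
      proof
        assume eq: "norm (y1 - x0) = fs"
        have "?h y1 \<le> ?h x0" by (rule y1(2)) (use fs0 in simp)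
        then have "a / fs * fs\<^sup>2 - f y1 \<le> - fs" by (simp add: power2_norm_eq_inner[symmetric] eq fs_def)
        then have "a * fs + fs \<le> f y1" using fs0 by (simp add: power2_eq_square)
        also have "\<dots> \<le> fs * (1 + a / 2)" by (rule upper[OF y1n])
        finally have "a * fs \<le> a / 2 * fs" by (simp add: algebra_simps)
        then show False using a fs0 by simp
      qed
      then have y1b: "0 < fs - norm (y1 - x0)" using y1n by simp
      have sub1: "y \<in> cball x0 fs" if "y \<in> ball y1 (fs - norm (y1 - x0))" for y
        using that norm_triangle_ineq[of "y - y1" "y1 - x0"] by (simp add: dist_norm norm_minus_commute)
      have jet: "jet2 ?h (\<lambda>y. (a / fs) *\<^sub>R (2 *\<^sub>R (y - x0)) - p y) (\<lambda>y. (a / fs) *\<^sub>R (2 *\<^sub>R mat 1) - H y) y"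
        if "y \<in> ball y1 (fs - norm (y1 - x0))" for y
        by (intro jet2_diff jet2_scaleR jet2_norm_squared fD(4) subsetD[OF cS2 sub1] that)
      have y1S: "y1 \<in> ball 0 2 - {0}" using cS2 y1(1) by blast
      note im = interior_minimum(2)[OF y1b jet y1(2)[OF sub1]]
      have psd1: "psd ((2 * a / fs) *\<^sub>R mat 1 - H y1)"
        unfolding psd_def using im fD(7)[OF y1S] by (auto simp: mult.commute)
      have "f y1 * (2 * a / fs) \<le> (2 * fs) * (2 * a / fs)"
      proof (rule mult_right_mono)
        have "fs * (1 + a / 2) \<le> fs * 2" using a fs0 by (intro mult_left_mono) auto
        then show "f y1 \<le> 2 * fs" using upper[OF y1n] by simp
      qed (use a fs0 in simp)
      also have "\<dots> = 4 * a" using fs0 by simp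
      finally have "2 * n * (f y1 * (2 * a / fs)) \<le> 2 * n * (4 * a)" using n by (intro mult_left_mono) auto
      then have small: "2 * CARD('n) * (f y1 * (2 * a / fs)) < \<delta>" using a\<delta> by (simp add: n_def)
      have b0: "0 \<le> 2 * a / fs" by (rule divide_nonneg_pos) (use a fs0 in auto)
      from no_flat_touching[OF f y1S gap(2) tr[OF y1S] psd1 b0 small] show False .
    qed
  qed
qed

end

section \<open>The theorem\<close>

lemma grad_works:
  fixes u :: "real^'n \<Rightarrow> real"
  assumes "u differentiable (at x)"
  shows "(u has_derivative (\<lambda>k. grad u x \<bullet> k)) (at x)"
proof -
  let ?d = "frechet_derivative u (at x)"
  have d: "(u has_derivative ?d) (at x)" using assms frechet_derivative_works by blast
  then have lin: "linear ?d" by (rule has_derivative_linear)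
  have "?d k = grad u x \<bullet> k" for k
  proof -
    have "?d k = ?d (\<Sum>i\<in>UNIV. k $ i *\<^sub>R axis i 1)"
      using basis_expansion[of k] by (simp add: scalar_mult_eq_scaleR)
    also have "\<dots> = (\<Sum>i\<in>UNIV. k $ i * ?d (axis i 1))"
      by (simp add: linear_sum[OF lin] linear_scale[OF lin])
    also have "\<dots> = grad u x \<bullet> k" by (simp add: inner_vec_def grad_def mult.commute)
    finally show ?thesis .
  qed
  then have "?d = (\<lambda>k. grad u x \<bullet> k)" by blast
  with d show ?thesis by simp
qed

lemma C2_on_jet2: "C2_on u S \<Longrightarrow> x \<in> S \<Longrightarrow> jet2 u (grad u) (hess u) x"
  unfolding jet2_def hess_def C2_on_def using grad_works jacobian_works by blast

lemma jet2_powr: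
  assumes u: "jet2 u G h y" and pos: "0 < u y"
  shows "jet2 (\<lambda>y. u y powr c) (\<lambda>y. (c * u y powr (c - 1)) *\<^sub>R G y)
    (\<lambda>y. (c * u y powr (c - 1)) *\<^sub>R h y + (c * (c - 1) * u y powr (c - 2)) *\<^sub>R tensor (G y) (G y)) y"
proof -
  have du: "(u has_derivative (\<lambda>k. G y \<bullet> k)) (at y)" and dG: "(G has_derivative (\<lambda>k. h y *v k)) (at y)"
    using u by (auto simp: jet2_def)
  have pw: "((\<lambda>y. u y powr c) has_derivative (\<lambda>k. (c * u y powr (c - 1)) * (G y \<bullet> k))) (at y)" for c
  proof -
    have "((\<lambda>z. z powr c) has_real_derivative c * u y powr (c - 1)) (at (u y))"
      using pos by (rule has_real_derivative_powr)
    from has_derivative_compose[OF du this[unfolded has_field_derivative_def]]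
    show ?thesis by simp
  qed
  have "((\<lambda>y. (c * u y powr (c - 1)) *\<^sub>R G y) has_derivative
     (\<lambda>k. (c * u y powr (c - 1)) *\<^sub>R (h y *v k) + (c * (((c - 1) * u y powr (c - 1 - 1)) * (G y \<bullet> k))) *\<^sub>R G y)) (at y)"
    by (rule has_derivative_scaleR[OF has_derivative_mult_right[OF pw] dG])
  then have "((\<lambda>y. (c * u y powr (c - 1)) *\<^sub>R G y) has_derivative
     (\<lambda>k. ((c * u y powr (c - 1)) *\<^sub>R h y + (c * (c - 1) * u y powr (c - 2)) *\<^sub>R tensor (G y) (G y)) *v k)) (at y)"
    by (rule has_derivative_eq_rhs) (simp add: fun_eq_iff matrix_vector_mult_add_rdistrib
        scaleR_matrix_vector_assoc[symmetric] tensor_mult_vector mult.assoc)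
  moreover have "((\<lambda>y. u y powr c) has_derivative (\<lambda>k. ((c * u y powr (c - 1)) *\<^sub>R G y) \<bullet> k)) (at y)"
    by (rule has_derivative_eq_rhs[OF pw]) (simp add: fun_eq_iff)
  ultimately show ?thesis by (simp add: jet2_def)
qed

lemma conf_hess_eq_conf_form:
  fixes u :: "real^'n \<Rightarrow> real"
  assumes dim: "3 \<le> CARD('n)" and pos: "0 < u y"
  defines "c \<equiv> - (2 / (real CARD('n) - 2))"
  shows "conf_form (u y powr c) ((c * u y powr (c - 1)) *\<^sub>R grad u y)
     ((c * u y powr (c - 1)) *\<^sub>R hess u y + (c * (c - 1) * u y powr (c - 2)) *\<^sub>R tensor (grad u y) (grad u y))
   = conf_hess u y"
proof -
  define n where "n = real CARD('n)"
  define m where "m = n - 2"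
  have m: "0 < m" and nm: "n = m + 2" using dim by (auto simp: m_def n_def)
  have c: "c = - (2 / m)" by (simp add: c_def m_def n_def)
  have q: "c + (c - 1) = - ((n + 2) / (n - 2))" "c + (c - 2) = - (2 * n / (n - 2))"
    "(c - 1) + (c - 1) = - (2 * n / (n - 2))"
    unfolding c nm using m by (simp_all add: field_simps)
  have e1: "u y powr c * u y powr (c - 1) = u y powr (- ((n + 2) / (n - 2)))"
    unfolding powr_add[symmetric] q ..
  have e2: "u y powr c * u y powr (c - 2) = u y powr (- (2 * n / (n - 2)))"
    unfolding powr_add[symmetric] q ..
  have e3: "u y powr (c - 1) * u y powr (c - 1) = u y powr (- (2 * n / (n - 2)))"
    unfolding powr_add[symmetric] q ..
  have c1: "c * (c - 1) = 2 * n / (n - 2)\<^sup>2"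
    unfolding c nm using m by (simp add: power2_eq_square field_simps)
  have c2: "c * c / 2 = 2 / (n - 2)\<^sup>2"
    unfolding c nm using m by (simp add: power2_eq_square field_simps)
  have s1: "u y powr c * (c * u y powr (c - 1)) = - (2 / (n - 2)) * u y powr (- ((n + 2) / (n - 2)))"
    unfolding e1[symmetric] by (simp add: c m_def)
  have s2: "u y powr c * (c * (c - 1) * u y powr (c - 2)) = 2 * n / (n - 2)\<^sup>2 * u y powr (- (2 * n / (n - 2)))"
    unfolding c1[symmetric] e2[symmetric] by (simp only: mult_ac)
  have s3: "((c * u y powr (c - 1)) *\<^sub>R grad u y) \<bullet> ((c * u y powr (c - 1)) *\<^sub>R grad u y) / 2
     = 2 / (n - 2)\<^sup>2 * u y powr (- (2 * n / (n - 2))) * (norm (grad u y))\<^sup>2"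
    unfolding c2[symmetric] e3[symmetric] power2_norm_eq_inner by (simp add: mult_ac)
  show ?thesis
    unfolding conf_form_def conf_hess_def Let_def n_def[symmetric] s3 scaleR_add_right scaleR_scaleR s1 s2 ..
qed

lemma trace_conf_hess:
  fixes u :: "real^'n \<Rightarrow> real"
  assumes dim: "3 \<le> CARD('n)"
  shows "trace (conf_hess u y) =
    - (2 / (real CARD('n) - 2)) * u y powr (- ((real CARD('n) + 2) / (real CARD('n) - 2))) * laplacian u y"
proof -
  define n where "n = real CARD('n)"
  have n: "n - 2 > 0" using dim by (simp add: n_def)
  have "2 * n / (n - 2)\<^sup>2 * w * g - 2 / (n - 2)\<^sup>2 * w * g * n = 0" for w g by simp
  then show ?thesis
    by (simp add: conf_hess_def Let_def trace_add trace_sub laplacian_def n_def power2_norm_eq_inner)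
qed

lemma continuous_on_tensor:
  fixes v :: "'a::topological_space \<Rightarrow> real^'n"
  assumes "continuous_on S v" shows "continuous_on S (\<lambda>y. tensor (v y) (v y))"
  unfolding tensor_def
  by (intro continuous_intros continuous_on_vec_lambda continuous_on_component assms)

lemma one_plus_power_le:
  fixes t :: real assumes "0 \<le> t" "t \<le> 1" shows "(1 + t) ^ k \<le> 1 + 3 ^ k * t"
proof (induction k)
  case (Suc k)
  have "(1 + t) ^ Suc k \<le> (1 + t) * (1 + 3 ^ k * t)" using Suc assms by simp
  also have "\<dots> = 1 + t + 3 ^ k * t + 3 ^ k * t * t" by (simp add: algebra_simps)
  also have "\<dots> \<le> 1 + 3 ^ k * t + 3 ^ k * t + 3 ^ k * t"
  proof -
    have "1 * t \<le> 3 ^ k * t" using assms by (intro mult_right_mono) auto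
    moreover have "3 ^ k * t * t \<le> 3 ^ k * t * 1" using assms by (intro mult_left_mono) auto
    ultimately show ?thesis by linarith
  qed
  finally show ?case by (simp add: algebra_simps)
qed (use assms in simp)

text \<open>
  The centre \<open>c\<close> lies on the line through \<open>y\<close> and \<open>x\<close>, beyond \<open>x\<close> at distance \<open>s\<close>. Since \<open>|x| = |y|\<close>, expanding
  \<open>|c|\<^sup>2\<close> gives \<open>|x|\<^sup>2 + s (s + |x-y|)\<close>, so \<open>|c| = \<epsilon>\<close> is a quadratic equation for \<open>s\<close>. The number \<open>s (s + |x-y|)\<close>
  is also the squared radius of the sphere about \<open>c\<close> that exchanges \<open>x\<close> and \<open>y\<close>.
\<close>
lemma inversion_exchanging:
  fixes x y :: "real^'n"
  assumes xy: "x \<noteq> y" "norm x = norm y" and r: "0 < norm x" "norm x < \<epsilon>"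
  obtains c s l where "norm c = \<epsilon>" "0 < l" "l < \<epsilon>" "0 < s" "l\<^sup>2 = s * (s + norm (x - y))"
    "l\<^sup>2 = \<epsilon>\<^sup>2 - (norm x)\<^sup>2" "norm (y - c) = s + norm (x - y)" "inversion c l y = x"
proof -
  define d where "d = norm (x - y)"
  define D where "D = \<epsilon>\<^sup>2 - (norm x)\<^sup>2"
  define t where "t = sqrt (d\<^sup>2 + 4 * D)"
  define s where "s = (t - d) / 2"
  define e where "e = (1 / d) *\<^sub>R (x - y)"
  define c where "c = x + s *\<^sub>R e"
  define l where "l = sqrt D"
  have \<epsilon>0: "0 \<le> \<epsilon>" using r by linarith
  have d: "0 < d" using xy by (simp add: d_def)
  have D: "0 < D" using r by (simp add: D_def power_strict_mono)
  have t2: "t\<^sup>2 = d\<^sup>2 + 4 * D" using D by (simp add: t_def)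
  have "d < t" unfolding t_def using D d by (intro real_less_rsqrt) simp
  then have s: "0 < s" by (simp add: s_def)
  have ss: "s * (s + d) = D"
  proof -
    have "s * (s + d) = (t\<^sup>2 - d\<^sup>2) / 4" by (simp add: s_def power2_eq_square field_simps)
    then show ?thesis using t2 by simp
  qed
  have e1: "norm e = 1" using d by (simp add: e_def d_def)
  have de: "d *\<^sub>R e = x - y" using d by (simp add: e_def)
  have "d\<^sup>2 = (x - y) \<bullet> (x - y)" by (simp add: d_def power2_norm_eq_inner)
  also have "\<dots> = x \<bullet> x + y \<bullet> y - 2 * (x \<bullet> y)" by (simp add: inner_diff_left inner_diff_right inner_commute)
  also have "y \<bullet> y = x \<bullet> x" using xy(2) by (simp add: norm_eq)
  finally have "x \<bullet> (d *\<^sub>R e) = d * (d / 2)" by (simp add: de inner_diff_right power2_eq_square)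
  then have xe: "x \<bullet> e = d / 2" using d by simp
  have ee: "e \<bullet> e = 1" using e1 by (simp add: norm_eq_1)
  have "(norm c)\<^sup>2 = x \<bullet> x + 2 * (s * (x \<bullet> e)) + s * s * (e \<bullet> e)"
    by (simp add: c_def power2_norm_eq_inner inner_add_left inner_add_right inner_commute)
  also have "\<dots> = (norm x)\<^sup>2 + s * (s + d)" by (simp add: xe ee power2_norm_eq_inner algebra_simps)
  also have "\<dots> = \<epsilon>\<^sup>2" by (simp add: ss D_def)
  finally have "(norm c)\<^sup>2 = \<epsilon>\<^sup>2" .
  then have nc: "norm c = \<epsilon>" by (rule power2_eq_imp_eq[OF _ norm_ge_zero \<epsilon>0])
  have yc: "y - c = (- (s + d)) *\<^sub>R e" using de by (simp add: c_def algebra_simps)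
  have nyc: "norm (y - c) = s + d" unfolding yc using s d e1 by simp
  have l2: "l\<^sup>2 = D" using D by (simp add: l_def)
  have "D / (s + d)\<^sup>2 * (s + d) = s"
    unfolding ss[symmetric] using s d by (simp add: power2_eq_square)
  then have "(D / (s + d)\<^sup>2) *\<^sub>R (y - c) = - (s *\<^sub>R e)"
    unfolding yc by (simp only: scaleR_minus_left scaleR_minus_right scaleR_scaleR)
  then have "inversion c l y = c - s *\<^sub>R e"
    unfolding inversion_def nyc l2 by simp
  then have inv: "inversion c l y = x" by (simp add: c_def)
  have "l\<^sup>2 < \<epsilon>\<^sup>2" using l2 r by (simp add: D_def)
  then have "l < \<epsilon>" using \<epsilon>0 by (rule power2_less_imp_less)
  then show thesis
    using that[of c l s] nc s ss l2 nyc inv D by (simp add: d_def D_def l_def)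
qed

theorem theorem1p3:
  fixes U :: "(real^'n^'n) set" and F :: "real^'n^'n \<Rightarrow> real" and u :: "real^'n \<Rightarrow> real"
  assumes dim: "CARD('n) \<ge> 3"
    and U_open: "openin (top_of_set sym_matrices) U"
    and U_inv: "\<And>Q. orthogonal_matrix Q \<Longrightarrow> (\<lambda>M. matrix_inv Q ** M ** Q) ` U = U"
    and U_convex: "\<And>M N. M \<in> sym_matrices \<Longrightarrow> pos_def N \<Longrightarrow>
                     convex (U \<inter> {M + t *\<^sub>R N | t. 0 < t})"
    and F_C1: "C1_on_sym F U"
    and F_inv: "\<And>M Q. M \<in> U \<Longrightarrow> orthogonal_matrix Q \<Longrightarrow> F (matrix_inv Q ** M ** Q) = F M"
    and F_elliptic: "\<And>M. M \<in> U \<Longrightarrow> pos_def (entry_derivs F M)"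
    and F_zero: "\<exists>\<delta>>0. \<forall>M\<in>U. norm M < \<delta> \<longrightarrow> F M \<noteq> 1"
    and u_C2: "C2_on u (ball 0 2 - {0})"
    and u_pos: "\<And>x. x \<in> ball 0 2 - {0} \<Longrightarrow> u x > 0"
    and u_superharmonic: "\<And>x. x \<in> ball 0 2 - {0} \<Longrightarrow> laplacian u x \<le> 0"
    and u_U: "\<And>x. x \<in> ball 0 2 - {0} \<Longrightarrow> conf_hess u x \<in> U"
    and u_eq: "\<And>x. x \<in> ball 0 2 - {0} \<Longrightarrow> F (conf_hess u x) = 1"
  shows "(\<exists>\<epsilon>>0. \<forall>x l y. 0 < l \<and> l < norm x \<and> norm x \<le> \<epsilon> \<and> norm (y - x) \<ge> l \<and>
             0 < norm y \<and> norm y \<le> 1 \<longrightarrow> kelvin u x l y \<le> u y)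
       \<and> (\<exists>C>0. \<forall>r x y. 0 < r \<and> r = norm x \<and> norm x = norm y \<and> r < 1 \<longrightarrow>
             \<bar>u x / u y - 1\<bar> \<le> C * r)"
proof -
  interpret conformal_operator U F
    by unfold_locales (use U_open U_convex F_C1 F_elliptic U_inv F_inv in blast)+
  let ?S = "ball 0 2 - {0} :: (real^'n) set"
  define n where "n = real CARD('n)"
  define c where "c = - (2 / (n - 2))"
  define f where "f y = u y powr c" for y
  define p where "p y = (c * u y powr (c - 1)) *\<^sub>R grad u y" for y
  define H where "H y = (c * u y powr (c - 1)) *\<^sub>R hess u y
    + (c * (c - 1) * u y powr (c - 2)) *\<^sub>R tensor (grad u y) (grad u y)" for y
  have n: "0 < n - 2" using dim by (simp add: n_def)
  have c: "c < 0" using n by (simp add: c_def)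
  have opS: "open ?S" by (simp add: open_delete)
  have ujet: "jet2 u (grad u) (hess u) y" if "y \<in> ?S" for y by (rule C2_on_jet2[OF u_C2 that])
  have ucont: "continuous_on ?S u" "continuous_on ?S (grad u)"
    by (intro continuous_at_imp_continuous_on ballI jet2_isCont[OF ujet], assumption)+
  have A: "conf_form (f y) (p y) (H y) = conf_hess u y" if "y \<in> ?S" for y
    unfolding f_def p_def H_def c_def n_def by (rule conf_hess_eq_conf_form[of u y, OF dim u_pos[OF that]])
  have une: "\<forall>y\<in>?S. u y \<noteq> 0" using u_pos by force
  have "continuous_on ?S (hess u)" using u_C2 by (simp add: C2_on_def)
  then have Hcont: "continuous_on ?S H"
    unfolding H_def by (intro continuous_intros continuous_on_tensor ucont une)
  have sol: "solution_on ?S f p H"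
    unfolding solution_on_def
  proof (intro conjI ballI opS Hcont)
    fix y assume y: "y \<in> ?S"
    show "0 < f y" using u_pos[OF y] by (simp add: f_def)
    show "jet2 f p H y" unfolding f_def[abs_def] p_def[abs_def] H_def[abs_def]
      by (rule jet2_powr[OF ujet[OF y] u_pos[OF y]])
    show "conf_form (f y) (p y) (H y) \<in> U" "F (conf_form (f y) (p y) (H y)) = 1"
      unfolding A[OF y] by (rule u_U[OF y], rule u_eq[OF y])
  qed
  have fpos: "0 < f y" if "y \<in> ?S" for y using u_pos[OF that] by (simp add: f_def)
  have trA: "0 \<le> trace (conf_form (f y) (p y) (H y))" if "y \<in> ?S" for y
    unfolding A[OF that] trace_conf_hess[OF dim]
    by (intro mult_nonpos_nonpos mult_nonpos_nonneg)
       (use u_superharmonic[OF that] n in \<open>auto simp: n_def\<close>)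
  have trH: "0 \<le> trace (H y)" if "y \<in> ?S" for y
  proof -
    have "trace (conf_form (f y) (p y) (H y)) = f y * trace (H y) - p y \<bullet> p y / 2 * n"
      by (simp add: conf_form_def trace_sub n_def)
    moreover have "0 \<le> p y \<bullet> p y / 2 * n" using n by simp
    ultimately have "0 \<le> f y * trace (H y)" using trA[OF that] by linarith
    then show ?thesis using fpos[OF that] by (simp add: zero_le_mult_iff)
  qed
  have sph: "sphere 0 1 \<subseteq> ?S" by auto
  have "sphere (0::real^'n) 1 \<noteq> {}" by simp
  then obtain z where z: "z \<in> sphere 0 1" "\<And>y. y \<in> sphere 0 1 \<Longrightarrow> u z \<le> u y"
    using continuous_attains_inf[OF compact_sphere _ continuous_on_subset[OF ucont(1) sph]] by blast
  have uz: "0 < u z" using u_pos z(1) sph by blast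
  have ulow: "u z \<le> u y" if "0 < norm y" "norm y \<le> 1" for y
  proof (rule punctured_minimum_principle[OF dim zero_less_one, of u "grad u" "hess u" 0])
    show "continuous_on (cball 0 1 - {0}) u" by (rule continuous_on_subset[OF ucont(1)]) auto
    show "jet2 u (grad u) (hess u) y" if "y \<in> ball 0 1 - {0}" for y using that by (intro ujet) auto
    show "trace (hess u y) \<le> 0" if "y \<in> ball 0 1 - {0}" for y
      using u_superharmonic[of y] that by (simp add: laplacian_def)
    show "- 0 \<le> u y" if "y \<in> ball 0 1 - {0}" for y using u_pos[of y] that by (simp add: less_imp_le)
    show "u z \<le> u y" if "norm y = 1" for y using z(2) that by simp
    show "y \<in> cball 0 1 - {0}" using that by auto
  qed
  define M where "M = u z powr c"
  have M: "0 < M" using uz by (simp add: M_def)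
  have bound: "f y \<le> M" if "0 < norm y" "norm y \<le> 1" for y
    unfolding f_def M_def using uz ulow[OF that] c by (intro powr_mono2') auto
  obtain \<delta> where \<delta>: "0 < \<delta>" "\<And>A. A \<in> U \<Longrightarrow> norm A < \<delta> \<Longrightarrow> F A \<noteq> 1" using F_zero by blast
  \<comment> \<open>The factor 8 beats the loss \<open>(3/4)\<^sup>2 (2/3)\<^sup>2 = 1/4\<close> in the comparison on the unit sphere below.\<close>
  obtain \<rho> where \<rho>: "0 < \<rho>" "\<And>z. 0 < norm z \<Longrightarrow> norm z < \<rho> \<Longrightarrow> (8 * M) * (norm z)\<^sup>2 \<le> f z"
    using quadratic_growth[OF dim sol trH trA bound \<delta>, of "8 * M"] M by auto
  define \<epsilon> where "\<epsilon> = min (1/4) (\<rho> / 2)"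
  have \<epsilon>: "0 < \<epsilon>" "\<epsilon> \<le> 1/4" "\<epsilon> \<le> \<rho> / 2" using \<rho> by (auto simp: \<epsilon>_def)
  have spheres: "f y \<le> invert f x l y"
    if x: "norm x \<le> \<epsilon>" and l: "0 < l" "l < norm x" "l \<le> norm (y - x)" and y: "0 < norm y" "norm y \<le> 1"
    for x y l
  proof (rule moving_spheres[OF dim sol trH bound _ l(2) _ l(1) order_refl l(3) y])
    show x4: "norm x \<le> 1/4" using x \<epsilon> by simp
    fix l' and w :: "real^'n" assume l': "0 < l'" "l' \<le> l" and w: "norm w = 1"
    let ?z = "inversion x l' w"
    have wx: "3/4 \<le> norm (w - x)" using norm_triangle_ineq2[of w x] w x4 by simp
    have "w \<noteq> x" using w x4 by auto
    then have "norm (?z - x) = l'\<^sup>2 / norm (w - x)" by (rule norm_inversion)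
    also have "\<dots> \<le> l'\<^sup>2 / (3/4)" using wx by (intro divide_left_mono) auto
    also have "\<dots> \<le> norm x * (1/4) / (3/4)"
      unfolding power2_eq_square using l l' x4 by (intro divide_right_mono mult_mono) auto
    finally have zx: "norm (?z - x) \<le> norm x / 3" by simp
    have zl: "norm x * (2/3) \<le> norm ?z" using zx norm_triangle_ineq2[of x "x - ?z"] by (simp add: norm_minus_commute)
    have zu: "norm ?z \<le> norm x * (4/3)" using zx norm_triangle_ineq[of "?z - x" x] by simp
    have x0: "0 < norm x" using l by linarith
    have zl': "l' * (2/3) \<le> norm ?z" using zl l l' by linarith
    have "(8 * M) * (norm ?z)\<^sup>2 \<le> f ?z"
    proof (rule \<rho>(2))
      show "0 < norm ?z" using zl' l' by linarith
      show "norm ?z < \<rho>" using zu x \<epsilon> x0 by linarith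
    qed
    moreover have "(8 * M) * (l' * (2/3))\<^sup>2 \<le> (8 * M) * (norm ?z)\<^sup>2"
      using zl' l' M by (intro mult_left_mono power_mono) auto
    ultimately have fz: "(8 * M) * (l' * (2/3))\<^sup>2 \<le> f ?z" by linarith
    have "(3/4)\<^sup>2 * ((8 * M) * (l' * (2/3))\<^sup>2) \<le> (norm (w - x))\<^sup>2 * f ?z"
      using wx fz M by (intro mult_mono power_mono) auto
    then have "2 * M * l'\<^sup>2 \<le> (norm (w - x))\<^sup>2 * f ?z" by (simp add: power2_eq_square)
    then have "2 * M \<le> (norm (w - x))\<^sup>2 * f ?z / l'\<^sup>2" using l' by (simp add: pos_le_divide_eq)
    then have "2 * M \<le> invert f x l' w" by (simp add: invert_def)
    moreover have "f w \<le> M" by (rule bound) (simp_all add: w)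
    ultimately show "f w < invert f x l' w" using M by linarith
  qed
  have part1: "kelvin u x l y \<le> u y"
    if x: "0 < l" "l < norm x" "norm x \<le> \<epsilon>" "l \<le> norm (y - x)" "0 < norm y" "norm y \<le> 1" for x y l
  proof (rule ccontr)
    let ?r = "norm (y - x)"
    let ?z = "inversion x l y"
    have r: "0 < ?r" using x by linarith
    have "norm x \<le> 1/4" using x \<epsilon> by simp
    then have zS: "?z \<in> ?S" using inversion_in_domain[OF _ x(1,2,4)] by blast
    have yS: "y \<in> ?S" using x by auto
    have "real (CARD('n) - 2) = n - 2" using dim by (simp add: n_def)
    then have "(l / ?r) ^ (CARD('n) - 2) = (l / ?r) powr (n - 2)"
      using powr_realpow[of "l / ?r" "CARD('n) - 2"] x(1) r by simp
    then have k: "kelvin u x l y = (l / ?r) powr (n - 2) * u ?z"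
      by (simp add: kelvin_def inversion_def)
    have "(n - 2) * c = - 2" unfolding c_def using n by (simp del: right_diff_distrib_numeral left_diff_distrib_numeral)
    then have "((l / ?r) powr (n - 2)) powr c = (l / ?r) powr (- 2)"
      unfolding powr_powr by (rule arg_cong)
    also have "\<dots> = ?r\<^sup>2 / l\<^sup>2"
      using x(1) r by (simp add: powr_minus_divide power_divide)
    finally have kc: "(kelvin u x l y) powr c = invert f x l y"
      unfolding k using u_pos[OF zS] x(1) r by (simp add: powr_mult invert_def f_def)
    assume "\<not> kelvin u x l y \<le> u y"
    then have "(kelvin u x l y) powr c < u y powr c"
      using u_pos[OF yS] c by (intro powr_less_mono2_neg) auto
    then show False using spheres[OF x(3,1,2,4,5,6)] kc by (simp add: f_def)
  qed
  define k where "k = CARD('n)"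
  define C1 where "C1 = 3 ^ k * (4 / \<epsilon>)"
  have C1: "0 < C1" using \<epsilon> by (simp add: C1_def)
  have ratio: "u x / u y \<le> 1 + C1 * norm x"
    if xy: "norm x = norm y" "0 < norm x" "norm x \<le> \<epsilon> / 4" for x y
  proof (cases "x = y")
    case True
    have "y \<in> ?S" using xy \<epsilon> by auto
    then show ?thesis using True u_pos[of y] C1 xy by simp
  next
    case False
    let ?d = "norm (x - y)"
    have xS: "x \<in> ?S" "y \<in> ?S" using xy \<epsilon> by auto
    have xe: "norm x < \<epsilon>" using xy \<epsilon> by linarith
    obtain a s l where a: "norm a = \<epsilon>" "0 < l" "l < \<epsilon>" "0 < s" "l\<^sup>2 = s * (s + ?d)"
      "l\<^sup>2 = \<epsilon>\<^sup>2 - (norm x)\<^sup>2" "norm (y - a) = s + ?d" "inversion a l y = x"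
      by (rule inversion_exchanging[OF False xy(1,2) xe])
    have d0: "0 < ?d" using False by simp
    have d2: "?d \<le> 2 * norm x" using norm_triangle_ineq4[of x y] xy by simp
    have s: "\<epsilon> / 2 \<le> s"
    proof (rule ccontr)
      assume "\<not> \<epsilon> / 2 \<le> s"
      then have "s < \<epsilon> / 2" by simp
      moreover have "?d \<le> \<epsilon> / 2" using d2 xy by simp
      ultimately have "s * (s + ?d) \<le> \<epsilon> / 2 * \<epsilon>" using a(4) \<epsilon> by (intro mult_mono) auto
      moreover have "(norm x)\<^sup>2 \<le> (\<epsilon> / 4)\<^sup>2" using xy by (intro power_mono) auto
      moreover have "0 < \<epsilon>\<^sup>2" using \<epsilon> by simp
      ultimately show False using a(5,6) by (simp add: power2_eq_square)
    qed
    have "s * (s + ?d) \<le> (s + ?d) * (s + ?d)" using a(4) d0 by (intro mult_right_mono) auto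
    then have "l\<^sup>2 \<le> (norm (y - a))\<^sup>2" unfolding a(5,7) by (simp only: power2_eq_square)
    then have ly: "l \<le> norm (y - a)" by (rule power2_le_imp_le) simp
    have "f y \<le> invert f a l y"
      by (rule spheres) (use a ly xy \<epsilon> in auto)
    also have "\<dots> = (s + ?d) / s * f x"
    proof -
      have "0 < s + ?d" using a(4) d0 by (rule add_pos_pos)
      then have "(s + ?d)\<^sup>2 / (s * (s + ?d)) = (s + ?d) / s" by (simp add: power2_eq_square)
      then show ?thesis unfolding invert_def a(8) a(7) a(5) by simp
    qed
    finally have fyx: "f y \<le> (1 + ?d / s) * f x" using a(4) by (simp add: add_divide_distrib)
    have "?d / s \<le> 2 * norm x / (\<epsilon> / 2)" using d2 s \<epsilon> d0 by (intro frac_le) auto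
    then have ds: "1 + ?d / s \<le> 1 + 4 / \<epsilon> * norm x" by simp
    define t where "t = 4 / \<epsilon> * norm x"
    have t: "0 \<le> t" "t \<le> 1" using xy \<epsilon> by (auto simp: t_def field_simps)
    have "(1 + ?d / s) * f x \<le> (1 + t) * f x"
      using ds fpos[OF xS(1)] by (intro mult_right_mono) (auto simp: t_def)
    then have fyx: "f y \<le> (1 + t) * f x" using fyx by linarith
    define \<gamma> where "\<gamma> = (n - 2) / 2"
    have "c * (- \<gamma>) = 1"
      unfolding c_def \<gamma>_def using n by (simp del: right_diff_distrib_numeral left_diff_distrib_numeral)
    then have uf: "u w = f w powr (- \<gamma>)" if "w \<in> ?S" for w
      unfolding f_def powr_powr using u_pos[OF that] by simp
    have "((1 + t) * f x) powr (- \<gamma>) \<le> f y powr (- \<gamma>)"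
      using fpos[OF xS(2)] fyx n by (intro powr_mono2') (auto simp: \<gamma>_def)
    then have "(1 + t) powr (- \<gamma>) * u x \<le> u y"
      using t fpos[OF xS(1)] by (simp add: powr_mult uf[OF xS(1)] uf[OF xS(2)])
    then have "(1 + t) powr \<gamma> * ((1 + t) powr (- \<gamma>) * u x) \<le> (1 + t) powr \<gamma> * u y"
      by (intro mult_left_mono) auto
    moreover have "(1 + t) powr \<gamma> * ((1 + t) powr (- \<gamma>) * u x) = u x"
      using t by (simp add: mult.assoc[symmetric] powr_add[symmetric])
    ultimately have "u x / u y \<le> (1 + t) powr \<gamma>"
      using u_pos[OF xS(2)] by (simp add: pos_divide_le_eq)
    also have "\<dots> \<le> (1 + t) powr (real k)"
      using t n by (intro powr_mono) (auto simp: \<gamma>_def k_def n_def)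
    also have "\<dots> = (1 + t) ^ k" using t by (simp add: powr_realpow)
    also have "\<dots> \<le> 1 + 3 ^ k * t" by (rule one_plus_power_le[OF t])
    finally show ?thesis by (simp add: t_def C1_def mult_ac)
  qed
  have small: "\<bar>u x / u y - 1\<bar> \<le> C1 * norm x"
    if xy: "norm x = norm y" "0 < norm x" "norm x \<le> \<epsilon> / 4" for x y
  proof -
    have xS: "x \<in> ?S" "y \<in> ?S" using xy \<epsilon> by auto
    have up: "0 < u x" "0 < u y" using u_pos xS by auto
    have 1: "u x / u y \<le> 1 + C1 * norm x" by (rule ratio[OF xy])
    have "u y / u x \<le> 1 + C1 * norm x" using ratio[of y x] xy by simp
    then have "u y \<le> (1 + C1 * norm x) * u x" using up by (simp add: pos_divide_le_eq)
    have q0: "0 < C1 * norm x" using C1 xy by simp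
    have "1 - C1 * norm x \<le> u x / u y"
    proof -
      have "(1 - C1 * norm x) * u y \<le> u x"
      proof (cases "1 - C1 * norm x \<le> 0")
        case True
        then have "(1 - C1 * norm x) * u y \<le> 0" using up by (simp add: mult_nonpos_nonneg)
        then show ?thesis using up by linarith
      next
        case False
        then have "(1 - C1 * norm x) * u y \<le> (1 - C1 * norm x) * ((1 + C1 * norm x) * u x)"
          using \<open>u y \<le> (1 + C1 * norm x) * u x\<close> by (intro mult_left_mono) auto
        also have "\<dots> = u x - (C1 * norm x) * (C1 * norm x) * u x" by (simp add: algebra_simps)
        also have "\<dots> \<le> u x" using up by simp
        finally show ?thesis .
      qed
      then show ?thesis using up by (simp add: pos_le_divide_eq)
    qed
    then show ?thesis using 1 by linarith
  qed
  define N where "N = (cball 0 1 - ball 0 (\<epsilon> / 4) :: (real^'n) set)"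
  have NS: "N \<subseteq> ?S" using \<epsilon> by (auto simp: N_def)
  have "compact N" unfolding N_def by (intro compact_diff compact_cball open_ball)
  then obtain B where B: "0 \<le> B" "\<And>y. y \<in> N \<Longrightarrow> norm (u y) \<le> B"
    using continuous_on_compact_bound[OF _ continuous_on_subset[OF ucont(1) NS]] by blast
  define C2 where "C2 = (B / u z + 1) * (4 / \<epsilon>)"
  have C2: "0 < C2" using B uz \<epsilon> by (simp add: C2_def add_nonneg_pos)
  have large: "\<bar>u x / u y - 1\<bar> \<le> C2 * norm x"
    if xy: "norm x = norm y" "norm x < 1" "\<epsilon> / 4 < norm x" for x y
  proof -
    have x0: "0 < norm x" using xy(3) \<epsilon>(1) by linarith
    have N: "x \<in> N" "y \<in> N" using xy by (auto simp: N_def)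
    have up: "0 < u x" "0 < u y" by (intro u_pos subsetD[OF NS] N)+
    have "u x \<le> B" using B(2)[OF N(1)] by simp
    moreover have "u z \<le> u y" using ulow[of y] xy x0 by simp
    ultimately have "u x / u y \<le> B / u z" using B(1) uz by (intro frac_le) auto
    moreover have "0 < u x / u y" using up by simp
    ultimately have "\<bar>u x / u y - 1\<bar> \<le> B / u z + 1" by linarith
    also have "\<dots> \<le> (B / u z + 1) * (4 / \<epsilon> * norm x)"
    proof -
      have "1 \<le> 4 / \<epsilon> * norm x" using xy \<epsilon> by (simp add: field_simps)
      then have "(B / u z + 1) * 1 \<le> (B / u z + 1) * (4 / \<epsilon> * norm x)"
        using B uz by (intro mult_left_mono) (auto simp: add_nonneg_nonneg)
      then show ?thesis by simp
    qed
    finally show ?thesis unfolding C2_def by (simp only: mult.assoc)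
  qed
  have part2: "\<bar>u x / u y - 1\<bar> \<le> max C1 C2 * r"
    if "0 < r" "r = norm x" "norm x = norm y" "r < 1" for r x y
  proof (cases "norm x \<le> \<epsilon> / 4")
    case True
    have "C1 * norm x \<le> max C1 C2 * norm x" by (intro mult_right_mono) auto
    with small[of x y] that True have "\<bar>u x / u y - 1\<bar> \<le> max C1 C2 * norm x" by linarith
    then show ?thesis unfolding that(2) .
  next
    case False
    have "C2 * norm x \<le> max C1 C2 * norm x" by (intro mult_right_mono) auto
    with large[of x y] that False have "\<bar>u x / u y - 1\<bar> \<le> max C1 C2 * norm x" by linarith
    then show ?thesis unfolding that(2) .
  qed
  have "0 < max C1 C2" using C1 by simp
  have "\<exists>\<epsilon>>0. \<forall>x l y. 0 < l \<and> l < norm x \<and> norm x \<le> \<epsilon> \<and> norm (y - x) \<ge> l \<and>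
      0 < norm y \<and> norm y \<le> 1 \<longrightarrow> kelvin u x l y \<le> u y"
  proof (intro exI[of _ \<epsilon>] conjI allI impI \<epsilon>(1))
    fix x y :: "real^'n" and l :: real
    assume "0 < l \<and> l < norm x \<and> norm x \<le> \<epsilon> \<and> norm (y - x) \<ge> l \<and> 0 < norm y \<and> norm y \<le> 1"
    then show "kelvin u x l y \<le> u y" using part1 by blast
  qed
  moreover have "\<exists>C>0. \<forall>r x y. 0 < r \<and> r = norm x \<and> norm x = norm y \<and> r < 1 \<longrightarrow>
      \<bar>u x / u y - 1\<bar> \<le> C * r"
  proof (intro exI[of _ "max C1 C2"] conjI allI impI \<open>0 < max C1 C2\<close>)
    fix x y :: "real^'n" and r :: real
    assume "0 < r \<and> r = norm x \<and> norm x = norm y \<and> r < 1"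
    then show "\<bar>u x / u y - 1\<bar> \<le> max C1 C2 * r" using part2[of r x y] by blast
  qed
  ultimately show ?thesis ..
qed

end
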